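(* Let $E$ be a regular compact subset of $\mathbb{C}$ and fix $\varepsilon\in(0,1]$. Then there exist an arbitrarily small number $s>0$ and a polynomial $P$ (chosen for this $s$) of degree at least $2$ such that $$E\subset\mathcal{K}(P)\subset E_s\subset\big(\widehat E\big)^{\varepsilon};$$ that is, for every $s_0>0$ there are $s\in(0,s_0)$ and such a polynomial $P$. In particular, $\Gamma(E,\mathcal{K}(P))\le s$ and $\chi(\widehat E,\mathcal{K}(P))\le\varepsilon$.
   Context: For compact $E\subset\mathbb{C}$, $\widehat E=\{z\in\mathbb{C}:|p(z)|\le\max_{w\in E}|p(w)|\text{ for every complex polynomial }p\}$. $E$ is regular if the Green function of $D_\infty=\mathbb{C}\setminus\widehat E$ with pole at infinity exists: a function $g_E$, harmonic and positive in $D_\infty$, with $g_E(z)\to0$ as $z\to\partial D_\infty$ and $g_E(z)-\log|z|$ tending to a finite number as $z\to\infty$. It is extended by $0$ on $\widehat E$ to a continuous function on $\mathbb{C}$. Notation: $E_s=\{z\in\mathbb{C}:g_E(z)\le s\}$; for $F\subset\mathbb{C}$, $F^\varepsilon=\{z\in\mathbb{C}:\mathrm{dist}(z,F)<\varepsilon\}$. For a complex polynomial $P$ of degree at least $2$, the filled-in Julia set is $\mathcal{K}(P)=\{z\in\mathbb{C}:(P^{\circ n}(z))_{n\ge1}\text{ is bounded}\}$, where $P^{\circ n}$ is the $n$-th iterate (it is compact, polynomially convex and regular). $\chi$ is the Hausdorff metric on nonempty compact sets. For compact regular $E,F$, $\Gamma(E,F)=\max(\sup_F g_E,\ \sup_E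 g_F)$. *)

theory Defs
  imports "HOL-Analysis.Analysis" "HOL-Computational_Algebra.Polynomial"
begin

definition polynomial_hull :: "complex set \<Rightarrow> complex set" where
  "polynomial_hull E = {z. \<forall>p :: complex poly. cmod (poly p z) \<le> (SUP w\<in>E. cmod (poly p w))}"

text \<open>
  Classical harmonicity, with \<open>z = x + i y\<close>: \<open>u\<close> is \<open>C\<^sup>2\<close> on the open set \<open>S\<close> and
  \<open>u\<^sub>x\<^sub>x + u\<^sub>y\<^sub>y = 0\<close> there. The functions \<open>ux\<close>, \<open>uy\<close>, \<open>uxx\<close>, \<open>uxy\<close>, \<open>uyx\<close>, \<open>uyy\<close> are the
  partial derivatives; derivatives are real Frechet derivatives on the plane.
\<close>
definition harmonic_on :: "(complex \<Rightarrow> real) \<Rightarrow> complex set \<Rightarrow> bool" where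
  "harmonic_on u S \<longleftrightarrow> open S \<and>
     (\<exists>ux uy uxx uxy uyx uyy :: complex \<Rightarrow> real.
        (\<forall>z\<in>S. (u has_derivative (\<lambda>h. ux z * Re h + uy z * Im h)) (at z)) \<and>
        (\<forall>z\<in>S. (ux has_derivative (\<lambda>h. uxx z * Re h + uxy z * Im h)) (at z)) \<and>
        (\<forall>z\<in>S. (uy has_derivative (\<lambda>h. uyx z * Re h + uyy z * Im h)) (at z)) \<and>
        continuous_on S uxx \<and> continuous_on S uxy \<and>
        continuous_on S uyx \<and> continuous_on S uyy \<and>
        (\<forall>z\<in>S. uxx z + uyy z = 0))"

definition D_inf :: "complex set \<Rightarrow> complex set" where
  "D_inf E = - polynomial_hull E"

text \<open>The last conjunct is the extension by \<open>0\<close> to the whole plane.\<close>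
definition is_green_function :: "complex set \<Rightarrow> (complex \<Rightarrow> real) \<Rightarrow> bool" where
  "is_green_function E g \<longleftrightarrow>
     harmonic_on g (D_inf E) \<and>
     (\<forall>z\<in>D_inf E. 0 < g z) \<and>
     (\<forall>\<zeta>\<in>frontier (D_inf E). (g \<longlongrightarrow> 0) (at \<zeta> within D_inf E)) \<and>
     (\<exists>c :: real. ((\<lambda>z. g z - ln (cmod z)) \<longlongrightarrow> c) at_infinity) \<and>
     (\<forall>z\<in>polynomial_hull E. g z = 0)"

definition regular_compact :: "complex set \<Rightarrow> bool" where
  "regular_compact E \<longleftrightarrow> compact E \<and> (\<exists>g. is_green_function E g)"

text \<open>Only meaningful for regular compact sets, for which the Green function is unique.\<close>
definition green_function :: "complex set \<Rightarrow> complex \<Rightarrow> real" where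
  "green_function E = (THE g. is_green_function E g)"

definition green_sublevel :: "complex set \<Rightarrow> real \<Rightarrow> complex set" where
  "green_sublevel E s = {z. green_function E z \<le> s}"

text \<open>The guard is needed because \<open>infdist z {} = 0\<close>.\<close>
definition open_nbhd :: "complex set \<Rightarrow> real \<Rightarrow> complex set" where
  "open_nbhd F \<epsilon> = {z. F \<noteq> {} \<and> infdist z F < \<epsilon>}"

definition filled_julia :: "complex poly \<Rightarrow> complex set" where
  "filled_julia P = {z. bounded ((\<lambda>n. (poly P ^^ n) z) ` {1..})}"

definition hausdorff_dist :: "complex set \<Rightarrow> complex set \<Rightarrow> real" where
  "hausdorff_dist A B = max (SUP a\<in>A. infdist a B) (SUP b\<in>B. infdist b A)"

definition Gamma_dist :: "complex set \<Rightarrow> complex set \<Rightarrow> real" where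
  "Gamma_dist E F = max (SUP z\<in>F. green_function E z) (SUP z\<in>E. green_function F z)"

end

theory Submission
  imports Defs "HOL-Complex_Analysis.Cauchy_Integral_Formula"
begin

text \<open>
  Let \<open>g\<close> be the Green function of \<open>E\<close>. It tends to infinity at infinity and its zero set is the
  compact hull of \<open>E\<close>, so for small \<open>s\<close> the set \<open>g \<le> s\<close> lies in the \<open>\<epsilon>\<close>-neighbourhood of the hull
  (\<open>sublevel_in_nbhd\<close>). Everything else follows from a polynomial \<open>P\<close> whose filled Julia set \<open>K\<close>
  contains the hull and lies inside \<open>g < s\<close>: both terms of the Hausdorff distance are then at most
  \<open>\<epsilon>\<close>, and \<open>g \<le> s\<close> on \<open>K\<close> while the Green function of \<open>K\<close> vanishes on \<open>E\<close>.

  Such a \<open>P\<close> comes from a Hilbert lemniscate. Suppose \<open>p\<close> is a polynomial with \<open>\<bar>p\<bar> \<le> 1/2\<close> on the hull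
  and \<open>\<bar>p\<bar> \<ge> 1\<close> where \<open>g \<ge> s\<close>. Put \<open>P = a + C p\<^sup>k\<close> with \<open>a\<close> in the hull, \<open>C\<close> large and then \<open>k\<close>
  so large that \<open>C (3/4)\<^sup>k\<close> is tiny. Where \<open>\<bar>p\<bar> < 3/4\<close>, one step leads into a small disc around \<open>a\<close>,
  on which again \<open>\<bar>p\<bar> < 3/4\<close>; where \<open>\<bar>p\<bar> \<ge> 1\<close>, one step leads to distance at least \<open>C\<close> from \<open>a\<close>,
  and from there the orbit escapes (\<open>filled_julia_near_lemniscate\<close>).

  To find \<open>p\<close> it suffices to find finitely many points \<open>w\<^sub>i\<close> with weights \<open>c\<^sub>i \<ge> 0\<close> such that
  \<open>\<Sum> c\<^sub>i ln \<bar>z - w\<^sub>i\<bar>\<close> is larger, by a fixed amount, on \<open>g \<ge> s\<close> than on the hull: multiply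
  the weights by a large integer, round them down and use them as multiplicities of zeros
  (\<open>lemniscate\<close>). Classically, \<open>g\<close> is the potential of the equilibrium measure up to a constant, and
  one discretises that measure. Here \<open>g\<close> is first composed with a convex cut-off \<open>H\<close> that vanishes near
  \<open>0\<close> and is affine beyond \<open>s/2\<close>. The Laplacian of \<open>H \<circ> g\<close> is \<open>H''(g) \<bar>\<nabla>g\<bar>\<^sup>2 \<ge> 0\<close>, a continuous
  density supported where \<open>s/4 \<le> g \<le> s/2\<close>, away from both sets to be separated, and by Green's
  identity its potential is \<open>H \<circ> g\<close> up to a constant. The identity is only needed approximately,
  and it is obtained without integration: on a fine square grid the five-point Laplacian is symmetric
  (\<open>sum_by_parts_grid\<close>), and for \<open>C\<^sup>2\<close> functions it is uniformly close to the Laplacian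
  (\<open>five_point_approx\<close>). The values of the density at the grid points are the weights
  (\<open>discrete_potential\<close>).

  The statement speaks of \<^emph>\<open>the\<close> Green function, so uniqueness is needed, and existence for \<open>K\<close>.
  Uniqueness is the maximum principle applied to \<open>g - (1 + \<delta>) h\<close>, which tends to \<open>-\<infinity>\<close> at infinity
  (\<open>green_le\<close>). For existence, near infinity \<open>ln \<bar>z\<bar>\<close> is corrected by the real part of a convergent series
  of holomorphic functions into a solution of \<open>G(P z) = d G(z)\<close>, with \<open>d\<close> the degree of \<open>P\<close>;
  this functional equation then extends \<open>G\<close> to the complement of \<open>K\<close> (\<open>julia_green_is_green\<close>).
\<close>

section \<open>The maximum principle and the Green function\<close>

lemma DERIV_along_line:
  fixes u :: "complex \<Rightarrow> real"
  assumes "(u has_derivative (\<lambda>h. A * Re h + B * Im h)) (at (z + of_real t * e))"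
  shows "((\<lambda>t. u (z + of_real t * e)) has_real_derivative (A * Re e + B * Im e)) (at t)"
proof -
  have "((\<lambda>t::real. z + of_real t * e) has_derivative (\<lambda>h. of_real h * e)) (at t)"
    by (auto intro!: derivative_eq_intros)
  from has_derivative_compose[OF this assms]
  have "((\<lambda>t. u (z + of_real t * e)) has_derivative (\<lambda>h. A * Re (of_real h * e) + B * Im (of_real h * e))) (at t)" .
  moreover have "(\<lambda>h. A * Re (of_real h * e) + B * Im (of_real h * e)) = (*) (A * Re e + B * Im e)"
    by (auto simp: fun_eq_iff algebra_simps)
  ultimately show ?thesis
    by (simp add: has_field_derivative_def)
qed

text \<open>
  If \<open>l\<close> were positive, \<open>f'\<close> would be positive just to the right of \<open>0\<close>, and \<open>f\<close> would increase there.
\<close>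
lemma second_derivative_nonpos_at_max:
  fixes f f' :: "real \<Rightarrow> real"
  assumes "0 < r"
    and f': "\<And>t. \<bar>t\<bar> < r \<Longrightarrow> (f has_real_derivative f' t) (at t)"
    and f'': "(f' has_real_derivative l) (at 0)"
    and max: "\<And>t. \<bar>t\<bar> < r \<Longrightarrow> f t \<le> f 0"
  shows "l \<le> 0"
proof (rule ccontr)
  assume "\<not> l \<le> 0"
  have "f' 0 = 0"
    using DERIV_local_max[OF f'[of 0] \<open>0 < r\<close>] max \<open>0 < r\<close> by auto
  obtain d where d: "d > 0" "\<And>h. 0 < h \<Longrightarrow> h < d \<Longrightarrow> f' 0 < f' (0 + h)"
    using DERIV_pos_inc_right[OF f''] \<open>\<not> l \<le> 0\<close> by auto
  define h where "h = min d r / 2"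
  have h: "0 < h" "h < d" "h < r" using d \<open>0 < r\<close> by (auto simp: h_def)
  obtain x where "0 < x" "x < h" "f h - f 0 = (h - 0) * f' x"
    using MVT2[of 0 h f f'] f' h by force
  moreover have "f' x > 0" using d(2)[of x] \<open>f' 0 = 0\<close> h \<open>0 < x\<close> \<open>x < h\<close> by auto
  ultimately have "f h > f 0" using h by (simp add: algebra_simps)
  then show False using max[of h] h by auto
qed

lemma harmonic_on_lincomb:
  assumes "harmonic_on u S" "harmonic_on v S"
  shows "harmonic_on (\<lambda>z. a * u z + b * v z + c) S"
proof -
  obtain ux uy uxx uxy uyx uyy where u:
    "\<forall>z\<in>S. (u has_derivative (\<lambda>h. ux z * Re h + uy z * Im h)) (at z)"
    "\<forall>z\<in>S. (ux has_derivative (\<lambda>h. uxx z * Re h + uxy z * Im h)) (at z)"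
    "\<forall>z\<in>S. (uy has_derivative (\<lambda>h. uyx z * Re h + uyy z * Im h)) (at z)"
    "continuous_on S uxx" "continuous_on S uxy" "continuous_on S uyx" "continuous_on S uyy"
    "\<forall>z\<in>S. uxx z + uyy z = 0"
    using assms(1) unfolding harmonic_on_def by blast
  obtain vx vy vxx vxy vyx vyy where v:
    "\<forall>z\<in>S. (v has_derivative (\<lambda>h. vx z * Re h + vy z * Im h)) (at z)"
    "\<forall>z\<in>S. (vx has_derivative (\<lambda>h. vxx z * Re h + vxy z * Im h)) (at z)"
    "\<forall>z\<in>S. (vy has_derivative (\<lambda>h. vyx z * Re h + vyy z * Im h)) (at z)"
    "continuous_on S vxx" "continuous_on S vxy" "continuous_on S vyx" "continuous_on S vyy"
    "\<forall>z\<in>S. vxx z + vyy z = 0"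
    using assms(2) unfolding harmonic_on_def by blast
  have comb: "((\<lambda>z. a * p z + b * q z + k) has_derivative (\<lambda>h. (a * p1 + b * q1) * Re h + (a * p2 + b * q2) * Im h)) (at z)"
    if "(p has_derivative (\<lambda>h. p1 * Re h + p2 * Im h)) (at z)" "(q has_derivative (\<lambda>h. q1 * Re h + q2 * Im h)) (at z)"
    for p q :: "complex \<Rightarrow> real" and p1 p2 q1 q2 k z
    using that by (auto intro!: derivative_eq_intros simp: algebra_simps)
  show ?thesis
    unfolding harmonic_on_def
  proof (intro conjI exI)
    show "open S" using assms(1) by (simp add: harmonic_on_def)
    show "\<forall>z\<in>S. ((\<lambda>z. a * u z + b * v z + c) has_derivative
        (\<lambda>h. (a * ux z + b * vx z + 0) * Re h + (a * uy z + b * vy z + 0) * Im h)) (at z)"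
      using u v by (auto intro!: comb)
    show "\<forall>z\<in>S. ((\<lambda>z. a * ux z + b * vx z + 0) has_derivative
        (\<lambda>h. (a * uxx z + b * vxx z) * Re h + (a * uxy z + b * vxy z) * Im h)) (at z)"
      using u v by (intro ballI comb) auto
    show "\<forall>z\<in>S. ((\<lambda>z. a * uy z + b * vy z + 0) has_derivative
        (\<lambda>h. (a * uyx z + b * vyx z) * Re h + (a * uyy z + b * vyy z) * Im h)) (at z)"
      using u v by (intro ballI comb) auto
    show "\<forall>z\<in>S. a * uxx z + b * vxx z + (a * uyy z + b * vyy z) = 0"
    proof
      fix z assume "z \<in> S"
      have "a * uxx z + b * vxx z + (a * uyy z + b * vyy z) = a * (uxx z + uyy z) + b * (vxx z + vyy z)"
        by (simp add: algebra_simps)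
      then show "a * uxx z + b * vxx z + (a * uyy z + b * vyy z) = 0"
        using u(8) v(8) \<open>z \<in> S\<close> by simp
    qed
  qed (use u v in \<open>auto intro!: continuous_intros\<close>)
qed

lemma harmonic_on_imp_continuous_on: "harmonic_on u S \<Longrightarrow> continuous_on S u"
  unfolding harmonic_on_def
  by (meson continuous_at_imp_continuous_on has_derivative_continuous)

text \<open>
  Compactness of the superlevel sets replaces boundary conditions: it says that \<open>v\<close> has no
  positive limit value at the boundary of \<open>D\<close> or at infinity. A positive value of \<open>v\<close> would survive
  adding a small multiple of \<open>\<bar>z\<bar>\<^sup>2\<close>; the sum then has an interior maximum, where its Laplacian is
  at most \<open>0\<close>, although it equals that of \<open>\<bar>z\<bar>\<^sup>2\<close> and is positive.
\<close>
lemma maximum_principle: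
  assumes "harmonic_on v D"
    and cpt: "\<And>c. 0 < c \<Longrightarrow> compact {z\<in>D. c \<le> v z}"
    and "z0 \<in> D"
  shows "v z0 \<le> 0"
proof (rule ccontr)
  assume "\<not> v z0 \<le> 0"
  define m where "m = v z0"
  have "m > 0" using \<open>\<not> v z0 \<le> 0\<close> by (simp add: m_def)
  define K where "K = {z\<in>D. m/2 \<le> v z}"
  have "compact K" unfolding K_def using \<open>m > 0\<close> by (intro cpt) auto
  have "z0 \<in> K" using \<open>z0 \<in> D\<close> \<open>m > 0\<close> by (simp add: K_def m_def)
  have contv: "continuous_on D v" by (rule harmonic_on_imp_continuous_on[OF assms(1)])
  obtain ux uy uxx uxy uyx uyy where "open D" and u:
    "\<forall>z\<in>D. (v has_derivative (\<lambda>h. ux z * Re h + uy z * Im h)) (at z)"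
    "\<forall>z\<in>D. (ux has_derivative (\<lambda>h. uxx z * Re h + uxy z * Im h)) (at z)"
    "\<forall>z\<in>D. (uy has_derivative (\<lambda>h. uyx z * Re h + uyy z * Im h)) (at z)"
    "\<forall>z\<in>D. uxx z + uyy z = 0"
    using assms(1) unfolding harmonic_on_def by blast
  obtain B where B: "B > 0" "\<And>z. z \<in> K \<Longrightarrow> cmod z \<le> B"
    using compact_imp_bounded[OF \<open>compact K\<close>] bounded_pos by blast
  define \<eta> where "\<eta> = m / (4 * B\<^sup>2)"
  have "\<eta> > 0" using \<open>m > 0\<close> B by (simp add: \<eta>_def)
  define w where "w z = v z + \<eta> * ((Re z)\<^sup>2 + (Im z)\<^sup>2)" for z
  \<comment> \<open>the maximum of the perturbed function lies in the interior of K, as v exceeds m/2 there\<close>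
  have "continuous_on K w"
    unfolding w_def using contv by (intro continuous_intros continuous_on_subset[OF contv]) (auto simp: K_def)
  then obtain z1 where z1: "z1 \<in> K" "\<And>z. z \<in> K \<Longrightarrow> w z \<le> w z1"
    using continuous_attains_sup[of K w] \<open>compact K\<close> \<open>z0 \<in> K\<close> by blast
  have small: "\<eta> * ((Re z)\<^sup>2 + (Im z)\<^sup>2) \<le> m/4" if "z \<in> K" for z
  proof -
    have "(Re z)\<^sup>2 + (Im z)\<^sup>2 \<le> B\<^sup>2"
      using B(2)[OF that] by (simp add: cmod_power2[symmetric] power_mono)
    then have "\<eta> * ((Re z)\<^sup>2 + (Im z)\<^sup>2) \<le> \<eta> * B\<^sup>2" using \<open>\<eta> > 0\<close> by simp
    also have "\<dots> = m/4" using B by (simp add: \<eta>_def)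
    finally show ?thesis .
  qed
  have "m \<le> w z0" using \<open>\<eta> > 0\<close> by (simp add: w_def m_def)
  also have "\<dots> \<le> w z1" using z1 \<open>z0 \<in> K\<close> by blast
  finally have "v z1 \<ge> 3*m/4" using small[OF z1(1)] by (simp add: w_def)
  then have "v z1 > m/2" using \<open>m > 0\<close> by simp
  have "z1 \<in> D" using z1 by (simp add: K_def)
  have "open {z\<in>D. m/2 < v z}"
    using continuous_open_preimage[OF contv \<open>open D\<close>, of "{m/2<..}"]
    by (simp add: vimage_def Int_def)
  then obtain r where r: "r > 0" "ball z1 r \<subseteq> {z\<in>D. m/2 < v z}"
    using \<open>z1 \<in> D\<close> \<open>v z1 > m/2\<close> open_contains_ball by (metis (mono_tags, lifting) mem_Collect_eq)
  have w1: "(w has_derivative (\<lambda>h. (ux z + 2 * \<eta> * Re z) * Re h + (uy z + 2 * \<eta> * Im z) * Im h)) (at z)"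
    if "z \<in> D" for z
    unfolding w_def using u(1) that by (auto intro!: derivative_eq_intros simp: algebra_simps)
  have w2: "((\<lambda>z. ux z + 2 * \<eta> * Re z) has_derivative (\<lambda>h. (uxx z + 2*\<eta>) * Re h + uxy z * Im h)) (at z)"
    if "z \<in> D" for z
    using u(2) that by (auto intro!: derivative_eq_intros simp: algebra_simps)
  have w3: "((\<lambda>z. uy z + 2 * \<eta> * Im z) has_derivative (\<lambda>h. uyx z * Re h + (uyy z + 2*\<eta>) * Im h)) (at z)"
    if "z \<in> D" for z
    using u(3) that by (auto intro!: derivative_eq_intros simp: algebra_simps)
  have inD: "z1 + of_real t * e \<in> ball z1 r" if "\<bar>t\<bar> < r" "cmod e = 1" for t e
    using that by (simp add: dist_norm norm_mult)
  have le: "w (z1 + of_real t * e) \<le> w (z1 + of_real 0 * e)" if "\<bar>t\<bar> < r" "cmod e = 1" for t e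
  proof -
    have "z1 + of_real t * e \<in> K" using inD[OF that] r unfolding K_def by force
    then show ?thesis using z1 by simp
  qed
  have "uxx z1 + 2 * \<eta> \<le> 0"
  proof (rule second_derivative_nonpos_at_max[OF \<open>r > 0\<close>])
    show "((\<lambda>t. w (z1 + of_real t * 1)) has_real_derivative (\<lambda>t. ux (z1 + of_real t * 1) + 2 * \<eta> * Re (z1 + of_real t * 1)) t) (at t)"
      if "\<bar>t\<bar> < r" for t
      using DERIV_along_line[OF w1, of z1 t 1] inD[OF that, of 1] r by auto
    show "((\<lambda>t. ux (z1 + of_real t * 1) + 2 * \<eta> * Re (z1 + of_real t * 1)) has_real_derivative uxx z1 + 2 * \<eta>) (at 0)"
      using DERIV_along_line[OF w2, of z1 0 1] \<open>z1 \<in> D\<close> by auto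
    show "w (z1 + of_real t * 1) \<le> w (z1 + of_real 0 * 1)" if "\<bar>t\<bar> < r" for t
      using le[OF that, of 1] by simp
  qed
  moreover have "uyy z1 + 2 * \<eta> \<le> 0"
  proof (rule second_derivative_nonpos_at_max[OF \<open>r > 0\<close>])
    show "((\<lambda>t. w (z1 + of_real t * \<i>)) has_real_derivative (\<lambda>t. uy (z1 + of_real t * \<i>) + 2 * \<eta> * Im (z1 + of_real t * \<i>)) t) (at t)"
      if "\<bar>t\<bar> < r" for t
      using DERIV_along_line[OF w1, of z1 t \<i>] inD[OF that, of \<i>] r by auto
    show "((\<lambda>t. uy (z1 + of_real t * \<i>) + 2 * \<eta> * Im (z1 + of_real t * \<i>)) has_real_derivative uyy z1 + 2 * \<eta>) (at 0)"
      using DERIV_along_line[OF w3, of z1 0 \<i>] \<open>z1 \<in> D\<close> by auto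
    show "w (z1 + of_real t * \<i>) \<le> w (z1 + of_real 0 * \<i>)" if "\<bar>t\<bar> < r" for t
      using le[OF that, of \<i>] by simp
  qed
  moreover have "uxx z1 + uyy z1 = 0" using u(4) \<open>z1 \<in> D\<close> by blast
  ultimately show False using \<open>\<eta> > 0\<close> by linarith
qed

lemma closed_polynomial_hull: "closed (polynomial_hull E)"
proof -
  have "polynomial_hull E = (\<Inter>p. {z. cmod (poly p z) \<le> (SUP w\<in>E. cmod (poly p w))})"
    by (auto simp: polynomial_hull_def)
  also have "closed \<dots>"
    by (intro closed_INT ballI closed_Collect_le continuous_intros)
  finally show ?thesis .
qed

lemma polynomial_hull_superset:
  assumes "compact E" shows "E \<subseteq> polynomial_hull E"
proof -
  have "bdd_above ((\<lambda>w. cmod (poly p w)) ` E)" for p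
    by (intro bounded_imp_bdd_above compact_imp_bounded compact_continuous_image assms continuous_intros)
  then show ?thesis unfolding polynomial_hull_def by (auto intro: cSUP_upper)
qed

text \<open>
  The supremum of the empty set is some real number, and a constant polynomial exceeds it.
\<close>
lemma polynomial_hull_empty: "polynomial_hull {} = {}"
proof -
  have "\<not> z \<in> polynomial_hull {}" for z
  proof
    assume "z \<in> polynomial_hull {}"
    then have "cmod (poly [:of_real (\<bar>Sup {}\<bar> + 1):] z) \<le> Sup {}"
      unfolding polynomial_hull_def mem_Collect_eq image_empty by (rule spec)
    moreover have "cmod (poly [:of_real (\<bar>Sup {}\<bar> + 1):] z) = \<bar>Sup {}\<bar> + (1::real)"
      using norm_of_real[of "\<bar>Sup {}\<bar> + 1", where ?'a = complex] by (simp del: of_real_add)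
    ultimately show False by linarith
  qed
  then show ?thesis by blast
qed

lemma poly_le_on_polynomial_hull:
  assumes "z \<in> polynomial_hull E" "E \<noteq> {}" "\<And>w. w \<in> E \<Longrightarrow> cmod (poly p w) \<le> c"
  shows "cmod (poly p z) \<le> c"
proof -
  have "cmod (poly p z) \<le> (SUP w\<in>E. cmod (poly p w))" using assms(1) by (simp add: polynomial_hull_def)
  also have "\<dots> \<le> c" using assms by (intro cSUP_least) auto
  finally show ?thesis .
qed

lemma green_continuous:
  assumes "is_green_function E g" shows "continuous_on UNIV g"
proof -
  define D where "D = D_inf E"
  have "open D" using closed_polynomial_hull by (simp add: D_def D_inf_def open_Compl)
  have "isCont g z" for z
  proof (cases "z \<in> D")
    case True
    have "continuous_on D g" using assms unfolding is_green_function_def D_def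
      by (blast intro: harmonic_on_imp_continuous_on)
    then show ?thesis using True \<open>open D\<close> continuous_on_eq_continuous_at by blast
  next
    case False
    have g0: "g w = 0" if "w \<notin> D" for w
      using assms that unfolding is_green_function_def D_def D_inf_def by blast
    have *: "(g \<longlongrightarrow> 0) (at z within - D)"
      by (rule Lim_transform_eventually[OF tendsto_const]) (auto simp: eventually_at_filter g0)
    have **: "(g \<longlongrightarrow> 0) (at z within D)"
    proof (cases "z \<in> closure D")
      case True
      then have "z \<in> frontier D" using False \<open>open D\<close> by (simp add: frontier_def interior_open)
      then show ?thesis using assms unfolding is_green_function_def D_def by blast
    next
      case False
      then have "\<not> z islimpt D" by (simp add: closure_def)
      then have "at z within D = bot" by (simp add: trivial_limit_within)
      then show ?thesis by simp
    qed
    have "(g \<longlongrightarrow> 0) (at z within (D \<union> -D))"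
      using * ** unfolding Lim_within_Un by blast
    then have "g \<midarrow>z\<rightarrow> 0" by simp
    then show ?thesis using g0[OF False] by (simp add: isCont_def)
  qed
  then show ?thesis by (simp add: continuous_at_imp_continuous_on)
qed

lemma ln_cmod_at_top: "filterlim (\<lambda>z. ln (cmod z)) at_top at_infinity"
  by (rule filterlim_compose[OF ln_at_top filterlim_norm_at_top])

lemma green_at_top:
  assumes "is_green_function E g" shows "filterlim g at_top at_infinity"
proof -
  obtain c where c: "((\<lambda>z. g z - ln (cmod z)) \<longlongrightarrow> c) at_infinity"
    using assms unfolding is_green_function_def by blast
  show ?thesis
    using filterlim_tendsto_add_at_top[OF c ln_cmod_at_top] by simp
qed

lemma green_nonneg: "is_green_function E g \<Longrightarrow> 0 \<le> g z"
  unfolding is_green_function_def D_inf_def by (metis Compl_iff less_eq_real_def)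

lemma compact_sublevel:
  fixes g :: "complex \<Rightarrow> real"
  assumes "continuous_on UNIV g" "filterlim g at_top at_infinity"
  shows "compact {z. g z \<le> s}"
proof -
  have "closed {z. g z \<le> s}" by (intro closed_Collect_le assms continuous_intros)
  moreover obtain b where "\<And>z. cmod z \<ge> b \<Longrightarrow> g z \<ge> s + 1"
    using assms(2) unfolding filterlim_at_top eventually_at_infinity by meson
  then have "cmod z \<le> b" if "g z \<le> s" for z using that by (smt (verit))
  then have "bounded {z. g z \<le> s}" by (auto simp: bounded_iff)
  ultimately show ?thesis by (simp add: compact_eq_bounded_closed)
qed

text \<open>
  The factor \<open>1 + \<delta>\<close> makes the comparison function tend to \<open>-\<infinity>\<close> at infinity, where
  \<open>g - h\<close> itself only has a finite limit; the maximum principle applies and \<open>\<delta>\<close> tends to \<open>0\<close>.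
\<close>
lemma green_le:
  assumes "is_green_function E g" "is_green_function E h"
  shows "g z \<le> h z"
proof (cases "z \<in> D_inf E")
  case False
  then show ?thesis using assms by (auto simp: is_green_function_def D_inf_def)
next
  case True
  obtain c1 where c1: "((\<lambda>z. g z - ln (cmod z)) \<longlongrightarrow> c1) at_infinity"
    using assms unfolding is_green_function_def by blast
  obtain c2 where c2: "((\<lambda>z. h z - ln (cmod z)) \<longlongrightarrow> c2) at_infinity"
    using assms unfolding is_green_function_def by blast
  have *: "g z \<le> (1 + \<delta>) * h z" if "\<delta> > 0" for \<delta>
  proof -
    define v where "v = (\<lambda>z. 1 * g z + (- (1 + \<delta>)) * h z + 0)"
    have contv: "continuous_on UNIV v"
      unfolding v_def by (intro continuous_intros green_continuous[OF assms(1)] green_continuous[OF assms(2)])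
    have "((\<lambda>z. (g z - ln (cmod z)) - (h z - ln (cmod z))) \<longlongrightarrow> c1 - c2) at_infinity"
      by (intro tendsto_diff c1 c2)
    then have "((\<lambda>z. - (g z - h z)) \<longlongrightarrow> -(c1 - c2)) at_infinity" by (intro tendsto_minus) simp
    moreover have "filterlim (\<lambda>z. \<delta> * h z) at_top at_infinity"
      by (rule filterlim_tendsto_pos_mult_at_top[OF tendsto_const that green_at_top[OF assms(2)]])
    ultimately have "filterlim (\<lambda>z. - (g z - h z) + \<delta> * h z) at_top at_infinity"
      by (rule filterlim_tendsto_add_at_top)
    moreover have "(\<lambda>z. - (g z - h z) + \<delta> * h z) = (\<lambda>z. - v z)" by (auto simp: v_def algebra_simps)
    ultimately have top: "filterlim (\<lambda>z. - v z) at_top at_infinity" by simp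
    have "v z \<le> 0"
    proof (rule maximum_principle[OF _ _ True])
      show "harmonic_on v (D_inf E)"
        unfolding v_def using assms by (intro harmonic_on_lincomb) (auto simp: is_green_function_def)
      fix c :: real assume "c > 0"
      have "v w = 0" if "w \<notin> D_inf E" for w
        using assms that by (auto simp: v_def is_green_function_def D_inf_def)
      then have "{z \<in> D_inf E. c \<le> v z} = {z. - v z \<le> - c}" using \<open>c > 0\<close> by force
      also have "compact \<dots>" by (intro compact_sublevel top continuous_intros contv)
      finally show "compact {z \<in> D_inf E. c \<le> v z}" .
    qed
    then show ?thesis by (simp add: v_def algebra_simps)
  qed
  show ?thesis
  proof (rule field_le_epsilon)
    fix e :: real assume "e > 0"
    have h0: "h z \<ge> 0" using assms(2) by (rule green_nonneg)
    have "g z \<le> (1 + e / (h z + 1)) * h z" using \<open>e > 0\<close> h0 by (intro *) auto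
    also have "\<dots> \<le> h z + e" using \<open>e > 0\<close> h0 by (simp add: field_simps)
    finally show "g z \<le> h z + e" .
  qed
qed

lemma green_function_eq:
  assumes "is_green_function E g" shows "green_function E = g"
  unfolding green_function_def
proof (rule the_equality[where P = "is_green_function E", OF assms])
  fix h assume "is_green_function E h"
  then show "h = g" using green_le[OF assms] green_le[OF _ assms] by (auto intro!: ext antisym)
qed

text \<open>
  Otherwise \<open>g\<close> would be harmonic on the whole plane and tend to \<open>\<infinity>\<close> at infinity, against
  the minimum principle. The function below is \<open>g 0 + 1 - g\<close>, written as a linear combination.
\<close>
lemma green_polynomial_hull_nonempty:
  assumes "is_green_function E g" shows "polynomial_hull E \<noteq> {}"
proof
  assume "polynomial_hull E = {}"
  then have D: "D_inf E = UNIV" by (simp add: D_inf_def)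
  have H: "harmonic_on g UNIV" using assms D by (simp add: is_green_function_def)
  have "0 * g 0 + (-1) * g 0 + (g 0 + 1) \<le> 0"
  proof (rule maximum_principle[of "\<lambda>z. 0 * g z + (-1) * g z + (g 0 + 1)" UNIV 0])
    show "harmonic_on (\<lambda>z. 0 * g z + (-1) * g z + (g 0 + 1)) UNIV"
      by (rule harmonic_on_lincomb[OF H H])
    fix c :: real assume "c > 0"
    have "{z \<in> UNIV. c \<le> 0 * g z + (-1) * g z + (g 0 + 1)} = {z. g z \<le> g 0 + 1 - c}" by auto
    then show "compact {z \<in> UNIV. c \<le> 0 * g z + (-1) * g z + (g 0 + 1)}"
      using compact_sublevel[OF green_continuous[OF assms] green_at_top[OF assms], of "g 0 + 1 - c"] by simp
  qed simp
  then show False by simp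
qed

lemma green_zero_iff:
  assumes "is_green_function E g" shows "g z = 0 \<longleftrightarrow> z \<in> polynomial_hull E"
  using assms unfolding is_green_function_def D_inf_def by (metis Compl_iff less_irrefl)

lemma sublevel_in_nbhd:
  assumes "is_green_function E g" "\<epsilon> > 0"
  obtains s1 where "s1 > 0" "\<And>z. g z \<le> s1 \<Longrightarrow> infdist z (polynomial_hull E) < \<epsilon>"
proof -
  define C where "C = {z. g z \<le> 1} \<inter> {z. \<epsilon> \<le> infdist z (polynomial_hull E)}"
  have "compact C" unfolding C_def
    by (intro compact_Int_closed compact_sublevel green_continuous[OF assms(1)] green_at_top[OF assms(1)]
        closed_Collect_le continuous_intros)
  show ?thesis
  proof (cases "C = {}")
    case True
    then show ?thesis using that[of 1] unfolding C_def by force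
  next
    case False
    then obtain x where x: "x \<in> C" "\<And>y. y \<in> C \<Longrightarrow> g x \<le> g y"
      using continuous_attains_inf[OF \<open>compact C\<close> False, of g] green_continuous[OF assms(1)]
      by (meson continuous_on_subset subset_UNIV)
    have "x \<notin> polynomial_hull E" using x(1) \<open>\<epsilon> > 0\<close> by (auto simp: C_def)
    then have "g x > 0" using assms(1) by (auto simp: is_green_function_def D_inf_def)
    show ?thesis
    proof (rule that[of "min 1 (g x / 2)"])
      show "0 < min 1 (g x / 2)" using \<open>g x > 0\<close> by simp
      show "infdist z (polynomial_hull E) < \<epsilon>" if "g z \<le> min 1 (g x / 2)" for z
      proof (rule ccontr)
        assume "\<not> infdist z (polynomial_hull E) < \<epsilon>"
        then have "z \<in> C" using that by (simp add: C_def)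
        from x(2)[OF this] that \<open>g x > 0\<close> show False by simp
      qed
    qed
  qed
qed

section \<open>The five-point Laplacian on a square grid\<close>

text \<open>
  The five-point Laplacian compares values along the two coordinate directions; this is the
  differentiability that makes such a comparison accurate to second order.
\<close>
definition second_deriv_along :: "complex \<Rightarrow> (complex \<Rightarrow> real) \<Rightarrow> (complex \<Rightarrow> real) \<Rightarrow> bool" where
  "second_deriv_along e u u2 \<longleftrightarrow> (\<exists>u1. \<forall>z.
     ((\<lambda>t. u (z + of_real t * e)) has_real_derivative u1 z) (at 0) \<and>
     ((\<lambda>t. u1 (z + of_real t * e)) has_real_derivative u2 z) (at 0))"

text \<open>
  Taylor's formula of order two for the even function \<open>t \<mapsto> u(z + t e) + u(z - t e)\<close>; its remainder
  is controlled by the uniform continuity of \<open>u2\<close> on a compact disc.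
\<close>
lemma second_difference_approx:
  assumes "second_deriv_along e u u2" "cmod e = 1" "continuous_on UNIV u2" "0 < \<eta>"
  shows "\<exists>h0>0. \<forall>h z. 0 < h \<longrightarrow> h < h0 \<longrightarrow> cmod z \<le> R \<longrightarrow>
    \<bar>u (z + of_real h * e) + u (z - of_real h * e) - 2 * u z - h\<^sup>2 * u2 z\<bar> \<le> \<eta> * h\<^sup>2"
proof -
  obtain u1 where u1: "\<And>z. ((\<lambda>t. u (z + of_real t * e)) has_real_derivative u1 z) (at 0)"
    "\<And>z. ((\<lambda>t. u1 (z + of_real t * e)) has_real_derivative u2 z) (at 0)"
    using assms(1) unfolding second_deriv_along_def by blast
  have shift: "((\<lambda>t. v (z + of_real t * e)) has_real_derivative v1 (z + of_real t * e)) (at t)"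
    if "\<And>z. ((\<lambda>t. v (z + of_real t * e)) has_real_derivative v1 z) (at 0)" for v v1 z t
  proof -
    have "((\<lambda>s. v ((z + of_real t * e) + of_real s * e)) has_real_derivative v1 (z + of_real t * e)) (at 0)"
      by (rule that)
    moreover have "(z + of_real t * e) + of_real s * e = z + of_real (s + t) * e" for s
      by (simp add: distrib_right)
    ultimately have "((\<lambda>s. v (z + of_real (s + t) * e)) has_real_derivative v1 (z + of_real t * e)) (at 0)"
      by simp
    then have "((\<lambda>s. v (z + of_real s * e)) has_real_derivative v1 (z + of_real t * e)) (at (0 + t))"
      unfolding DERIV_shift .
    then show ?thesis by simp
  qed
  have shift': "((\<lambda>t. v (z - of_real t * e)) has_real_derivative - v1 (z - of_real t * e)) (at t)"
    if "\<And>z. ((\<lambda>t. v (z + of_real t * e)) has_real_derivative v1 z) (at 0)" for v v1 z t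
  proof -
    have "((\<lambda>s. v (z + of_real s * e)) has_real_derivative v1 (z + of_real (- t) * e)) (at (- t))"
      by (rule shift) (rule that)
    then have "((\<lambda>s. v (z + of_real (- s) * e)) has_real_derivative - v1 (z + of_real (- t) * e)) (at t)"
      by (rule iffD1[OF DERIV_mirror])
    then show ?thesis by simp
  qed
  have "uniformly_continuous_on (cball 0 (R + 1)) u2"
    by (intro compact_uniformly_continuous continuous_on_subset[OF assms(3)]) auto
  then obtain d where d: "d > 0" "\<forall>x\<in>cball 0 (R+1). \<forall>y\<in>cball 0 (R+1). dist y x < d \<longrightarrow> dist (u2 y) (u2 x) < \<eta>"
    using \<open>0 < \<eta>\<close> unfolding uniformly_continuous_on_def by blast
  show ?thesis
  proof (intro exI[of _ "min 1 d"] conjI allI impI)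
    show "0 < min 1 d" using d by simp
    fix h :: real and z assume h: "0 < h" "h < min 1 d" "cmod z \<le> R"
    \<comment> \<open>the odd-order terms of the two one-sided expansions cancel\<close>
    define D where "D = (\<lambda>m::nat. \<lambda>t. if m = 0 then u (z + of_real t * e) + u (z - of_real t * e)
      else if m = 1 then u1 (z + of_real t * e) - u1 (z - of_real t * e)
      else u2 (z + of_real t * e) + u2 (z - of_real t * e))"
    have "\<exists>t. 0 < t \<and> t \<le> h \<and> D 0 h = (\<Sum>m<2. D m 0 / fact m * h ^ m) + D 2 t / fact 2 * h ^ 2"
    proof (rule Maclaurin2[OF h(1) refl], intro allI impI)
      fix m :: nat and t :: real assume "m < 2 \<and> 0 \<le> t \<and> t \<le> h"
      then consider "m = 0" | "m = 1" by linarith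
      then show "(D m has_real_derivative D (Suc m) t) (at t)"
      proof cases
        case 1
        have "((\<lambda>t. u (z + of_real t * e) + u (z - of_real t * e)) has_real_derivative
            u1 (z + of_real t * e) + - u1 (z - of_real t * e)) (at t)"
          by (rule DERIV_add[OF shift[OF u1(1)] shift'[OF u1(1)]])
        then show ?thesis using 1 by (simp add: D_def)
      next
        case 2
        have "((\<lambda>t. u1 (z + of_real t * e) - u1 (z - of_real t * e)) has_real_derivative
            u2 (z + of_real t * e) - - u2 (z - of_real t * e)) (at t)"
          by (rule DERIV_diff[OF shift[OF u1(2)] shift'[OF u1(2)]])
        then show ?thesis using 2 by (simp add: D_def)
      qed
    qed
    then obtain t where t: "0 < t" "t \<le> h" "D 0 h = (\<Sum>m<2. D m 0 / fact m * h ^ m) + D 2 t / fact 2 * h ^ 2"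
      by blast
    have D: "D 0 h = u (z + of_real h * e) + u (z - of_real h * e)" "D 0 0 = 2 * u z" "D 1 0 = 0"
      "D 2 t = u2 (z + of_real t * e) + u2 (z - of_real t * e)" by (simp_all add: D_def)
    have "(\<Sum>m<2. D m 0 / fact m * h ^ m) = D 0 0 + D 1 0 * h" by (simp add: numeral_2_eq_2)
    with t(3) have "D 0 h = D 0 0 + D 1 0 * h + D 2 t / 2 * h\<^sup>2" by simp
    then have eq: "u (z + of_real h * e) + u (z - of_real h * e) - 2 * u z - h\<^sup>2 * u2 z
       = ((u2 (z + of_real t * e) - u2 z) + (u2 (z - of_real t * e) - u2 z)) / 2 * h\<^sup>2"
      unfolding D by (simp add: field_simps)
    have n: "cmod (of_real t * e) = t" using t assms(2) by (simp add: norm_mult)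
    have "cmod (z + of_real t * e) \<le> R + 1" "cmod (z - of_real t * e) \<le> R + 1"
      using norm_triangle_ineq[of z "of_real t * e"] norm_triangle_ineq4[of z "of_real t * e"] n h t by auto
    moreover have "dist (z + of_real t * e) z < d" "dist (z - of_real t * e) z < d"
      using n h t by (auto simp: dist_norm)
    ultimately have "dist (u2 (z + of_real t * e)) (u2 z) < \<eta>" "dist (u2 (z - of_real t * e)) (u2 z) < \<eta>"
      using h(3) by (auto intro!: d(2)[rule_format] simp del: dist_real_def)
    then have "\<bar>((u2 (z + of_real t * e) - u2 z) + (u2 (z - of_real t * e) - u2 z)) / 2\<bar> \<le> \<eta>"
      by (simp add: dist_real_def)
    then show "\<bar>u (z + of_real h * e) + u (z - of_real h * e) - 2 * u z - h\<^sup>2 * u2 z\<bar> \<le> \<eta> * h\<^sup>2"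
      unfolding eq abs_mult by (intro mult_mono) auto
  qed
qed

definition five_point :: "real \<Rightarrow> (complex \<Rightarrow> real) \<Rightarrow> complex \<Rightarrow> real" where
  "five_point h u z = u (z + of_real h) + u (z - of_real h) + u (z + of_real h * \<i>) + u (z - of_real h * \<i>) - 4 * u z"

lemma five_point_approx:
  assumes "second_deriv_along 1 u uxx" "second_deriv_along \<i> u uyy"
    "continuous_on UNIV uxx" "continuous_on UNIV uyy" "0 < \<eta>"
  shows "\<exists>h0>0. \<forall>h z. 0 < h \<longrightarrow> h < h0 \<longrightarrow> cmod z \<le> R \<longrightarrow>
    \<bar>five_point h u z - h\<^sup>2 * (uxx z + uyy z)\<bar> \<le> \<eta> * h\<^sup>2"
proof -
  obtain h1 where h1: "h1 > 0" "\<And>h z. 0 < h \<Longrightarrow> h < h1 \<Longrightarrow> cmod z \<le> R \<Longrightarrow>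
    \<bar>u (z + of_real h * 1) + u (z - of_real h * 1) - 2 * u z - h\<^sup>2 * uxx z\<bar> \<le> \<eta>/2 * h\<^sup>2"
    using second_difference_approx[OF assms(1) _ assms(3), of "\<eta>/2" R] \<open>0 < \<eta>\<close> by auto
  obtain h2 where h2: "h2 > 0" "\<And>h z. 0 < h \<Longrightarrow> h < h2 \<Longrightarrow> cmod z \<le> R \<Longrightarrow>
    \<bar>u (z + of_real h * \<i>) + u (z - of_real h * \<i>) - 2 * u z - h\<^sup>2 * uyy z\<bar> \<le> \<eta>/2 * h\<^sup>2"
    using second_difference_approx[OF assms(2) _ assms(4), of "\<eta>/2" R] \<open>0 < \<eta>\<close> by auto
  show ?thesis
  proof (intro exI[of _ "min h1 h2"] conjI allI impI)
    fix h z assume *: "0 < h" "h < min h1 h2" "cmod z \<le> R"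
    have "five_point h u z - h\<^sup>2 * (uxx z + uyy z) =
      (u (z + of_real h * 1) + u (z - of_real h * 1) - 2 * u z - h\<^sup>2 * uxx z) +
      (u (z + of_real h * \<i>) + u (z - of_real h * \<i>) - 2 * u z - h\<^sup>2 * uyy z)"
      by (simp add: five_point_def algebra_simps)
    then show "\<bar>five_point h u z - h\<^sup>2 * (uxx z + uyy z)\<bar> \<le> \<eta> * h\<^sup>2"
      using h1(2)[of h z] h2(2)[of h z] * by linarith
  qed (use h1 h2 in auto)
qed

definition grid_point :: "real \<Rightarrow> int \<times> int \<Rightarrow> complex" where
  "grid_point h p = Complex (h * of_int (fst p)) (h * of_int (snd p))"

definition grid_box :: "nat \<Rightarrow> (int \<times> int) set" where
  "grid_box N = {- int N..int N} \<times> {- int N..int N}"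

lemma finite_grid_box [simp]: "finite (grid_box N)"
  by (simp add: grid_box_def)

lemma card_grid_box: "card (grid_box n) = (2 * n + 1)\<^sup>2"
proof -
  have "nat (2 * int n + 1) = 2 * n + 1" by simp
  then show ?thesis by (simp add: grid_box_def card_cartesian_product power2_eq_square)
qed

lemma telescope_int:
  fixes T :: "int \<Rightarrow> real"
  shows "(\<Sum>i\<in>{- int N..int N}. T i - T (i - 1)) = T (int N) - T (- int N - 1)"
proof (induction N)
  case (Suc N)
  have "{- int (Suc N)..int (Suc N)} = insert (int (Suc N)) (insert (- int (Suc N)) {- int N..int N})" by auto
  then have "(\<Sum>i\<in>{- int (Suc N)..int (Suc N)}. T i - T (i - 1)) =
    (T (int (Suc N)) - T (int (Suc N) - 1)) + ((T (- int (Suc N)) - T (- int (Suc N) - 1)) + (\<Sum>i\<in>{- int N..int N}. T i - T (i - 1)))"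
    by (simp del: of_nat_Suc)
  moreover have "T (int (Suc N) - 1) = T (int N)" "T (- int (Suc N)) = T (- int N - 1)"
    by (rule arg_cong[of _ _ T], simp)+
  ultimately show ?case using Suc by linarith
qed simp

lemma sum_by_parts_1d:
  fixes a b :: "int \<Rightarrow> real"
  assumes "\<And>i. int N \<le> \<bar>i\<bar> \<Longrightarrow> b i = 0"
  shows "(\<Sum>i\<in>{- int N..int N}. a i * (b (i + 1) + b (i - 1) - 2 * b i)) =
         (\<Sum>i\<in>{- int N..int N}. b i * (a (i + 1) + a (i - 1) - 2 * a i))"
proof -
  define T where "T = (\<lambda>i. a i * b (i + 1) - b i * a (i + 1))"
  have "(\<Sum>i\<in>{- int N..int N}. a i * (b (i + 1) + b (i - 1) - 2 * b i)) -
         (\<Sum>i\<in>{- int N..int N}. b i * (a (i + 1) + a (i - 1) - 2 * a i))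
      = (\<Sum>i\<in>{- int N..int N}. T i - T (i - 1))"
    unfolding sum_subtractf[symmetric] by (intro sum.cong) (auto simp: T_def algebra_simps)
  also have "\<dots> = 0" unfolding telescope_int using assms by (simp add: T_def)
  finally show ?thesis by simp
qed

text \<open>
  Green's second identity on the grid: the five-point Laplacian is symmetric, and there is no boundary
  term because \<open>v\<close> vanishes on the rim of the box and outside it.
\<close>
lemma sum_by_parts_grid:
  assumes "\<And>p. int N \<le> \<bar>fst p\<bar> \<or> int N \<le> \<bar>snd p\<bar> \<Longrightarrow> v (grid_point h p) = 0"
  shows "(\<Sum>p\<in>grid_box N. u (grid_point h p) * five_point h v (grid_point h p)) =
         (\<Sum>p\<in>grid_box N. v (grid_point h p) * five_point h u (grid_point h p))"
proof -
  let ?I = "{- int N..int N}"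
  define U where "U i j = u (grid_point h (i, j))" for i j
  define V where "V i j = v (grid_point h (i, j))" for i j
  have fp: "five_point h w (grid_point h (i, j)) =
     (w (grid_point h (i+1, j)) + w (grid_point h (i-1, j)) - 2 * w (grid_point h (i, j))) +
     (w (grid_point h (i, j+1)) + w (grid_point h (i, j-1)) - 2 * w (grid_point h (i, j)))" for w i j
  proof -
    have "grid_point h (i, j) + of_real h = grid_point h (i+1, j)"
      "grid_point h (i, j) - of_real h = grid_point h (i-1, j)"
      "grid_point h (i, j) + of_real h * \<i> = grid_point h (i, j+1)"
      "grid_point h (i, j) - of_real h * \<i> = grid_point h (i, j-1)"
      by (auto simp: grid_point_def complex_eq_iff algebra_simps)
    then show ?thesis by (simp add: five_point_def)
  qed
  have V0: "V i j = 0" if "int N \<le> \<bar>i\<bar> \<or> int N \<le> \<bar>j\<bar>" for i j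
    using assms[of "(i, j)"] that by (auto simp: V_def)
  have split: "(\<Sum>p\<in>grid_box N. f (grid_point h p) * five_point h k (grid_point h p)) =
     (\<Sum>j\<in>?I. \<Sum>i\<in>?I. f (grid_point h (i, j)) * (k (grid_point h (i+1, j)) + k (grid_point h (i-1, j)) - 2 * k (grid_point h (i, j)))) +
     (\<Sum>i\<in>?I. \<Sum>j\<in>?I. f (grid_point h (i, j)) * (k (grid_point h (i, j+1)) + k (grid_point h (i, j-1)) - 2 * k (grid_point h (i, j))))" for f k
  proof -
    have "(\<Sum>p\<in>grid_box N. f (grid_point h p) * five_point h k (grid_point h p)) =
      (\<Sum>i\<in>?I. \<Sum>j\<in>?I. f (grid_point h (i, j)) * five_point h k (grid_point h (i, j)))"
      unfolding grid_box_def sum.cartesian_product by (simp add: case_prod_unfold)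
    also have "\<dots> = (\<Sum>i\<in>?I. \<Sum>j\<in>?I. f (grid_point h (i, j)) * (k (grid_point h (i+1, j)) + k (grid_point h (i-1, j)) - 2 * k (grid_point h (i, j)))) +
     (\<Sum>i\<in>?I. \<Sum>j\<in>?I. f (grid_point h (i, j)) * (k (grid_point h (i, j+1)) + k (grid_point h (i, j-1)) - 2 * k (grid_point h (i, j))))"
      unfolding fp distrib_left sum.distrib ..
    also have "(\<Sum>i\<in>?I. \<Sum>j\<in>?I. f (grid_point h (i, j)) * (k (grid_point h (i+1, j)) + k (grid_point h (i-1, j)) - 2 * k (grid_point h (i, j)))) =
      (\<Sum>j\<in>?I. \<Sum>i\<in>?I. f (grid_point h (i, j)) * (k (grid_point h (i+1, j)) + k (grid_point h (i-1, j)) - 2 * k (grid_point h (i, j))))"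
      by (rule sum.swap)
    finally show ?thesis .
  qed
  have "(\<Sum>i\<in>?I. U i j * (V (i+1) j + V (i-1) j - 2 * V i j)) = (\<Sum>i\<in>?I. V i j * (U (i+1) j + U (i-1) j - 2 * U i j))" for j
    by (rule sum_by_parts_1d) (simp add: V0)
  moreover have "(\<Sum>j\<in>?I. U i j * (V i (j+1) + V i (j-1) - 2 * V i j)) = (\<Sum>j\<in>?I. V i j * (U i (j+1) + U i (j-1) - 2 * U i j))" for i
    by (rule sum_by_parts_1d) (simp add: V0)
  ultimately show ?thesis unfolding split U_def V_def by simp
qed

text \<open>
  Sums over a grid of mesh \<open>h\<close>, scaled by \<open>h\<^sup>2\<close>, are bounded independently of \<open>h\<close>, like integrals.
\<close>
lemma grid_sum_le:
  assumes "0 < h" "h \<le> 1" "finite S" "0 \<le> M" "0 \<le> R"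
    and "\<And>p. p \<in> S \<Longrightarrow> cmod (grid_point h p) \<le> R \<Longrightarrow> F p \<le> M"
    and "\<And>p. p \<in> S \<Longrightarrow> R < cmod (grid_point h p) \<Longrightarrow> F p \<le> 0"
  shows "h\<^sup>2 * (\<Sum>p\<in>S. F p) \<le> M * (2 * R + 1)\<^sup>2"
proof -
  define n where "n = nat \<lfloor>R / h\<rfloor>"
  have n: "real n \<le> R / h" "int n = \<lfloor>R / h\<rfloor>" using assms by (auto simp: n_def)
  define S' where "S' = {p\<in>S. cmod (grid_point h p) \<le> R}"
  have sub: "S' \<subseteq> grid_box n"
  proof
    fix p assume "p \<in> S'"
    then have c: "cmod (grid_point h p) \<le> R" by (simp add: S'_def)
    have "\<bar>h * of_int (fst p)\<bar> \<le> R" "\<bar>h * of_int (snd p)\<bar> \<le> R"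
      using c abs_Re_le_cmod[of "grid_point h p"] abs_Im_le_cmod[of "grid_point h p"]
      by (auto simp: grid_point_def)
    then have "\<bar>of_int (fst p)\<bar> \<le> R / h" "\<bar>of_int (snd p)\<bar> \<le> R / h"
      using \<open>0 < h\<close> by (auto simp: abs_mult field_simps)
    then have "\<bar>fst p\<bar> \<le> int n" "\<bar>snd p\<bar> \<le> int n" unfolding n(2) by linarith+
    then show "p \<in> grid_box n" by (cases p) (auto simp: grid_box_def)
  qed
  have "(\<Sum>p\<in>S. F p) \<le> (\<Sum>p\<in>S. if p \<in> S' then M else 0)"
    using assms by (intro sum_mono) (auto simp: S'_def not_le)
  also have "\<dots> = M * card S'" using \<open>finite S\<close> by (simp add: sum.If_cases S'_def Int_def)
  also have "\<dots> \<le> M * card (grid_box n)"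
    using sub \<open>0 \<le> M\<close> by (intro mult_left_mono) (simp_all add: card_mono)
  also have "\<dots> = M * (2 * n + 1)\<^sup>2" unfolding card_grid_box by simp
  finally have "h\<^sup>2 * (\<Sum>p\<in>S. F p) \<le> h\<^sup>2 * (M * (2 * n + 1)\<^sup>2)"
    by (intro mult_left_mono) auto
  also have "\<dots> = M * (h * (2 * n + 1))\<^sup>2" by (simp add: power_mult_distrib)
  also have "\<dots> \<le> M * (2 * R + 1)\<^sup>2"
  proof -
    have "h * real n \<le> R" using n(1) \<open>0 < h\<close> by (simp add: field_simps)
    then have "h * (2 * n + 1) \<le> 2 * R + 1" using \<open>h \<le> 1\<close> by (simp add: algebra_simps)
    then show ?thesis using assms by (intro mult_left_mono power_mono) auto
  qed
  finally show ?thesis .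
qed

text \<open>
  A smooth regularisation of \<open>ln \<bar>z\<bar>\<close>, written in coordinates so that it can be differentiated.
\<close>
definition smooth_log :: "real \<Rightarrow> complex \<Rightarrow> real" where
  "smooth_log d z = ln ((Re z)\<^sup>2 + (Im z)\<^sup>2 + d\<^sup>2) / 2"

text \<open>
  The Laplacian of \<open>smooth_log d\<close>: an approximate identity as \<open>d\<close> tends to \<open>0\<close>, up to the factor \<open>2 \<pi>\<close>.
\<close>
definition bump :: "real \<Rightarrow> complex \<Rightarrow> real" where
  "bump d z = 2 * d\<^sup>2 / ((Re z)\<^sup>2 + (Im z)\<^sup>2 + d\<^sup>2)\<^sup>2"

lemma smooth_log_alt: "smooth_log d z = ln ((cmod z)\<^sup>2 + d\<^sup>2) / 2"
  by (simp add: smooth_log_def cmod_power2)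

lemma bump_alt: "bump d z = 2 * d\<^sup>2 / ((cmod z)\<^sup>2 + d\<^sup>2)\<^sup>2"
  by (simp add: bump_def cmod_power2)

lemma bump_nonneg: "0 \<le> bump d z" by (simp add: bump_def)

lemma ln_diff_le:
  fixes x y m :: real
  assumes "0 < m" "m \<le> x" "m \<le> y"
  shows "ln x - ln y \<le> \<bar>x - y\<bar> / m"
proof -
  have "ln x - ln y = ln (x / y)" using assms by (simp add: ln_div)
  also have "\<dots> \<le> x / y - 1" using assms by (intro ln_le_minus_one) auto
  also have "\<dots> = (x - y) / y" using assms by (simp add: field_simps)
  also have "\<dots> \<le> \<bar>x - y\<bar> / y" using assms by (intro divide_right_mono) auto
  also have "\<dots> \<le> \<bar>x - y\<bar> / m" using assms by (intro divide_left_mono) auto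
  finally show ?thesis .
qed

text \<open>
  The bound does not depend on \<open>d\<close> because adding \<open>d\<^sup>2\<close> to both squared moduli only brings
  their ratio closer to \<open>1\<close>.
\<close>
lemma smooth_log_lipschitz:
  assumes "0 < m" "m \<le> cmod x" "m \<le> cmod y"
  shows "\<bar>smooth_log d x - smooth_log d y\<bar> \<le> cmod (x - y) / m"
proof -
  have main: "smooth_log d x - smooth_log d y \<le> cmod (x - y) / m"
    if "m \<le> cmod x" "m \<le> cmod y" for x y
  proof (cases "cmod y \<le> cmod x")
    case True
    have pos: "cmod x > 0" "cmod y > 0" using that \<open>0 < m\<close> by auto
    have pos2: "(cmod x)\<^sup>2 + d\<^sup>2 > 0" "(cmod y)\<^sup>2 + d\<^sup>2 > 0" using pos by (auto intro: add_pos_nonneg)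
    have "((cmod x)\<^sup>2 + d\<^sup>2) / ((cmod y)\<^sup>2 + d\<^sup>2) \<le> (cmod x)\<^sup>2 / (cmod y)\<^sup>2"
    proof -
      have "((cmod x)\<^sup>2 + d\<^sup>2) * (cmod y)\<^sup>2 \<le> (cmod x)\<^sup>2 * ((cmod y)\<^sup>2 + d\<^sup>2)"
        using True by (simp add: algebra_simps mult_left_mono power_mono)
      then show ?thesis using pos pos2 by (simp add: divide_simps mult.commute)
    qed
    then have "ln (((cmod x)\<^sup>2 + d\<^sup>2) / ((cmod y)\<^sup>2 + d\<^sup>2)) \<le> ln ((cmod x)\<^sup>2 / (cmod y)\<^sup>2)"
      using pos pos2 by (intro ln_mono) auto
    then have "smooth_log d x - smooth_log d y \<le> ln (cmod x) - ln (cmod y)"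
      using pos pos2 by (simp add: smooth_log_alt ln_div ln_realpow)
    also have "\<dots> \<le> \<bar>cmod x - cmod y\<bar> / m" by (intro ln_diff_le that \<open>0 < m\<close>)
    also have "\<dots> \<le> cmod (x - y) / m" using \<open>0 < m\<close> by (intro divide_right_mono norm_triangle_ineq3) auto
    finally show ?thesis .
  next
    case False
    have "(cmod x)\<^sup>2 + d\<^sup>2 > 0" using that \<open>0 < m\<close> by (intro add_pos_nonneg) auto
    then have "smooth_log d x \<le> smooth_log d y"
      using False by (auto simp: smooth_log_alt intro!: ln_mono add_mono power_mono)
    moreover have "0 \<le> cmod (x - y) / m" using \<open>0 < m\<close> by simp
    ultimately show ?thesis by linarith
  qed
  show ?thesis using main[of x y] main[of y x] assms by (simp add: norm_minus_commute)
qed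

lemma smooth_log_close:
  assumes "0 < m" "m \<le> cmod x"
  shows "\<bar>smooth_log d x - ln (cmod x)\<bar> \<le> d\<^sup>2 / m\<^sup>2"
proof -
  have x: "cmod x > 0" "x \<noteq> 0" using assms by auto
  have "smooth_log d x - ln (cmod x) = (ln ((cmod x)\<^sup>2 + d\<^sup>2) - ln ((cmod x)\<^sup>2)) / 2"
    using x by (simp add: smooth_log_alt ln_realpow diff_divide_distrib del: zero_less_norm_iff)
  moreover have "ln ((cmod x)\<^sup>2 + d\<^sup>2) - ln ((cmod x)\<^sup>2) \<le> \<bar>(cmod x)\<^sup>2 + d\<^sup>2 - (cmod x)\<^sup>2\<bar> / m\<^sup>2"
    using assms by (intro ln_diff_le) (auto intro!: power_mono simp: add_increasing2)
  moreover have "ln ((cmod x)\<^sup>2 + d\<^sup>2) - ln ((cmod x)\<^sup>2) \<ge> 0"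
    using x by (simp add: add_pos_nonneg)
  moreover have "d\<^sup>2 / m\<^sup>2 \<ge> 0" by simp
  ultimately show ?thesis by simp
qed

lemma smooth_log_second_derivs:
  assumes "d \<noteq> 0"
  obtains pxx pyy where "second_deriv_along 1 (smooth_log d) pxx" "second_deriv_along \<i> (smooth_log d) pyy"
    "continuous_on UNIV pxx" "continuous_on UNIV pyy" "\<And>z. pxx z + pyy z = bump d z"
proof -
  define A where "A z = (Re z)\<^sup>2 + (Im z)\<^sup>2 + d\<^sup>2" for z
  have A: "A z > 0" for z using assms by (auto simp: A_def intro!: add_nonneg_pos)
  have A0: "(Re z)\<^sup>2 + (Im z)\<^sup>2 + d\<^sup>2 \<noteq> 0" "(Re z)\<^sup>2 + (Im z)\<^sup>2 + d\<^sup>2 > 0" for z using A[of z] by (auto simp: A_def)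
  show ?thesis
  proof
    show "second_deriv_along 1 (smooth_log d) (\<lambda>z. ((Im z)\<^sup>2 - (Re z)\<^sup>2 + d\<^sup>2) / (A z)\<^sup>2)"
      unfolding second_deriv_along_def
    proof (intro exI[of _ "\<lambda>z. Re z / A z"] allI conjI)
      fix z
      show "((\<lambda>t. smooth_log d (z + of_real t * 1)) has_real_derivative Re z / A z) (at 0)"
        unfolding smooth_log_def A_def using A0[of z]
        by (auto intro!: derivative_eq_intros simp: field_simps)
      show "((\<lambda>t. Re (z + of_real t * 1) / A (z + of_real t * 1)) has_real_derivative
          ((Im z)\<^sup>2 - (Re z)\<^sup>2 + d\<^sup>2) / (A z)\<^sup>2) (at 0)"
        unfolding A_def using A0[of z]
        by (auto intro!: derivative_eq_intros simp: field_simps power2_eq_square)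
    qed
    show "second_deriv_along \<i> (smooth_log d) (\<lambda>z. ((Re z)\<^sup>2 - (Im z)\<^sup>2 + d\<^sup>2) / (A z)\<^sup>2)"
      unfolding second_deriv_along_def
    proof (intro exI[of _ "\<lambda>z. Im z / A z"] allI conjI)
      fix z
      show "((\<lambda>t. smooth_log d (z + of_real t * \<i>)) has_real_derivative Im z / A z) (at 0)"
        unfolding smooth_log_def A_def using A0[of z]
        by (auto intro!: derivative_eq_intros simp: field_simps)
      show "((\<lambda>t. Im (z + of_real t * \<i>) / A (z + of_real t * \<i>)) has_real_derivative
          ((Re z)\<^sup>2 - (Im z)\<^sup>2 + d\<^sup>2) / (A z)\<^sup>2) (at 0)"
        unfolding A_def using A0[of z]
        by (auto intro!: derivative_eq_intros simp: field_simps power2_eq_square)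
    qed
    show "continuous_on UNIV (\<lambda>z. ((Im z)\<^sup>2 - (Re z)\<^sup>2 + d\<^sup>2) / (A z)\<^sup>2)"
      "continuous_on UNIV (\<lambda>z. ((Re z)\<^sup>2 - (Im z)\<^sup>2 + d\<^sup>2) / (A z)\<^sup>2)"
      unfolding A_def using A0 by (auto intro!: continuous_intros)
    fix z
    show "((Im z)\<^sup>2 - (Re z)\<^sup>2 + d\<^sup>2) / (A z)\<^sup>2 + ((Re z)\<^sup>2 - (Im z)\<^sup>2 + d\<^sup>2) / (A z)\<^sup>2 = bump d z"
      by (simp add: bump_def A_def add_divide_distrib[symmetric])
  qed
qed

text \<open>
  A lower bound for the mass of \<open>bump d\<close> that is independent of \<open>d\<close> and \<open>h\<close>. The points with both
  coordinates at most \<open>d/2\<close> in modulus already contribute enough, since \<open>bump d\<close> is at least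
  \<open>8 / (9 d\<^sup>2)\<close> there.
\<close>
lemma bump_grid_mass:
  assumes "0 < h" "h \<le> d / 8" "d \<le> r" "r \<le> h * N"
  shows "1/2 \<le> h\<^sup>2 * (\<Sum>p\<in>{p\<in>grid_box N. cmod (grid_point h p) < r}. bump d (grid_point h p))"
proof -
  have d: "0 < d" using assms by simp
  define n where "n = nat \<lfloor>d / (2 * h)\<rfloor>"
  have n: "real n \<le> d / (2 * h)" "d / (2*h) - 1 \<le> real n"
    using assms d by (auto simp: n_def) 
  have nh: "h * n \<le> d / 2" using n(1) \<open>0 < h\<close> by (simp add: field_simps)
  have "real n \<le> N"
  proof -
    have "h * n \<le> h * N" using nh assms d by linarith
    then show ?thesis using \<open>0 < h\<close> by simp
  qed
  then have box: "grid_box n \<subseteq> grid_box N" by (auto simp: grid_box_def)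
  have small: "(cmod (grid_point h p))\<^sup>2 \<le> d\<^sup>2 / 2" if "p \<in> grid_box n" for p
  proof -
    have "\<bar>fst p\<bar> \<le> int n" "\<bar>snd p\<bar> \<le> int n" using that by (auto simp: grid_box_def)
    then have "\<bar>real_of_int (fst p)\<bar> \<le> n" "\<bar>real_of_int (snd p)\<bar> \<le> n" by linarith+
    then have "\<bar>h * of_int (fst p)\<bar> \<le> h * n" "\<bar>h * of_int (snd p)\<bar> \<le> h * n"
      using \<open>0 < h\<close> by (auto simp: abs_mult)
    then have "\<bar>h * of_int (fst p)\<bar> \<le> d/2" "\<bar>h * of_int (snd p)\<bar> \<le> d/2" using nh by linarith+
    then have "(h * of_int (fst p))\<^sup>2 \<le> (d/2)\<^sup>2" "(h * of_int (snd p))\<^sup>2 \<le> (d/2)\<^sup>2"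
      using d by (auto simp: abs_le_square_iff[symmetric])
    then show ?thesis by (simp add: cmod_power2 grid_point_def power_divide)
  qed
  have lt: "cmod (grid_point h p) < r" if "p \<in> grid_box n" for p
  proof -
    have "(cmod (grid_point h p))\<^sup>2 < d\<^sup>2" using small[OF that] d by (smt (verit) field_sum_of_halves zero_less_power)
    then show ?thesis using d assms by (meson less_eq_real_def less_le_trans power_less_imp_less_base)
  qed
  have low: "8 / (9 * d\<^sup>2) \<le> bump d (grid_point h p)" if "p \<in> grid_box n" for p
  proof -
    have "(cmod (grid_point h p))\<^sup>2 + d\<^sup>2 \<le> 3/2 * d\<^sup>2" using small[OF that] by simp
    then have "((cmod (grid_point h p))\<^sup>2 + d\<^sup>2)\<^sup>2 \<le> (3/2 * d\<^sup>2)\<^sup>2" by (intro power_mono) auto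
    moreover have "((cmod (grid_point h p))\<^sup>2 + d\<^sup>2)\<^sup>2 > 0" using d by (simp add: add_nonneg_pos)
    ultimately have "2 * d\<^sup>2 / (3/2 * d\<^sup>2)\<^sup>2 \<le> bump d (grid_point h p)"
      unfolding bump_alt using d by (intro divide_left_mono) auto
    then show ?thesis using d by (simp add: field_simps power2_eq_square)
  qed
  have "7/8 * d \<le> h * (2 * n + 1)"
  proof -
    have "d / 2 - h = h * (d / (2*h) - 1)" using \<open>0 < h\<close> by (simp add: field_simps)
    also have "\<dots> \<le> h * n" using n(2) \<open>0 < h\<close> by (intro mult_left_mono) auto
    finally have "d / 2 - h \<le> h * n" .
    then show ?thesis using assms by (simp add: algebra_simps)
  qed
  then have "(7/8 * d)\<^sup>2 \<le> (h * (2 * n + 1))\<^sup>2" using d by (intro power_mono) auto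
  then have "49/64 * d\<^sup>2 \<le> h\<^sup>2 * (2 * n + 1)\<^sup>2" by (simp add: power_mult_distrib power_divide)
  then have "49/64 * d\<^sup>2 * (8 / (9 * d\<^sup>2)) \<le> h\<^sup>2 * (2 * n + 1)\<^sup>2 * (8 / (9 * d\<^sup>2))"
    by (intro mult_right_mono) auto
  moreover have "49/64 * d\<^sup>2 * (8 / (9 * d\<^sup>2)) = 49/72" using d by simp
  ultimately have "1/2 \<le> h\<^sup>2 * ((2 * n + 1)\<^sup>2 * (8 / (9 * d\<^sup>2)))" by (simp only: mult.assoc)
  also have "\<dots> = h\<^sup>2 * (\<Sum>p\<in>grid_box n. 8 / (9 * d\<^sup>2))" by (simp add: card_grid_box)
  also have "\<dots> \<le> h\<^sup>2 * (\<Sum>p\<in>grid_box n. bump d (grid_point h p))"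
    by (intro mult_left_mono sum_mono low) auto
  also have "\<dots> \<le> h\<^sup>2 * (\<Sum>p\<in>{p\<in>grid_box N. cmod (grid_point h p) < r}. bump d (grid_point h p))"
    using box lt by (intro mult_left_mono sum_mono2) (auto simp: bump_nonneg)
  finally show ?thesis .
qed

section \<open>Smooth cut-offs of the Green function\<close>

lemma DERIV_positive_part_power:
  "((\<lambda>t::real. max 0 t ^ Suc (Suc n)) has_real_derivative real (Suc (Suc n)) * max 0 t ^ Suc n) (at t)"
proof -
  consider "t > 0" | "t < 0" | "t = 0" by linarith
  then show ?thesis
  proof cases
    case 1
    have "((\<lambda>t. t ^ Suc (Suc n)) has_real_derivative real (Suc (Suc n)) * t ^ Suc n) (at t)"
      using DERIV_pow[of "Suc (Suc n)" t] by simp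
    then have "((\<lambda>t. max 0 t ^ Suc (Suc n)) has_real_derivative real (Suc (Suc n)) * t ^ Suc n) (at t)"
      by (rule has_field_derivative_transform_within_open[of _ _ _ "{0<..}"]) (use 1 in auto)
    then show ?thesis using 1 by simp
  next
    case 2
    have "((\<lambda>t. 0) has_real_derivative 0) (at t)" by simp
    then have "((\<lambda>t. max 0 t ^ Suc (Suc n)) has_real_derivative 0) (at t)"
      by (rule has_field_derivative_transform_within_open[of _ _ _ "{..<0}"]) (use 2 in auto)
    then show ?thesis using 2 by simp
  next
    case 3
    have "((\<lambda>h::real. max 0 h ^ Suc (Suc n) / h) \<longlongrightarrow> 0) (at 0)"
    proof (rule Lim_null_comparison)
      have "norm (max 0 h ^ Suc (Suc n) / h) \<le> \<bar>h\<bar> ^ Suc n" for h :: real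
      proof (cases "h > 0")
        case False
        then have "max 0 h = 0" by simp
        then show ?thesis by (simp del: power_Suc)
      qed simp
      then show "\<forall>\<^sub>F h in at 0. norm (max 0 h ^ Suc (Suc n) / h) \<le> \<bar>h\<bar> ^ Suc n" by simp
      have "((\<lambda>h::real. \<bar>h\<bar> ^ Suc n) \<longlongrightarrow> \<bar>0\<bar> ^ Suc n) (at 0)" by (intro tendsto_intros)
      then show "((\<lambda>h::real. \<bar>h\<bar> ^ Suc n) \<longlongrightarrow> 0) (at 0)" by simp
    qed
    then show ?thesis using 3 by (simp add: DERIV_def)
  qed
qed

text \<open>
  Take for \<open>H\<close> the second difference with step \<open>a/2\<close> of the function that is \<open>t\<^sup>3/6\<close> for positive \<open>t\<close> and
  \<open>0\<close> otherwise; then \<open>H''\<close> is a hat function on the interval from \<open>a\<close> to \<open>2 a\<close>.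
\<close>
lemma convex_cutoff:
  fixes a :: real
  assumes "0 < a"
  obtains H H' H'' :: "real \<Rightarrow> real" where
    "\<And>t. (H has_real_derivative H' t) (at t)" "\<And>t. (H' has_real_derivative H'' t) (at t)"
    "continuous_on UNIV H''" "\<And>t. 0 \<le> H'' t"
    "\<And>t. t \<le> a \<Longrightarrow> H t = 0" "\<And>t. t \<le> a \<Longrightarrow> H' t = 0" "\<And>t. t \<le> a \<Longrightarrow> H'' t = 0"
    "\<And>t. 2 * a \<le> t \<Longrightarrow> H'' t = 0" "\<And>t. 2 * a \<le> t \<Longrightarrow> H' t = H' (2 * a)"
    "\<And>t. a < t \<Longrightarrow> 0 < H t" "\<And>s t. s \<le> t \<Longrightarrow> H' s \<le> H' t" "\<And>s t. s \<le> t \<Longrightarrow> H s \<le> H t"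
proof -
  define P where "P n t = max 0 t ^ n" for n and t :: real
  define H where "H t = (P 3 (t - a) - 2 * P 3 (t - 3*a/2) + P 3 (t - 2*a)) / 6" for t
  define H' where "H' t = (P 2 (t - a) - 2 * P 2 (t - 3*a/2) + P 2 (t - 2*a)) / 2" for t
  define H'' where "H'' t = P 1 (t - a) - 2 * P 1 (t - 3*a/2) + P 1 (t - 2*a)" for t
  have P3: "((\<lambda>t. P 3 (t - b)) has_real_derivative 3 * P 2 (t - b)) (at t)" for t b
  proof -
    have "(P 3 has_real_derivative 3 * P 2 (t - b)) (at (t - b))"
      using DERIV_positive_part_power[of 1 "t - b"] unfolding P_def by (simp add: numeral_3_eq_3 numeral_2_eq_2)
    then show ?thesis by (rule DERIV_chain2[where s = "UNIV", simplified, THEN DERIV_cong]) (auto intro!: derivative_eq_intros)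
  qed
  have P2: "((\<lambda>t. P 2 (t - b)) has_real_derivative 2 * P 1 (t - b)) (at t)" for t b
  proof -
    have "(P 2 has_real_derivative 2 * P 1 (t - b)) (at (t - b))"
      using DERIV_positive_part_power[of 0 "t - b"] unfolding P_def by (simp add: numeral_2_eq_2)
    then show ?thesis by (rule DERIV_chain2[where s = "UNIV", simplified, THEN DERIV_cong]) (auto intro!: derivative_eq_intros)
  qed
  have third: "((3 * x - (0 * w + 3 * y * 2) + 3 * z) * 6 - v * 0) / (6 * 6) = (x - 2 * y + z) / 2" for x y z v w :: real
    by (simp add: field_simps)
  have second: "((2 * x - (0 * w + 2 * y * 2) + 2 * z) * 2 - v * 0) / (2 * 2) = x - 2 * y + z" for x y z v w :: real
    by (simp add: field_simps)
  have dH: "(H has_real_derivative H' t) (at t)" for t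
    unfolding H_def H'_def by (rule derivative_eq_intros P3 refl)+ (simp, rule third)
  have dH': "(H' has_real_derivative H'' t) (at t)" for t
    unfolding H'_def H''_def by (rule derivative_eq_intros P2 refl)+ (simp, rule second)
  have nonneg: "0 \<le> H'' t" for t using \<open>0 < a\<close> by (auto simp: H''_def P_def max_def)
  have zero: "H t = 0" "H' t = 0" "H'' t = 0" if "t \<le> a" for t
    using that \<open>0 < a\<close> by (auto simp: H_def H'_def H''_def P_def max_def)
  have mono': "H' s \<le> H' t" if "s \<le> t" for s t
    by (rule DERIV_nonneg_imp_nondecreasing[OF that]) (use dH' nonneg in blast)
  have nonneg': "0 \<le> H' t" for t using mono'[of "min a t" t] zero[of "min a t"] by simp
  have mono: "H s \<le> H t" if "s \<le> t" for s t
    by (rule DERIV_nonneg_imp_nondecreasing[OF that]) (use dH nonneg' in blast)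
  have pos': "0 < H' t" if "a < t" for t
  proof -
    define x where "x = min t (3*a/2)"
    have x: "a < x" "x \<le> 3*a/2" "x \<le> t" using that \<open>0 < a\<close> by (auto simp: x_def)
    have "x - 2*a \<le> 0" using x \<open>0 < a\<close> by linarith
    then have "H' x = (x - a)\<^sup>2 / 2" using x by (simp add: H'_def P_def max_def)
    moreover have "0 < (x - a)\<^sup>2" using x by simp
    ultimately have "0 < H' x" by linarith
    also have "\<dots> \<le> H' t" using x by (intro mono')
    finally show ?thesis .
  qed
  have pos: "0 < H t" if "a < t" for t
  proof -
    obtain x where "a < x" "x < t" "H t - H a = (t - a) * H' x" using MVT2[OF \<open>a < t\<close>, of H H'] dH by blast
    then show ?thesis using pos'[of x] that zero(1)[of a] by simp
  qed
  show ?thesis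
  proof (rule that[OF dH dH' _ nonneg zero])
    show "continuous_on UNIV H''" unfolding H''_def P_def by (intro continuous_intros)
    show "H'' t = 0" if "2 * a \<le> t" for t
      using that \<open>0 < a\<close> by (auto simp: H''_def P_def max_def)
    have eq: "H' t = a\<^sup>2 / 4" if "2 * a \<le> t" for t
    proof -
      have "P 2 (t - a) = (t-a)\<^sup>2" "P 2 (t - 3*a/2) = (t - 3*a/2)\<^sup>2" "P 2 (t - 2*a) = (t - 2*a)\<^sup>2"
        using that \<open>0 < a\<close> by (auto simp: P_def max_def)
      then show ?thesis unfolding H'_def by (simp add: power2_eq_square field_simps)
    qed
    show "H' t = H' (2 * a)" if "2 * a \<le> t" for t using eq[OF that] eq[of "2 * a"] by simp
  qed (use mono mono' pos in auto)
qed

text \<open>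
  \<open>Q\<close> is the squared gradient of \<open>g\<close>, and the term \<open>\<phi>'(g) \<Delta>g\<close> of the chain rule is zero. Since \<open>\<phi>\<close>
  vanishes on small values, the composition is \<open>C\<^sup>2\<close> also across the boundary of the hull, where \<open>g\<close>
  is merely continuous. One \<open>Q\<close> serves all cut-offs \<open>\<phi>\<close>.
\<close>
lemma green_compose_laplacian:
  assumes "is_green_function E g"
  obtains Q :: "complex \<Rightarrow> real" where "\<And>z. 0 \<le> Q z"
    "\<And>\<phi> \<phi>' \<phi>'' a. 0 < a \<Longrightarrow> (\<And>t. (\<phi> has_real_derivative \<phi>' t) (at t)) \<Longrightarrow>
      (\<And>t. (\<phi>' has_real_derivative \<phi>'' t) (at t)) \<Longrightarrow> continuous_on UNIV \<phi>'' \<Longrightarrow>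
      (\<And>t. t \<le> a \<Longrightarrow> \<phi> t = 0) \<Longrightarrow> (\<And>t. t \<le> a \<Longrightarrow> \<phi>' t = 0) \<Longrightarrow> (\<And>t. t \<le> a \<Longrightarrow> \<phi>'' t = 0) \<Longrightarrow>
      \<exists>fxx fyy. second_deriv_along 1 (\<lambda>z. \<phi> (g z)) fxx \<and> second_deriv_along \<i> (\<lambda>z. \<phi> (g z)) fyy \<and>
        continuous_on UNIV fxx \<and> continuous_on UNIV fyy \<and> (\<forall>z. fxx z + fyy z = \<phi>'' (g z) * Q z)"
proof -
  define D where "D = D_inf E"
  obtain gx gy gxx gxy gyx gyy where "open D" and g:
    "\<And>z. z \<in> D \<Longrightarrow> (g has_derivative (\<lambda>h. gx z * Re h + gy z * Im h)) (at z)"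
    "\<And>z. z \<in> D \<Longrightarrow> (gx has_derivative (\<lambda>h. gxx z * Re h + gxy z * Im h)) (at z)"
    "\<And>z. z \<in> D \<Longrightarrow> (gy has_derivative (\<lambda>h. gyx z * Re h + gyy z * Im h)) (at z)"
    "continuous_on D gxx" "continuous_on D gyy"
    "\<And>z. z \<in> D \<Longrightarrow> gxx z + gyy z = 0"
    using assms unfolding is_green_function_def harmonic_on_def D_def by blast
  have g0: "g z = 0" if "z \<notin> D" for z
    using assms that unfolding is_green_function_def D_def D_inf_def by blast
  have contg: "isCont g z" for z
    using green_continuous[OF assms] by (simp add: continuous_on_eq_continuous_at)
  have contgx: "isCont gx z" "isCont gy z" if "z \<in> D" for z
    using g(2,3)[OF that] has_derivative_continuous by blast+
  have contgxx: "isCont gxx z" "isCont gyy z" if "z \<in> D" for z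
    using g(4,5) that \<open>open D\<close> continuous_on_eq_continuous_at by blast+
  define Q where "Q z = (if z \<in> D then (gx z)\<^sup>2 + (gy z)\<^sup>2 else 0)" for z
  show ?thesis
  proof (rule that)
    show "0 \<le> Q z" for z by (simp add: Q_def)
    fix \<phi> \<phi>' \<phi>'' :: "real \<Rightarrow> real" and a :: real
    assume a: "0 < a" and d1: "\<And>t. (\<phi> has_real_derivative \<phi>' t) (at t)"
      and d2: "\<And>t. (\<phi>' has_real_derivative \<phi>'' t) (at t)" and c2: "continuous_on UNIV \<phi>''"
      and z: "\<And>t. t \<le> a \<Longrightarrow> \<phi> t = 0" "\<And>t. t \<le> a \<Longrightarrow> \<phi>' t = 0" "\<And>t. t \<le> a \<Longrightarrow> \<phi>'' t = 0"
    \<comment> \<open>the two directions are treated alike; G1 and G2 are the derivatives of g along e\<close>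
    have main: "second_deriv_along e (\<lambda>z. \<phi> (g z)) (\<lambda>z. if z \<in> D then \<phi>'' (g z) * (G1 z)\<^sup>2 + \<phi>' (g z) * G2 z else 0)
       \<and> continuous_on UNIV (\<lambda>z. if z \<in> D then \<phi>'' (g z) * (G1 z)\<^sup>2 + \<phi>' (g z) * G2 z else 0)"
      if G1: "\<And>z. z \<in> D \<Longrightarrow> ((\<lambda>t. g (z + of_real t * e)) has_real_derivative G1 z) (at 0)"
      and G2: "\<And>z. z \<in> D \<Longrightarrow> ((\<lambda>t. G1 (z + of_real t * e)) has_real_derivative G2 z) (at 0)"
      and cG1: "\<And>z. z \<in> D \<Longrightarrow> isCont G1 z" and cG2: "\<And>z. z \<in> D \<Longrightarrow> isCont G2 z"
      for e G1 G2
    proof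
      define F1 where "F1 = (\<lambda>z. if z \<in> D then \<phi>' (g z) * G1 z else 0)"
      let ?F2 = "\<lambda>z. if z \<in> D then \<phi>'' (g z) * (G1 z)\<^sup>2 + \<phi>' (g z) * G2 z else 0"
      have line: "((\<lambda>t. z + of_real t * e) \<longlongrightarrow> z) (at (0::real))" for z
        by (auto intro!: tendsto_eq_intros)
      have inD: "\<forall>\<^sub>F w in nhds z. w \<in> D" if "z \<in> D" for z
        using \<open>open D\<close> that by (simp add: eventually_nhds_in_open)
      have low: "\<forall>\<^sub>F w in nhds z. g w < a" if "z \<notin> D" for z
        using eventually_nhds_in_open[of "{w. g w < a}" z] g0[OF that] \<open>0 < a\<close>
          open_Collect_less[OF green_continuous[OF assms] continuous_on_const[of UNIV a]] by simp
      have lineD: "\<forall>\<^sub>F t in nhds (0::real). R (z + of_real t * e)" if "\<forall>\<^sub>F w in nhds z. R w" for z R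
      proof -
        have "((\<lambda>t. z + of_real t * e) \<longlongrightarrow> z) (nhds (0::real))"
          using isCont_def tendsto_at_iff_tendsto_nhds line by (auto simp: tendsto_nhds_iff intro!: tendsto_eq_intros filterlim_ident)
        then show ?thesis using that by (simp add: filterlim_iff)
      qed
      show "second_deriv_along e (\<lambda>z. \<phi> (g z)) ?F2"
        unfolding second_deriv_along_def
      proof (intro exI[of _ F1] allI conjI)
        fix z
        show "((\<lambda>t. \<phi> (g (z + of_real t * e))) has_real_derivative F1 z) (at 0)"
        proof (cases "z \<in> D")
          case True
          have "(\<phi> has_real_derivative \<phi>' (g z)) (at (g (z + of_real 0 * e)))" using d1 by simp
          from DERIV_chain2[OF this G1[OF True]] show ?thesis using True by (simp add: F1_def)
        next
          case False
          have "\<forall>\<^sub>F t in nhds (0::real). \<phi> (g (z + of_real t * e)) = 0"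
            using lineD[OF low[OF False]] by eventually_elim (simp add: z)
          then show ?thesis using False by (subst DERIV_cong_ev[OF refl _ refl]) (auto simp: F1_def)
        qed
        show "((\<lambda>t. F1 (z + of_real t * e)) has_real_derivative ?F2 z) (at 0)"
        proof (cases "z \<in> D")
          case True
          have "(\<phi>' has_real_derivative \<phi>'' (g z)) (at (g (z + of_real 0 * e)))" using d2 by simp
          from DERIV_mult[OF DERIV_chain2[OF this G1[OF True]] G2[OF True]]
          have "((\<lambda>t. \<phi>' (g (z + of_real t * e)) * G1 (z + of_real t * e)) has_real_derivative
              \<phi>'' (g z) * (G1 z)\<^sup>2 + \<phi>' (g z) * G2 z) (at 0)"
            by (simp add: power2_eq_square algebra_simps)
          moreover have "\<forall>\<^sub>F t in nhds (0::real). \<phi>' (g (z + of_real t * e)) * G1 (z + of_real t * e) = F1 (z + of_real t * e)"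
            using lineD[OF inD[OF True]] by eventually_elim (simp add: F1_def)
          ultimately show ?thesis using True
            by (subst DERIV_cong_ev[OF refl _ refl]) (auto simp: eq_commute)
        next
          case False
          have "\<forall>\<^sub>F t in nhds (0::real). F1 (z + of_real t * e) = 0"
            using lineD[OF low[OF False]] by eventually_elim (simp add: z F1_def)
          then show ?thesis using False by (subst DERIV_cong_ev[OF refl _ refl]) auto
        qed
      qed
      have "isCont ?F2 z" for z
      proof (cases "z \<in> D")
        case True
        have "isCont (\<lambda>z. \<phi>' (g z)) z"
          by (rule isCont_o2[OF contg DERIV_isCont[OF d2]])
        moreover have "isCont (\<lambda>z. \<phi>'' (g z)) z"
          by (rule isCont_o2[OF contg]) (use c2 in \<open>simp add: continuous_on_eq_continuous_at\<close>)
        ultimately have "isCont (\<lambda>z. \<phi>'' (g z) * (G1 z)\<^sup>2 + \<phi>' (g z) * G2 z) z"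
          using cG1[OF True] cG2[OF True] by (intro continuous_intros)
        moreover have "\<forall>\<^sub>F w in nhds z. \<phi>'' (g w) * (G1 w)\<^sup>2 + \<phi>' (g w) * G2 w = ?F2 w"
          using inD[OF True] by eventually_elim simp
        ultimately show ?thesis by (subst (asm) isCont_cong)
      next
        case False
        have "isCont (\<lambda>z. 0::real) z" by simp
        moreover have "\<forall>\<^sub>F w in nhds z. 0 = ?F2 w"
          using low[OF False] by eventually_elim (simp add: z)
        ultimately show ?thesis by (subst (asm) isCont_cong)
      qed
      then show "continuous_on UNIV ?F2" by (simp add: continuous_on_eq_continuous_at)
    qed
    define fxx where "fxx = (\<lambda>z. if z \<in> D then \<phi>'' (g z) * (gx z)\<^sup>2 + \<phi>' (g z) * gxx z else 0)"
    define fyy where "fyy = (\<lambda>z. if z \<in> D then \<phi>'' (g z) * (gy z)\<^sup>2 + \<phi>' (g z) * gyy z else 0)"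
    have "second_deriv_along 1 (\<lambda>z. \<phi> (g z)) fxx \<and> continuous_on UNIV fxx"
      unfolding fxx_def
    proof (rule main)
      fix z assume "z \<in> D"
      show "((\<lambda>t. g (z + of_real t * 1)) has_real_derivative gx z) (at 0)"
        using DERIV_along_line[of g _ _ z 0 1] g(1)[OF \<open>z \<in> D\<close>] by force
      show "((\<lambda>t. gx (z + of_real t * 1)) has_real_derivative gxx z) (at 0)"
        using DERIV_along_line[of gx _ _ z 0 1] g(2)[OF \<open>z \<in> D\<close>] by force
    qed (use contgx contgxx in auto)
    moreover have "second_deriv_along \<i> (\<lambda>z. \<phi> (g z)) fyy \<and> continuous_on UNIV fyy"
      unfolding fyy_def
    proof (rule main)
      fix z assume "z \<in> D"
      show "((\<lambda>t. g (z + of_real t * \<i>)) has_real_derivative gy z) (at 0)"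
        using DERIV_along_line[of g _ _ z 0 \<i>] g(1)[OF \<open>z \<in> D\<close>] by force
      show "((\<lambda>t. gy (z + of_real t * \<i>)) has_real_derivative gyy z) (at 0)"
        using DERIV_along_line[of gy _ _ z 0 \<i>] g(3)[OF \<open>z \<in> D\<close>] by force
    qed (use contgx contgxx in auto)
    moreover have "fxx z + fyy z = \<phi>'' (g z) * Q z" for z
    proof (cases "z \<in> D")
      case True
      have "fxx z + fyy z = \<phi>'' (g z) * ((gx z)\<^sup>2 + (gy z)\<^sup>2) + \<phi>' (g z) * (gxx z + gyy z)"
        using True by (simp add: fxx_def fyy_def algebra_simps)
      then show ?thesis using True g(6)[OF True] by (simp add: Q_def)
    qed (simp add: fxx_def fyy_def Q_def)
    ultimately show "\<exists>fxx fyy. second_deriv_along 1 (\<lambda>z. \<phi> (g z)) fxx \<and> second_deriv_along \<i> (\<lambda>z. \<phi> (g z)) fyy \<and>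
        continuous_on UNIV fxx \<and> continuous_on UNIV fyy \<and> (\<forall>z. fxx z + fyy z = \<phi>'' (g z) * Q z)"
      by blast
  qed
qed

section \<open>A discrete potential that separates the hull from the outside\<close>

lemma grid_point_add: "grid_point h (p + p') = grid_point h p + grid_point h p'"
  by (simp add: grid_point_def complex_eq_iff algebra_simps)

lemma grid_point_diff: "grid_point h (p - p') = grid_point h p - grid_point h p'"
  by (simp add: grid_point_def complex_eq_iff algebra_simps)

lemma cmod_grid_point_ge:
  assumes "0 < h" "int N \<le> \<bar>fst p\<bar> \<or> int N \<le> \<bar>snd p\<bar>"
  shows "h * N \<le> cmod (grid_point h p)"
proof -
  have "real N \<le> \<bar>of_int (fst p)\<bar> \<or> real N \<le> \<bar>of_int (snd p)\<bar>" using assms(2) by linarith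
  then have "h * N \<le> \<bar>h * of_int (fst p)\<bar> \<or> h * N \<le> \<bar>h * of_int (snd p)\<bar>"
    using assms(1) by (auto simp: abs_mult)
  then show ?thesis
    using abs_Re_le_cmod[of "grid_point h p"] abs_Im_le_cmod[of "grid_point h p"]
    by (auto simp: grid_point_def)
qed

lemma in_grid_boxI:
  assumes "0 < h" "cmod (grid_point h p) < h * N"
  shows "p \<in> grid_box N"
proof -
  have "\<bar>fst p\<bar> < int N" "\<bar>snd p\<bar> < int N"
    using cmod_grid_point_ge[OF assms(1), of N p] assms(2) by linarith+
  then show ?thesis by (cases p) (auto simp: grid_box_def)
qed

lemma near_grid_point:
  assumes "0 < h"
  obtains p where "cmod (z - grid_point h p) \<le> 2 * h"
proof -
  define p where "p = (\<lfloor>Re z / h\<rfloor>, \<lfloor>Im z / h\<rfloor>)"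
  have *: "\<bar>x - h * of_int \<lfloor>x / h\<rfloor>\<bar> \<le> h" for x
  proof -
    have "x - h * of_int \<lfloor>x / h\<rfloor> = h * (x / h - of_int \<lfloor>x / h\<rfloor>)" using assms by (simp add: field_simps)
    also have "\<bar>\<dots>\<bar> = h * \<bar>x / h - of_int \<lfloor>x / h\<rfloor>\<bar>" using assms by (simp add: abs_mult)
    also have "\<dots> \<le> h * 1" using assms by (intro mult_left_mono) linarith+
    finally show ?thesis by simp
  qed
  have "cmod (z - grid_point h p) \<le> \<bar>Re (z - grid_point h p)\<bar> + \<bar>Im (z - grid_point h p)\<bar>"
    by (rule cmod_le)
  also have "\<dots> \<le> h + h" using *[of "Re z"] *[of "Im z"] by (intro add_mono) (simp_all add: grid_point_def p_def)
  finally show ?thesis using that by simp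
qed

text \<open>
  Exact translation invariance holds because the centre is itself a grid point.
\<close>
lemma shifted_bump_mass:
  assumes "0 < h" "r + cmod (grid_point h p0) \<le> h * N"
  shows "(\<Sum>p\<in>{p\<in>grid_box N. cmod (grid_point h p - grid_point h p0) < r}. bump d (grid_point h p - grid_point h p0))
       = (\<Sum>p\<in>{p\<in>grid_box N. cmod (grid_point h p) < r}. bump d (grid_point h p))"
proof (rule sum.reindex_bij_witness[of _ "\<lambda>p. p + p0" "\<lambda>p. p - p0"])
  fix p assume "p \<in> {p\<in>grid_box N. cmod (grid_point h p) < r}"
  then have p: "cmod (grid_point h p) < r" by simp
  have "cmod (grid_point h (p + p0)) < h * N"
    unfolding grid_point_add using norm_triangle_ineq[of "grid_point h p" "grid_point h p0"] p assms(2) by linarith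
  then show "p + p0 \<in> {p\<in>grid_box N. cmod (grid_point h p - grid_point h p0) < r}"
    using p in_grid_boxI[OF assms(1)] by (simp add: grid_point_add)
next
  fix p assume "p \<in> {p\<in>grid_box N. cmod (grid_point h p - grid_point h p0) < r}"
  then have p: "cmod (grid_point h (p - p0)) < r" by (simp add: grid_point_diff)
  then have "cmod (grid_point h (p - p0)) < h * N" using assms(2) norm_ge_zero[of "grid_point h p0"] by linarith
  then show "p - p0 \<in> {p\<in>grid_box N. cmod (grid_point h p) < r}"
    using p in_grid_boxI[OF assms(1)] by simp
qed (simp_all add: grid_point_diff)

text \<open>
  \<open>bump d\<close> acts as an approximate identity: near the centre \<open>q\<close> is at most \<open>c - \<beta>\<close>, and the tail, where
  only \<open>q \<le> c\<close> is known, has mass of order \<open>d\<^sup>2\<close>.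
\<close>
lemma bump_convolution_upper:
  assumes h: "0 < h" "h \<le> 1" and "0 < r" "0 \<le> R" "r + cmod (grid_point h p0) \<le> h * N"
    and q: "\<And>w. 0 \<le> q w" "\<And>w. q w \<le> c" "\<And>w. R < cmod w \<Longrightarrow> q w = 0"
    and near: "\<And>w. cmod (w - grid_point h p0) < r \<Longrightarrow> q w \<le> c - \<beta>"
  shows "h\<^sup>2 * (\<Sum>p\<in>grid_box N. q (grid_point h p) * bump d (grid_point h p - grid_point h p0))
    \<le> (c - \<beta>) * (h\<^sup>2 * (\<Sum>p\<in>{p\<in>grid_box N. cmod (grid_point h p) < r}. bump d (grid_point h p)))
      + c * (2 * d\<^sup>2 / r^4) * (2 * R + 1)\<^sup>2"
proof -
  let ?P = "grid_point h" and ?l = "grid_point h p0"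
  let ?F = "\<lambda>p. q (?P p) * bump d (?P p - ?l)"
  let ?A = "{p\<in>grid_box N. cmod (?P p - ?l) < r}" and ?B = "{p\<in>grid_box N. \<not> cmod (?P p - ?l) < r}"
  have c: "0 \<le> c" using q(1)[of 0] q(2)[of 0] by linarith
  have "(\<Sum>p\<in>?A. ?F p) \<le> (\<Sum>p\<in>?A. (c - \<beta>) * bump d (?P p - ?l))"
    by (intro sum_mono mult_right_mono near) (auto simp: bump_nonneg)
  also have "\<dots> = (c - \<beta>) * (\<Sum>p\<in>{p\<in>grid_box N. cmod (?P p) < r}. bump d (?P p))"
    by (simp only: sum_distrib_left[symmetric] shifted_bump_mass[OF h(1) assms(5), of d])
  finally have 1: "h\<^sup>2 * (\<Sum>p\<in>?A. ?F p) \<le> h\<^sup>2 * ((c - \<beta>) * (\<Sum>p\<in>{p\<in>grid_box N. cmod (?P p) < r}. bump d (?P p)))"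
    by (intro mult_left_mono) auto
  have 2: "h\<^sup>2 * (\<Sum>p\<in>?B. ?F p) \<le> c * (2 * d\<^sup>2 / r^4) * (2 * R + 1)\<^sup>2"
  proof (rule grid_sum_le[OF h])
    fix p assume "p \<in> ?B"
    then have "r \<le> cmod (?P p - ?l)" by simp
    then have "r\<^sup>2 \<le> (cmod (?P p - ?l))\<^sup>2 + d\<^sup>2" using \<open>0 < r\<close> by (simp add: power_mono add_increasing2)
    then have "(r\<^sup>2)\<^sup>2 \<le> ((cmod (?P p - ?l))\<^sup>2 + d\<^sup>2)\<^sup>2" by (intro power_mono) auto
    moreover have "0 < (r\<^sup>2)\<^sup>2" using \<open>0 < r\<close> by simp
    ultimately have "bump d (?P p - ?l) \<le> 2 * d\<^sup>2 / (r\<^sup>2)\<^sup>2"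
      unfolding bump_alt by (intro divide_left_mono mult_pos_pos) (auto simp del: zero_less_power2)
    then have "bump d (?P p - ?l) \<le> 2 * d\<^sup>2 / r^4" by (simp flip: power_mult)
    then show "?F p \<le> c * (2 * d\<^sup>2 / r^4)" by (intro mult_mono q c bump_nonneg)
  qed (use assms c in auto)
  have "grid_box N = ?A \<union> ?B" by auto
  then have "(\<Sum>p\<in>grid_box N. ?F p) = (\<Sum>p\<in>?A. ?F p) + (\<Sum>p\<in>?B. ?F p)"
    by (subst \<open>grid_box N = _\<close>, intro sum.union_disjoint) auto
  then show ?thesis using 1 2 by (simp add: algebra_simps)
qed

lemma bump_convolution_lower:
  assumes h: "0 < h" "r + cmod (grid_point h p0) \<le> h * N"
    and q: "\<And>w. 0 \<le> q w" and near: "\<And>w. cmod (w - grid_point h p0) < r \<Longrightarrow> q w = c"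
  shows "c * (h\<^sup>2 * (\<Sum>p\<in>{p\<in>grid_box N. cmod (grid_point h p) < r}. bump d (grid_point h p)))
    \<le> h\<^sup>2 * (\<Sum>p\<in>grid_box N. q (grid_point h p) * bump d (grid_point h p - grid_point h p0))"
proof -
  let ?P = "grid_point h" and ?l = "grid_point h p0"
  let ?F = "\<lambda>p. q (?P p) * bump d (?P p - ?l)"
  let ?A = "{p\<in>grid_box N. cmod (?P p - ?l) < r}"
  have "c * (\<Sum>p\<in>{p\<in>grid_box N. cmod (?P p) < r}. bump d (?P p)) = c * (\<Sum>p\<in>?A. bump d (?P p - ?l))"
    using shifted_bump_mass[OF h, of d] by simp
  also have "\<dots> = (\<Sum>p\<in>?A. ?F p)" unfolding sum_distrib_left by (intro sum.cong) (auto simp: near)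
  also have "\<dots> \<le> (\<Sum>p\<in>grid_box N. ?F p)" by (intro sum_mono2) (auto simp: q bump_nonneg)
  finally have "h\<^sup>2 * (c * (\<Sum>p\<in>{p\<in>grid_box N. cmod (?P p) < r}. bump d (?P p))) \<le> h\<^sup>2 * (\<Sum>p\<in>grid_box N. ?F p)"
    by (intro mult_left_mono) auto
  then show ?thesis by (simp add: algebra_simps)
qed

lemma sublevel_radius:
  assumes "is_green_function E g"
  obtains R where "0 \<le> R" "\<And>z. g z \<le> t \<Longrightarrow> cmod z \<le> R"
proof -
  have "bounded {z. g z \<le> t}"
    by (rule compact_imp_bounded[OF compact_sublevel[OF green_continuous[OF assms] green_at_top[OF assms]]])
  then obtain R where "0 < R" "\<forall>z\<in>{z. g z \<le> t}. cmod z \<le> R" unfolding bounded_pos by blast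
  then show ?thesis using that[of R] by auto
qed

lemma continuous_bounded_on_cball:
  fixes u :: "complex \<Rightarrow> real"
  assumes "continuous_on UNIV u"
  obtains B where "0 \<le> B" "\<And>z. cmod z \<le> R \<Longrightarrow> \<bar>u z\<bar> \<le> B"
proof -
  have "bounded (u ` cball 0 R)"
    by (intro compact_imp_bounded compact_continuous_image continuous_on_subset[OF assms]) auto
  then obtain B where "0 < B" "\<forall>y\<in>u ` cball 0 R. norm y \<le> B" unfolding bounded_pos by blast
  then show ?thesis using that[of B] by auto
qed

lemma five_point_diff_translates:
  "five_point h (\<lambda>w. \<psi> (w - l) - \<psi> (w - k)) w = five_point h \<psi> (w - l) - five_point h \<psi> (w - k)"
proof -
  have "w + x - y = w - y + x" "w - x - y = w - y - x" for x y :: complex by simp_all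
  then show ?thesis unfolding five_point_def by (simp only: right_diff_distrib)
qed

text \<open>
  The outline: let \<open>f = \<phi>(g)\<close>, where \<open>\<phi>\<close> equals the convex cut-off \<open>H\<close> up to a high level \<open>\<tau>\<close> and is
  bent back to a constant \<open>c\<close> beyond it, so that \<open>q = c - f\<close> has compact support. The Laplacian of \<open>f\<close> is
  \<open>\<rho> - \<rho>m\<close> with \<open>\<rho>, \<rho>m \<ge> 0\<close>, where \<open>\<rho>\<close> is supported in \<open>s/4 \<le> g \<le> s/2\<close> and \<open>\<rho>m\<close> near infinity.
  Summation by parts against \<open>\<Psi>(w) = \<psi>(w - l) - \<psi>(w - k)\<close>, with \<open>\<psi>\<close> the smoothed logarithm, gives
  \<open>\<Sum> \<rho> \<Psi> \<approx> \<Sum> \<rho>m \<Psi> + \<Sum> q (bump(\<cdot> - k) - bump(\<cdot> - l))\<close>. The last sum is bounded below, because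
  \<open>q = c\<close> near \<open>k\<close> and \<open>q \<le> c - \<beta>\<close> near \<open>l\<close>. The term with \<open>\<rho>m\<close> is small because \<open>\<Psi>\<close> is small far
  away. So \<open>\<rho>\<close> at the grid points serves as the system of weights.

  The mass bound \<open>C\<close> for \<open>\<rho>\<close> and the gap \<open>\<beta>\<close> must not depend on \<open>\<tau>\<close>. The constants are chosen in
  the order \<open>C, r, \<beta>, \<eta>, \<tau>, c, d, e1, e2, h\<close>, each error being at most \<open>\<beta>/16\<close>.
\<close>
lemma discrete_potential:
  assumes G: "is_green_function E g" and "0 < s"
  obtains I :: "(int \<times> int) set" and pt :: "int \<times> int \<Rightarrow> complex" and wt :: "int \<times> int \<Rightarrow> real" and \<beta> :: real
  where "finite I" "0 < \<beta>" "\<And>p. p \<in> I \<Longrightarrow> 0 \<le> wt p"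
    "\<And>p. p \<in> I \<Longrightarrow> 0 < g (pt p)" "\<And>p. p \<in> I \<Longrightarrow> g (pt p) < s / 2"
    "\<And>l k. cmod l \<le> R1 \<Longrightarrow> s \<le> g l \<Longrightarrow> g k = 0 \<Longrightarrow>
       \<beta> \<le> (\<Sum>p\<in>I. wt p * (ln (cmod (l - pt p)) - ln (cmod (k - pt p))))"
proof -
  have contg: "continuous_on UNIV g" by (rule green_continuous[OF G])
  obtain Q where Q: "\<And>z. 0 \<le> Q z" and comp:
    "\<And>\<phi> \<phi>' \<phi>'' a. 0 < a \<Longrightarrow> (\<And>t. (\<phi> has_real_derivative \<phi>' t) (at t)) \<Longrightarrow>
      (\<And>t. (\<phi>' has_real_derivative \<phi>'' t) (at t)) \<Longrightarrow> continuous_on UNIV \<phi>'' \<Longrightarrow>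
      (\<And>t. t \<le> a \<Longrightarrow> \<phi> t = 0) \<Longrightarrow> (\<And>t. t \<le> a \<Longrightarrow> \<phi>' t = 0) \<Longrightarrow> (\<And>t. t \<le> a \<Longrightarrow> \<phi>'' t = 0) \<Longrightarrow>
      \<exists>fxx fyy. second_deriv_along 1 (\<lambda>z. \<phi> (g z)) fxx \<and> second_deriv_along \<i> (\<lambda>z. \<phi> (g z)) fyy \<and>
        continuous_on UNIV fxx \<and> continuous_on UNIV fyy \<and> (\<forall>z. fxx z + fyy z = \<phi>'' (g z) * Q z)"
    using green_compose_laplacian[OF G] by blast
  \<comment> \<open>the cut-off vanishes up to s/4 and is affine from s/2 on; s/8 is kept for moving points to the grid\<close>
  define a where "a = s / 4"
  have a: "0 < a" "s = 4 * a" using \<open>0 < s\<close> by (auto simp: a_def)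
  obtain H H' H'' :: "real \<Rightarrow> real" where
    H: "\<And>t. (H has_real_derivative H' t) (at t)" "\<And>t. (H' has_real_derivative H'' t) (at t)"
      "continuous_on UNIV H''" "\<And>t. 0 \<le> H'' t" and
    H0: "\<And>t. t \<le> a \<Longrightarrow> H t = 0" "\<And>t. t \<le> a \<Longrightarrow> H' t = 0" "\<And>t. t \<le> a \<Longrightarrow> H'' t = 0" and
    H2: "\<And>t. 2 * a \<le> t \<Longrightarrow> H'' t = 0" "\<And>t. 2 * a \<le> t \<Longrightarrow> H' t = H' (2 * a)" and
    Hpos: "\<And>t. a < t \<Longrightarrow> 0 < H t" and Hmono: "\<And>s t. s \<le> t \<Longrightarrow> H' s \<le> H' t" "\<And>s t. s \<le> t \<Longrightarrow> H s \<le> H t"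
    by (rule convex_cutoff[OF a(1)], rule that)
  define \<rho> where "\<rho> z = H'' (g z) * Q z" for z
  have \<rho>_nonneg: "0 \<le> \<rho> z" for z using H(4) Q by (simp add: \<rho>_def)
  have \<rho>_supp: "a < g z \<and> g z < 2 * a" if "\<rho> z \<noteq> 0" for z
    using that H0(3)[of "g z"] H2(1)[of "g z"] by (force simp: \<rho>_def)
  obtain R0 where R0: "0 \<le> R0" "\<And>z. g z \<le> s \<Longrightarrow> cmod z \<le> R0" using sublevel_radius[OF G] by metis
  define R where "R = max R1 R0"
  have R: "R1 \<le> R" "R0 \<le> R" "0 \<le> R" using R0 by (auto simp: R_def)
  have cont_\<rho>: "continuous_on UNIV \<rho>"
  proof -
    obtain fxx fyy where f: "continuous_on UNIV fxx" "continuous_on UNIV fyy" "\<forall>z. fxx z + fyy z = H'' (g z) * Q z"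
      using comp[OF a(1) H(1-3) H0] by blast
    have "\<rho> = (\<lambda>z. fxx z + fyy z)" using f(3) by (auto simp: \<rho>_def)
    moreover have "continuous_on UNIV (\<lambda>z. fxx z + fyy z)" by (intro continuous_on_add f)
    ultimately show ?thesis by (simp only:)
  qed
  obtain M where M: "0 \<le> M" "\<And>z. cmod z \<le> R0 \<Longrightarrow> \<bar>\<rho> z\<bar> \<le> M"
    using continuous_bounded_on_cball[OF cont_\<rho>] by metis
  define C where "C = M * (2 * R0 + 1)\<^sup>2"
  have C: "0 \<le> C" using M by (simp add: C_def)
  obtain r where r: "0 < r" "r \<le> 1" and osc: "\<And>x y. cmod x \<le> R + 2 \<Longrightarrow> cmod y \<le> R + 2 \<Longrightarrow> cmod (x - y) < r \<Longrightarrow> \<bar>g x - g y\<bar> < a / 2"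
  proof -
    have "uniformly_continuous_on (cball 0 (R + 2)) g"
      by (rule compact_uniformly_continuous[OF continuous_on_subset[OF contg]]) auto
    moreover have "0 < a / 2" using a by simp
    ultimately obtain d where d: "d > 0" "\<forall>x\<in>cball 0 (R+2). \<forall>y\<in>cball 0 (R+2). dist y x < d \<longrightarrow> dist (g y) (g x) < a / 2"
      unfolding uniformly_continuous_on_def by blast
    show ?thesis
    proof (rule that[of "min 1 d"])
      fix x y assume *: "cmod x \<le> R + 2" "cmod y \<le> R + 2" "cmod (x - y) < min 1 d"
      then have "dist (g x) (g y) < a / 2" using d(2)[rule_format, of y x] by (simp add: dist_norm[of x y])
      then show "\<bar>g x - g y\<bar> < a / 2" by (simp add: dist_real_def)
    qed (use d in auto)
  qed
  define \<beta> where "\<beta> = H (3 * a)"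
  have \<beta>: "0 < \<beta>" using Hpos[of "3 * a"] a by (simp add: \<beta>_def)
  define \<eta> where "\<eta> = \<beta> / (16 * (C + 1))"
  have \<eta>: "0 < \<eta>" "\<eta> * (C + 1) = \<beta> / 16" using \<beta> C by (auto simp: \<eta>_def field_simps)
  \<comment> \<open>beyond modulus X the logarithmic kernels at any l and k of modulus at most R + 1 differ by at most \<eta>\<close>
  define m where "m = 2 * (R + 1) / \<eta>"
  have m: "0 < m" "2 * (R + 1) / m = \<eta>" using R \<eta> by (auto simp: m_def)
  define X where "X = R + 1 + m"
  obtain Bg where Bg: "0 \<le> Bg" "\<And>z. cmod z \<le> X \<Longrightarrow> \<bar>g z\<bar> \<le> Bg"
    using continuous_bounded_on_cball[OF contg] by metis
  \<comment> \<open>\<rho>m is to live where g exceeds \<tau>, hence outside the disc of radius X\<close>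
  define \<tau> where "\<tau> = max s Bg"
  have \<tau>: "s \<le> \<tau>" "Bg \<le> \<tau>" by (auto simp: \<tau>_def)
  define \<phi> where "\<phi> t = H t - H (t - \<tau>)" for t
  define \<phi>' where "\<phi>' t = H' t - H' (t - \<tau>)" for t
  define \<phi>'' where "\<phi>'' t = H'' t - H'' (t - \<tau>)" for t
  have d\<phi>: "(\<phi> has_real_derivative \<phi>' t) (at t)" for t
    unfolding \<phi>_def \<phi>'_def
    by (rule DERIV_diff[OF H(1)]) (use DERIV_shift[of H "H' (t - \<tau>)" t "- \<tau>"] H(1) in simp)
  have d\<phi>': "(\<phi>' has_real_derivative \<phi>'' t) (at t)" for t
    unfolding \<phi>'_def \<phi>''_def
    by (rule DERIV_diff[OF H(2)]) (use DERIV_shift[of H' "H'' (t - \<tau>)" t "- \<tau>"] H(2) in simp)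
  have c\<phi>: "continuous_on UNIV \<phi>''"
    unfolding \<phi>''_def by (intro continuous_intros continuous_on_compose2[OF H(3)]) auto
  have \<phi>0: "\<phi> t = 0" "\<phi>' t = 0" "\<phi>'' t = 0" if "t \<le> a" for t
  proof -
    have "t - \<tau> \<le> a" using that \<tau> a by linarith
    then show "\<phi> t = 0" "\<phi>' t = 0" "\<phi>'' t = 0" using H0 that by (auto simp: \<phi>_def \<phi>'_def \<phi>''_def)
  qed
  have \<phi>mono: "\<phi> x \<le> \<phi> y" if "x \<le> y" for x y
  proof (rule DERIV_nonneg_imp_nondecreasing[OF that])
    fix t
    have "0 \<le> \<phi>' t" using Hmono(1)[of "t - \<tau>" t] \<tau> a by (simp add: \<phi>'_def)
    then show "\<exists>y. (\<phi> has_real_derivative y) (at t) \<and> 0 \<le> y" using d\<phi> by blast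
  qed
  define c where "c = \<phi> (\<tau> + 2 * a)"
  have \<phi>c: "\<phi> t = c" if "\<tau> + 2 * a \<le> t" for t
  proof (cases "t = \<tau> + 2 * a")
    case False
    then have "\<tau> + 2 * a < t" using that by simp
    then obtain x where x: "\<tau> + 2 * a < x" "\<phi> t - \<phi> (\<tau> + 2 * a) = (t - (\<tau> + 2 * a)) * \<phi>' x"
      using MVT2[of "\<tau> + 2 * a" t \<phi> \<phi>'] d\<phi> by blast
    have "2 * a \<le> x" "2 * a \<le> x - \<tau>" using x(1) \<tau> a by linarith+
    then have "\<phi>' x = 0" using H2(2) by (metis \<phi>'_def diff_self)
    then show ?thesis using x by (simp add: c_def)
  qed (simp add: c_def)
  have \<phi>bounds: "0 \<le> \<phi> t" "\<phi> t \<le> c" for t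
    using \<phi>mono[of "min t a" t] \<phi>0(1)[of "min t a"] \<phi>mono[of t "max t (\<tau> + 2 * a)"] \<phi>c[of "max t (\<tau> + 2 * a)"] by auto
  have \<phi>3: "\<beta> \<le> \<phi> t" if "3 * a \<le> t" for t
  proof -
    have "3 * a - \<tau> \<le> a" using \<tau> a by linarith
    then have "\<phi> (3 * a) = \<beta>" using H0(1) by (simp add: \<phi>_def \<beta>_def)
    then show ?thesis using \<phi>mono[OF that] by simp
  qed
  have c: "0 < c" using \<phi>3[of "3*a"] \<phi>bounds(2)[of "3*a"] \<beta> by simp
  obtain fxx fyy where f: "second_deriv_along 1 (\<lambda>z. \<phi> (g z)) fxx" "second_deriv_along \<i> (\<lambda>z. \<phi> (g z)) fyy"
    "continuous_on UNIV fxx" "continuous_on UNIV fyy" "\<And>z. fxx z + fyy z = \<phi>'' (g z) * Q z"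
    using comp[OF a(1) d\<phi> d\<phi>' c\<phi> \<phi>0] by blast
  define f where "f z = \<phi> (g z)" for z
  define \<rho>m where "\<rho>m z = H'' (g z - \<tau>) * Q z" for z
  have \<rho>m_nonneg: "0 \<le> \<rho>m z" for z using H(4) Q by (simp add: \<rho>m_def)
  have lapf: "fxx z + fyy z = \<rho> z - \<rho>m z" for z
    unfolding f(5) \<rho>_def \<rho>m_def \<phi>''_def by (simp add: left_diff_distrib)
  have \<rho>m_supp: "X < cmod z" if "\<rho>m z \<noteq> 0" for z
  proof (rule ccontr)
    assume "\<not> X < cmod z"
    then have "g z - \<tau> \<le> a" using Bg(2)[of z] \<tau> a by simp
    then show False using that H0(3) by (simp add: \<rho>m_def)
  qed
  define q where "q z = c - f z" for z
  obtain R2 where R2: "0 \<le> R2" "\<And>z. g z \<le> \<tau> + 2 * a \<Longrightarrow> cmod z \<le> R2" using sublevel_radius[OF G] by metis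
  have q: "0 \<le> q w" "q w \<le> c" for w using \<phi>bounds by (auto simp: q_def f_def)
  have far: "f w = c" "q w = 0" "\<rho> w = 0" "\<rho>m w = 0" if "R2 < cmod w" for w
  proof -
    have gw: "\<tau> + 2 * a < g w" using that R2(2)[of w] by linarith
    show "f w = c" "q w = 0" using \<phi>c[of "g w"] gw by (auto simp: f_def q_def)
    show "\<rho> w = 0" "\<rho>m w = 0" using H2(1)[of "g w"] H2(1)[of "g w - \<tau>"] gw \<tau> a by (auto simp: \<rho>_def \<rho>m_def)
  qed
  define R3 where "R3 = R2 + 1"
  define A where "A = (2 * R3 + 1)\<^sup>2"
  have R3: "0 \<le> R3" using R2 by (simp add: R3_def)
  have A: "0 < A" using R2 by (simp add: A_def R3_def)
  \<comment> \<open>Kc collects the tail of the bump and the price of smoothing the logarithm, both of order d^2\<close>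
  define Kc where "Kc = c * (2 / r^4) * (2 * R2 + 1)\<^sup>2 + 2 * C / r\<^sup>2"
  have Kc: "0 \<le> Kc" using c C r by (auto simp: Kc_def intro!: add_nonneg_nonneg mult_nonneg_nonneg)
  define d where "d = min (min 1 r) (\<beta> / (16 * (Kc + 1)))"
  have d: "0 < d" "d \<le> 1" "d \<le> r" using r \<beta> Kc by (auto simp: d_def)
  have dK: "Kc * d\<^sup>2 \<le> \<beta> / 16"
  proof -
    have "d\<^sup>2 \<le> d" using d by (simp add: power2_eq_square mult_left_le_one_le)
    then have "Kc * d\<^sup>2 \<le> (Kc + 1) * d" using Kc d by (intro mult_mono) auto
    also have "\<dots> \<le> (Kc + 1) * (\<beta> / (16 * (Kc + 1)))" using Kc by (intro mult_left_mono) (auto simp: d_def)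
    also have "\<dots> = \<beta> / 16" using Kc by (simp add: field_simps)
    finally show ?thesis .
  qed
  have Kc_split: "Kc * d\<^sup>2 = c * (2 * d\<^sup>2 / r^4) * (2 * R2 + 1)\<^sup>2 + 2 * C * (d\<^sup>2 / r\<^sup>2)"
    by (simp add: Kc_def algebra_simps)
  have "0 \<le> c * (2 * d\<^sup>2 / r^4) * (2 * R2 + 1)\<^sup>2" "0 \<le> 2 * C * (d\<^sup>2 / r\<^sup>2)" using c C by auto
  then have d1: "c * (2 * d\<^sup>2 / r^4) * (2 * R2 + 1)\<^sup>2 \<le> \<beta> / 16" and d2: "2 * C * (d\<^sup>2 / r\<^sup>2) \<le> \<beta> / 16"
    using dK unfolding Kc_split by linarith+
  define \<psi> where "\<psi> = smooth_log d"
  obtain pxx pyy where p: "second_deriv_along 1 \<psi> pxx" "second_deriv_along \<i> \<psi> pyy"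
    "continuous_on UNIV pxx" "continuous_on UNIV pyy" "\<And>z. pxx z + pyy z = bump d z"
    using smooth_log_second_derivs[of d] d unfolding \<psi>_def by (metis less_irrefl)
  have "continuous_on UNIV \<psi>"
    unfolding \<psi>_def smooth_log_alt using d
    by (intro continuous_intros) (auto simp: add_nonneg_eq_0_iff)
  then obtain B where B: "0 \<le> B" "\<And>z. cmod z \<le> R3 + R + 2 \<Longrightarrow> \<bar>\<psi> z\<bar> \<le> B"
    using continuous_bounded_on_cball by metis
  define e1 where "e1 = min (1 / A) (\<beta> / (16 * (2 * B + 1) * A))"
  have e1: "0 < e1" using A B \<beta> by (auto simp: e1_def intro!: divide_pos_pos mult_pos_pos)
  have e1A: "e1 * A \<le> 1"
  proof -
    have "e1 * A \<le> 1 / A * A" using A by (intro mult_right_mono) (auto simp: e1_def)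
    then show ?thesis using A by simp
  qed
  have e1B: "2 * B * e1 * A \<le> \<beta> / 16"
  proof -
    have cancel: "x * (\<beta> / (16 * x * A) * A) = \<beta> / 16" if "x \<noteq> 0" for x
      using A that by (simp add: field_simps)
    have "2 * B * e1 * A = (2 * B) * (e1 * A)" by simp
    also have "\<dots> \<le> (2 * B + 1) * (\<beta> / (16 * (2 * B + 1) * A) * A)"
      using A B e1 by (intro mult_mono mult_right_mono) (auto simp: e1_def)
    also have "\<dots> = \<beta> / 16" using B by (intro cancel) auto
    finally show ?thesis .
  qed
  define e2 where "e2 = \<beta> / (32 * c * A)"
  have e2: "0 < e2" "2 * c * e2 * A = \<beta> / 16" using A c \<beta> by (auto simp: e2_def)
  obtain h1 where h1: "0 < h1" "\<And>h z. 0 < h \<Longrightarrow> h < h1 \<Longrightarrow> cmod z \<le> R3 \<Longrightarrow>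
    \<bar>five_point h f z - h\<^sup>2 * (fxx z + fyy z)\<bar> \<le> e1 * h\<^sup>2"
    using five_point_approx[OF f(1-4) e1, of R3] unfolding f_def by blast
  obtain h2 where h2: "0 < h2" "\<And>h z. 0 < h \<Longrightarrow> h < h2 \<Longrightarrow> cmod z \<le> R3 + R + 2 \<Longrightarrow>
    \<bar>five_point h \<psi> z - h\<^sup>2 * (pxx z + pyy z)\<bar> \<le> e2 * h\<^sup>2"
    using five_point_approx[OF p(1-4) e2(1), of "R3 + R + 2"] by blast
  define h where "h = Min {h1 / 2, h2 / 2, d / 8, r / 4, \<beta> * r / (64 * (C + 1))}"
  have h: "0 < h" using h1 h2 d r \<beta> C by (simp add: h_def)
  have hle: "h \<le> h1 / 2" "h \<le> h2 / 2" "h \<le> d / 8" "h \<le> r / 4" "h \<le> \<beta> * r / (64 * (C + 1))"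
    unfolding h_def by (rule Min_le; simp)+
  have hlt: "h < h1" "h < h2" "h \<le> 1" using hle h1 h2 r by linarith+
  have hC: "4 * C * h / r \<le> \<beta> / 16"
  proof -
    have cancel: "4 * x * (\<beta> * r / (64 * x)) / r = \<beta> / 16" if "x \<noteq> 0" for x
      using r that by (simp add: field_simps)
    have "4 * C * h / r \<le> 4 * (C + 1) * (\<beta> * r / (64 * (C + 1))) / r"
      using hle(5) C r h by (intro divide_right_mono mult_mono) auto
    also have "\<dots> = \<beta> / 16" using C by (intro cancel) auto
    finally show ?thesis .
  qed
  define N where "N = nat \<lceil>(R3 + R + 4) / h\<rceil>"
  have "(R3 + R + 4) / h \<le> N" unfolding N_def by linarith
  then have hN: "R3 + R + 4 \<le> h * N" using h by (simp add: field_simps)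
  let ?b = "grid_box N" and ?P = "grid_point h"
  have mass: "h\<^sup>2 * (\<Sum>p\<in>?b. \<rho> (?P p)) \<le> C"
    unfolding C_def
  proof (rule grid_sum_le[OF h hlt(3)])
    fix p assume "R0 < cmod (?P p)"
    then have "s < g (?P p)" using R0(2)[of "?P p"] by linarith
    then show "\<rho> (?P p) \<le> 0" using \<rho>_supp[of "?P p"] a by force
  qed (use M R0 in \<open>auto intro: order_trans[OF abs_ge_self]\<close>)
  \<comment> \<open>the relative error of the five-point Laplacian of f at a grid point\<close>
  define \<epsilon> where "\<epsilon> p = five_point h f (?P p) / h\<^sup>2 - (\<rho> (?P p) - \<rho>m (?P p))" for p
  have FP: "five_point h f (?P p) = h\<^sup>2 * (\<rho> (?P p) - \<rho>m (?P p) + \<epsilon> p)" for p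
    using h by (simp add: \<epsilon>_def)
  have \<epsilon>: "\<bar>\<epsilon> p\<bar> \<le> e1" if "cmod (?P p) \<le> R3" for p
  proof -
    have "\<bar>h\<^sup>2 * \<epsilon> p\<bar> \<le> e1 * h\<^sup>2" using h1(2)[OF h hlt(1) that] unfolding lapf FP by (simp add: algebra_simps)
    then show ?thesis using h by (simp add: abs_mult mult.commute)
  qed
  have \<epsilon>0: "\<epsilon> p = 0" if "R3 < cmod (?P p)" for p
  proof -
    have *: "f (?P p + x) = c" if "cmod x \<le> 1" for x
      using norm_diff_ineq[of "?P p" x] that \<open>R3 < cmod (?P p)\<close> by (intro far(1)) (simp add: R3_def)
    have hh: "cmod (of_real h) \<le> 1" "cmod (of_real h * \<i>) \<le> 1" using h hlt by (auto simp: norm_mult)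
    have "five_point h f (?P p) = 0"
      using *[of "of_real h"] *[of "- of_real h"] *[of "of_real h * \<i>"] *[of "- (of_real h * \<i>)"] *[of 0] hh
      unfolding five_point_def by simp
    moreover have "R2 < cmod (?P p)" using that by (simp add: R3_def)
    ultimately show ?thesis using far(3,4)[of "?P p"] by (simp add: \<epsilon>_def)
  qed
  have five_q: "five_point h q w = - five_point h f w" for w by (simp add: five_point_def q_def)
  have qbd: "q (?P p) = 0" if "int N \<le> \<bar>fst p\<bar> \<or> int N \<le> \<bar>snd p\<bar>" for p
    using cmod_grid_point_ge[OF h that] hN R R3 by (intro far(2)) (simp add: R3_def)
  \<comment> \<open>summation by parts against the constant 1 shows that \<rho> and \<rho>m have nearly the same mass\<close>
  have "(\<Sum>p\<in>?b. 1 * five_point h q (?P p)) = (\<Sum>p\<in>?b. q (?P p) * five_point h (\<lambda>_. 1) (?P p))"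
    by (rule sum_by_parts_grid[where u = "\<lambda>_. 1"]) (rule qbd)
  also have "\<dots> = 0" by (simp add: five_point_def)
  finally have "h\<^sup>2 * (\<Sum>p\<in>?b. \<rho> (?P p) - \<rho>m (?P p) + \<epsilon> p) = 0"
    unfolding five_q FP by (simp add: sum_distrib_left sum_negf)
  then have "h\<^sup>2 * (\<Sum>p\<in>?b. \<rho>m (?P p)) = h\<^sup>2 * (\<Sum>p\<in>?b. \<rho> (?P p)) + h\<^sup>2 * (\<Sum>p\<in>?b. \<epsilon> p)"
    by (simp add: sum.distrib sum_subtractf algebra_simps)
  moreover have "h\<^sup>2 * (\<Sum>p\<in>?b. \<epsilon> p) \<le> e1 * A"
    unfolding A_def
  proof (rule grid_sum_le[OF h hlt(3)])
    show "\<epsilon> p \<le> e1" if "cmod (?P p) \<le> R3" for p using \<epsilon>[OF that] by simp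
  qed (use e1 R3 \<epsilon>0 in auto)
  ultimately have massm: "h\<^sup>2 * (\<Sum>p\<in>?b. \<rho>m (?P p)) \<le> C + 1" using mass e1A by linarith
  have grid_case: "\<beta> / 4 \<le> h\<^sup>2 * (\<Sum>p\<in>?b. \<rho> (?P p) * (\<psi> (?P p - ?P pl) - \<psi> (?P p - ?P pk)))"
    if l: "cmod (?P pl) \<le> R + 1" "7/8 * s \<le> g (?P pl)" and k: "cmod (?P pk) \<le> R + 1" "g (?P pk) \<le> s / 8" for pl pk
  proof -
    define l where "l = ?P pl"
    define k where "k = ?P pk"
    define \<Psi> where "\<Psi> w = \<psi> (w - l) - \<psi> (w - k)" for w
    define S where "S = h\<^sup>2 * (\<Sum>p\<in>{p\<in>?b. cmod (?P p) < r}. bump d (?P p))"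
    have S: "1/2 \<le> S"
      unfolding S_def by (rule bump_grid_mass[OF h hle(3) d(3)]) (use hN R R3 r in linarith)
    define \<epsilon>l where "\<epsilon>l p = five_point h \<psi> (?P p - l) / h\<^sup>2 - bump d (?P p - l)" for p
    define \<epsilon>k where "\<epsilon>k p = five_point h \<psi> (?P p - k) / h\<^sup>2 - bump d (?P p - k)" for p
    have FPl: "five_point h \<psi> (?P p - l) = h\<^sup>2 * (bump d (?P p - l) + \<epsilon>l p)"
      and FPk: "five_point h \<psi> (?P p - k) = h\<^sup>2 * (bump d (?P p - k) + \<epsilon>k p)" for p
      using h by (auto simp: \<epsilon>l_def \<epsilon>k_def)
    have \<epsilon>lk: "\<bar>\<epsilon>l p\<bar> \<le> e2" "\<bar>\<epsilon>k p\<bar> \<le> e2" if "cmod (?P p) \<le> R2" for p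
    proof -
      have "cmod (?P p - l) \<le> R3 + R + 2" "cmod (?P p - k) \<le> R3 + R + 2"
        using that l k norm_triangle_ineq4[of "?P p" l] norm_triangle_ineq4[of "?P p" k] by (auto simp: l_def k_def R3_def)
      then have "\<bar>h\<^sup>2 * \<epsilon>l p\<bar> \<le> e2 * h\<^sup>2" "\<bar>h\<^sup>2 * \<epsilon>k p\<bar> \<le> e2 * h\<^sup>2"
        using h2(2)[OF h hlt(2), of "?P p - l"] h2(2)[OF h hlt(2), of "?P p - k"] unfolding p(5) FPl FPk
        by (simp_all add: algebra_simps)
      then show "\<bar>\<epsilon>l p\<bar> \<le> e2" "\<bar>\<epsilon>k p\<bar> \<le> e2" using h by (simp_all add: abs_mult mult.commute)
    qed
    have "(\<Sum>p\<in>?b. \<Psi> (?P p) * five_point h q (?P p)) = (\<Sum>p\<in>?b. q (?P p) * five_point h \<Psi> (?P p))"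
      by (rule sum_by_parts_grid) (rule qbd)
    then have "- (h\<^sup>2 * (\<Sum>p\<in>?b. \<Psi> (?P p) * (\<rho> (?P p) - \<rho>m (?P p) + \<epsilon> p))) =
      h\<^sup>2 * (\<Sum>p\<in>?b. q (?P p) * (bump d (?P p - l) + \<epsilon>l p - (bump d (?P p - k) + \<epsilon>k p)))"
      unfolding five_q FP \<Psi>_def five_point_diff_translates FPl FPk
      by (simp add: sum_distrib_left sum_negf right_diff_distrib mult.left_commute)
    then have main: "h\<^sup>2 * (\<Sum>p\<in>?b. \<rho> (?P p) * \<Psi> (?P p)) =
        h\<^sup>2 * (\<Sum>p\<in>?b. \<Psi> (?P p) * \<rho>m (?P p)) - h\<^sup>2 * (\<Sum>p\<in>?b. \<Psi> (?P p) * \<epsilon> p)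
      + h\<^sup>2 * (\<Sum>p\<in>?b. q (?P p) * bump d (?P p - k)) - h\<^sup>2 * (\<Sum>p\<in>?b. q (?P p) * bump d (?P p - l))
      - h\<^sup>2 * (\<Sum>p\<in>?b. q (?P p) * (\<epsilon>l p - \<epsilon>k p))"
      by (simp add: sum.distrib sum_subtractf algebra_simps)
    have b1: "- \<eta> * (C + 1) \<le> h\<^sup>2 * (\<Sum>p\<in>?b. \<Psi> (?P p) * \<rho>m (?P p))"
    proof -
      have "- \<eta> * \<rho>m w \<le> \<Psi> w * \<rho>m w" for w
      proof (cases "\<rho>m w = 0")
        case False
        then have "X < cmod w" by (rule \<rho>m_supp)
        then have "m \<le> cmod (w - l)" "m \<le> cmod (w - k)"
          using l k norm_triangle_ineq2[of w l] norm_triangle_ineq2[of w k] by (auto simp: X_def l_def k_def)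
        then have "\<bar>\<Psi> w\<bar> \<le> cmod ((w - l) - (w - k)) / m"
          unfolding \<Psi>_def \<psi>_def by (intro smooth_log_lipschitz m(1))
        also have "\<dots> \<le> 2 * (R + 1) / m"
          using l k m(1) norm_triangle_ineq4[of k l] by (intro divide_right_mono) (auto simp: l_def k_def)
        finally have "\<bar>\<Psi> w\<bar> \<le> \<eta>" unfolding m(2) .
        then show ?thesis using \<rho>m_nonneg[of w] by (intro mult_right_mono) auto
      qed simp
      then have "(\<Sum>p\<in>?b. - \<eta> * \<rho>m (?P p)) \<le> (\<Sum>p\<in>?b. \<Psi> (?P p) * \<rho>m (?P p))" by (intro sum_mono)
      then have "h\<^sup>2 * (\<Sum>p\<in>?b. - \<eta> * \<rho>m (?P p)) \<le> h\<^sup>2 * (\<Sum>p\<in>?b. \<Psi> (?P p) * \<rho>m (?P p))" by (intro mult_left_mono) auto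
      moreover have "h\<^sup>2 * (\<Sum>p\<in>?b. - \<eta> * \<rho>m (?P p)) = - (\<eta> * (h\<^sup>2 * (\<Sum>p\<in>?b. \<rho>m (?P p))))"
        by (simp add: sum_distrib_left sum_negf algebra_simps)
      moreover have "\<eta> * (h\<^sup>2 * (\<Sum>p\<in>?b. \<rho>m (?P p))) \<le> \<eta> * (C + 1)" using massm \<eta> by (intro mult_left_mono) auto
      ultimately show ?thesis by linarith
    qed
    have b2: "h\<^sup>2 * (\<Sum>p\<in>?b. \<Psi> (?P p) * \<epsilon> p) \<le> 2 * B * e1 * A"
      unfolding A_def
    proof (rule grid_sum_le[OF h hlt(3)])
      fix p assume *: "cmod (?P p) \<le> R3"
      have "cmod (?P p - l) \<le> R3 + R + 2" "cmod (?P p - k) \<le> R3 + R + 2"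
        using * l k norm_triangle_ineq4[of "?P p" l] norm_triangle_ineq4[of "?P p" k] by (auto simp: l_def k_def)
      then have "\<bar>\<psi> (?P p - l)\<bar> \<le> B" "\<bar>\<psi> (?P p - k)\<bar> \<le> B" by (auto intro: B)
      then have "\<bar>\<Psi> (?P p)\<bar> \<le> 2 * B" by (simp add: \<Psi>_def)
      then have "\<bar>\<Psi> (?P p) * \<epsilon> p\<bar> \<le> 2 * B * e1"
        unfolding abs_mult using \<epsilon>[OF *] B by (intro mult_mono) auto
      then show "\<Psi> (?P p) * \<epsilon> p \<le> 2 * B * e1" by linarith
    qed (use e1 B R3 \<epsilon>0 in auto)
    have rN: "r + cmod (?P pl) \<le> h * N" "r + cmod (?P pk) \<le> h * N" using l k r hN R3 by linarith+
    have b3: "c * S \<le> h\<^sup>2 * (\<Sum>p\<in>?b. q (?P p) * bump d (?P p - k))"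
      unfolding k_def S_def
    proof (rule bump_convolution_lower[OF h rN(2) q(1)])
      fix w assume w: "cmod (w - ?P pk) < r"
      have "cmod w \<le> R + 2" using w k(1) r norm_triangle_ineq2[of w "?P pk"] by linarith
      then have "\<bar>g w - g (?P pk)\<bar> < a / 2" using w k(1) by (intro osc) auto
      then have "g w \<le> a" using k(2) a by linarith
      then show "q w = c" using \<phi>0(1) by (simp add: q_def f_def)
    qed
    have b4: "h\<^sup>2 * (\<Sum>p\<in>?b. q (?P p) * bump d (?P p - l)) \<le> (c - \<beta>) * S + c * (2 * d\<^sup>2 / r^4) * (2 * R2 + 1)\<^sup>2"
      unfolding l_def S_def
    proof (rule bump_convolution_upper[OF h hlt(3) r(1) R2(1) rN(1) q far(2)])
      fix w assume w: "cmod (w - ?P pl) < r"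
      have "cmod w \<le> R + 2" using w l(1) r norm_triangle_ineq2[of w "?P pl"] by linarith
      then have "\<bar>g w - g (?P pl)\<bar> < a / 2" using w l(1) by (intro osc) auto
      then have "3 * a \<le> g w" using l(2) a by linarith
      then show "q w \<le> c - \<beta>" using \<phi>3 by (simp add: q_def f_def)
    qed
    have b5: "h\<^sup>2 * (\<Sum>p\<in>?b. q (?P p) * (\<epsilon>l p - \<epsilon>k p)) \<le> 2 * c * e2 * A"
      unfolding A_def
    proof (rule grid_sum_le[OF h hlt(3)])
      fix p
      show "q (?P p) * (\<epsilon>l p - \<epsilon>k p) \<le> 2 * c * e2"
      proof (cases "cmod (?P p) \<le> R2")
        case True
        have "\<bar>\<epsilon>l p - \<epsilon>k p\<bar> \<le> 2 * e2" using \<epsilon>lk[OF True] by linarith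
        moreover have "\<bar>q (?P p)\<bar> \<le> c" using q by (simp add: abs_of_nonneg)
        ultimately have "\<bar>q (?P p) * (\<epsilon>l p - \<epsilon>k p)\<bar> \<le> c * (2 * e2)"
          unfolding abs_mult using c by (intro mult_mono) auto
        then show ?thesis by linarith
      next
        case False
        then show ?thesis using far(2)[of "?P p"] c e2 by simp
      qed
      assume "R3 < cmod (?P p)"
      then show "q (?P p) * (\<epsilon>l p - \<epsilon>k p) \<le> 0" using far(2)[of "?P p"] by (simp add: R3_def)
    qed (use c e2 R3 in auto)
    have "\<beta> / 2 \<le> \<beta> * S" using S \<beta> by simp
    moreover have "(c - \<beta>) * S = c * S - \<beta> * S" by (simp add: left_diff_distrib)
    moreover have "- \<eta> * (C + 1) = - (\<beta> / 16)" using \<eta>(2) by simp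
    ultimately have "\<beta> / 4 \<le> h\<^sup>2 * (\<Sum>p\<in>?b. \<rho> (?P p) * \<Psi> (?P p))"
      unfolding main using b1 b2 b3 b4 b5 d1 e1B e2(2) by linarith
    then show ?thesis by (simp add: \<Psi>_def l_def k_def)
  qed
  define I where "I = {p\<in>?b. \<rho> (?P p) \<noteq> 0}"
  show ?thesis
  proof (rule that[of I "\<beta> / 8" "\<lambda>p. h\<^sup>2 * \<rho> (?P p)" ?P])
    show "finite I" by (simp add: I_def)
    show "0 < \<beta> / 8" using \<beta> by simp
    show "0 \<le> h\<^sup>2 * \<rho> (?P p)" for p using \<rho>_nonneg by simp
    show "0 < g (?P p)" "g (?P p) < s / 2" if "p \<in> I" for p
      using that \<rho>_supp[of "?P p"] a by (auto simp: I_def)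
    fix l k assume l: "cmod l \<le> R1" "s \<le> g l" and k: "g k = 0"
    have lR: "cmod l \<le> R" using l R by simp
    have kR: "cmod k \<le> R" using R0(2)[of k] k \<open>0 < s\<close> R by simp
    obtain pl where pl: "cmod (l - ?P pl) \<le> 2 * h" using near_grid_point[OF h] .
    obtain pk where pk: "cmod (k - ?P pk) \<le> 2 * h" using near_grid_point[OF h] .
    have h2r: "2 * h < r" "2 * h \<le> 1" using hle(4) r by linarith+
    have lR': "cmod (?P pl) \<le> R + 1" and kR': "cmod (?P pk) \<le> R + 1"
      using pl pk lR kR h2r norm_triangle_ineq2[of "?P pl" l] norm_triangle_ineq2[of "?P pk" k]
      by (auto simp: norm_minus_commute)
    have "\<bar>g l - g (?P pl)\<bar> < a / 2" using pl lR lR' h2r by (intro osc) auto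
    then have gl: "7/8 * s \<le> g (?P pl)" using l(2) a by linarith
    have "\<bar>g k - g (?P pk)\<bar> < a / 2" using pk kR kR' h2r by (intro osc) auto
    then have gk: "g (?P pk) \<le> s / 8" using k a by linarith
    have away: "r \<le> cmod (w - x)" if "\<rho> w \<noteq> 0" "cmod x \<le> R + 1" "7/8 * s \<le> g x \<or> g x \<le> s / 8" for w x
    proof (rule ccontr)
      assume *: "\<not> r \<le> cmod (w - x)"
      then have "cmod w \<le> R + 2" using that(2) r norm_triangle_ineq2[of w x] by linarith
      then have "\<bar>g w - g x\<bar> < a / 2" using * that(2) by (intro osc) auto
      then show False using \<rho>_supp[OF that(1)] that(3) a by linarith
    qed
    \<comment> \<open>both replacements, of z by a grid point and of the logarithm by its smoothed version, are controlled by the distance r\<close>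
    have compare: "\<bar>ln (cmod (z - w)) - \<psi> (w - z')\<bar> \<le> 2 * h / r + d\<^sup>2 / r\<^sup>2"
      if "\<rho> w \<noteq> 0" "cmod z \<le> R + 1" "7/8 * s \<le> g z \<or> g z \<le> s / 8" "cmod z' \<le> R + 1" "7/8 * s \<le> g z' \<or> g z' \<le> s / 8"
        "cmod (z - z') \<le> 2 * h" for w z z'
    proof -
      have "\<bar>\<psi> (w - z) - \<psi> (w - z')\<bar> \<le> cmod ((w - z) - (w - z')) / r"
        unfolding \<psi>_def using that by (intro smooth_log_lipschitz r away) auto
      also have "\<dots> \<le> 2 * h / r" using that(6) r by (intro divide_right_mono) (auto simp: norm_minus_commute)
      finally have "\<bar>\<psi> (w - z) - \<psi> (w - z')\<bar> \<le> 2 * h / r" .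
      moreover have "\<bar>\<psi> (w - z) - ln (cmod (w - z))\<bar> \<le> d\<^sup>2 / r\<^sup>2"
        unfolding \<psi>_def using that by (intro smooth_log_close r away) auto
      ultimately show ?thesis by (simp add: norm_minus_commute)
    qed
    define e where "e = 2 * h / r + d\<^sup>2 / r\<^sup>2"
    define D where "D = 2 * e"
    have "\<rho> w * (\<psi> (w - ?P pl) - \<psi> (w - ?P pk)) - \<rho> w * D \<le> \<rho> w * (ln (cmod (l - w)) - ln (cmod (k - w)))" for w
    proof (cases "\<rho> w = 0")
      case False
      have "\<bar>ln (cmod (l - w)) - \<psi> (w - ?P pl)\<bar> \<le> e"
        unfolding e_def using False l lR lR' gl pl \<open>0 < s\<close> by (intro compare) auto
      moreover have "\<bar>ln (cmod (k - w)) - \<psi> (w - ?P pk)\<bar> \<le> e"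
        unfolding e_def using False k kR kR' gk pk \<open>0 < s\<close> by (intro compare) auto
      ultimately have "\<psi> (w - ?P pl) - \<psi> (w - ?P pk) - D \<le> ln (cmod (l - w)) - ln (cmod (k - w))"
        unfolding D_def by linarith
      then have "\<rho> w * (\<psi> (w - ?P pl) - \<psi> (w - ?P pk) - D) \<le> \<rho> w * (ln (cmod (l - w)) - ln (cmod (k - w)))"
        using \<rho>_nonneg by (intro mult_left_mono) auto
      then show ?thesis by (simp add: right_diff_distrib)
    qed simp
    then have "(\<Sum>p\<in>?b. \<rho> (?P p) * (\<psi> (?P p - ?P pl) - \<psi> (?P p - ?P pk)) - \<rho> (?P p) * D)
       \<le> (\<Sum>p\<in>?b. \<rho> (?P p) * (ln (cmod (l - ?P p)) - ln (cmod (k - ?P p))))"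
      by (intro sum_mono)
    then have "h\<^sup>2 * (\<Sum>p\<in>?b. \<rho> (?P p) * (\<psi> (?P p - ?P pl) - \<psi> (?P p - ?P pk)) - \<rho> (?P p) * D)
       \<le> h\<^sup>2 * (\<Sum>p\<in>?b. \<rho> (?P p) * (ln (cmod (l - ?P p)) - ln (cmod (k - ?P p))))"
      by (intro mult_left_mono) auto
    moreover have "h\<^sup>2 * (\<Sum>p\<in>?b. \<rho> (?P p) * (\<psi> (?P p - ?P pl) - \<psi> (?P p - ?P pk)) - \<rho> (?P p) * D) =
       h\<^sup>2 * (\<Sum>p\<in>?b. \<rho> (?P p) * (\<psi> (?P p - ?P pl) - \<psi> (?P p - ?P pk))) - h\<^sup>2 * (\<Sum>p\<in>?b. \<rho> (?P p)) * D"
      by (simp add: sum_subtractf sum_distrib_right right_diff_distrib)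
    moreover have "h\<^sup>2 * (\<Sum>p\<in>?b. \<rho> (?P p)) * D \<le> C * D"
      using mass h r by (intro mult_right_mono) (auto simp: D_def e_def)
    moreover have "C * D = 4 * C * h / r + 2 * C * (d\<^sup>2 / r\<^sup>2)" by (simp add: D_def e_def algebra_simps)
    moreover note grid_case[OF lR' gl kR' gk] hC d2
    ultimately have "\<beta> / 8 \<le> h\<^sup>2 * (\<Sum>p\<in>?b. \<rho> (?P p) * (ln (cmod (l - ?P p)) - ln (cmod (k - ?P p))))"
      by linarith
    also have "(\<Sum>p\<in>?b. \<rho> (?P p) * (ln (cmod (l - ?P p)) - ln (cmod (k - ?P p)))) =
      (\<Sum>p\<in>I. \<rho> (?P p) * (ln (cmod (l - ?P p)) - ln (cmod (k - ?P p))))"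
      by (intro sum.mono_neutral_right) (auto simp: I_def)
    finally show "\<beta> / 8 \<le> (\<Sum>p\<in>I. h\<^sup>2 * \<rho> (?P p) * (ln (cmod (l - ?P p)) - ln (cmod (k - ?P p))))"
      by (simp add: sum_distrib_left mult.assoc)
  qed
qed

section \<open>From the potential to a lemniscate and a Julia set\<close>

text \<open>
  Rounding \<open>N c\<^sub>i\<close> down to an integer \<open>n\<^sub>i\<close> costs a bounded amount in \<open>\<Sum> n\<^sub>i ln \<bar>z - w\<^sub>i\<bar>\<close>, whereas
  the gap grows with \<open>N\<close>. The potential estimate covers a disc of radius \<open>R1\<close>; outside it every factor
  \<open>\<bar>l - w\<^sub>i\<bar>\<close> is at least twice the factor \<open>\<bar>k - w\<^sub>i\<bar>\<close>. The constants \<open>1/2\<close> and \<open>1\<close> are a matter of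
  scaling.
\<close>
lemma lemniscate:
  assumes G: "is_green_function E g" and "0 < s"
  obtains p :: "complex poly" where "0 < degree p"
    "\<And>k. g k = 0 \<Longrightarrow> cmod (poly p k) \<le> 1/2" "\<And>l. s \<le> g l \<Longrightarrow> 1 \<le> cmod (poly p l)"
proof -
  have contg: "continuous_on UNIV g" by (rule green_continuous[OF G])
  obtain R0 where R0: "0 \<le> R0" "\<And>z. g z \<le> s \<Longrightarrow> cmod z \<le> R0" using sublevel_radius[OF G] by metis
  \<comment> \<open>all zeros and the hull lie in the disc of radius R0; outside radius R1 every zero is at least 4 R0 away\<close>
  define R1 where "R1 = 5 * R0 + 2"
  obtain I :: "(int \<times> int) set" and pt :: "int \<times> int \<Rightarrow> complex" and wt \<beta>
    where "finite I" and \<beta>: "0 < \<beta>" and wt: "\<And>i. i \<in> I \<Longrightarrow> 0 \<le> wt i"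
    and pt: "\<And>i. i \<in> I \<Longrightarrow> 0 < g (pt i)" "\<And>i. i \<in> I \<Longrightarrow> g (pt i) < s / 2"
    and gap: "\<And>l k. cmod l \<le> R1 \<Longrightarrow> s \<le> g l \<Longrightarrow> g k = 0 \<Longrightarrow>
       \<beta> \<le> (\<Sum>i\<in>I. wt i * (ln (cmod (l - pt i)) - ln (cmod (k - pt i))))"
    by (rule discrete_potential[OF G \<open>0 < s\<close>, of R1], rule that)
  define L where "L = {z. s \<le> g z} \<inter> cball 0 R1"
  define K where "K = {z. g z = 0}"
  have "closed {z. s \<le> g z}" by (intro closed_Collect_le continuous_intros contg)
  then have "compact L" unfolding L_def by (intro closed_Int_compact) auto
  have "K = {z. g z \<le> 0}" using green_nonneg[OF G] by (auto simp: K_def intro: antisym)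
  then have "compact K" using compact_sublevel[OF contg green_at_top[OF G]] by simp
  have "K \<noteq> {}"
    using green_polynomial_hull_nonempty[OF G] by (auto simp: K_def green_zero_iff[OF G])
  then obtain k1 where k1: "k1 \<in> K" by blast
  have R01: "R0 < R1" "0 \<le> R1" using R0(1) by (simp_all add: R1_def)
  have "\<not> g (of_real R1) \<le> s"
  proof
    assume "g (of_real R1) \<le> s"
    from R0(2)[OF this] show False using R01 by (simp only: norm_of_real)
  qed
  then have l1: "of_real R1 \<in> L" using R01 by (simp add: L_def)
  have ptR: "cmod (pt i) \<le> R0" if "i \<in> I" for i using pt(2)[OF that] \<open>0 < s\<close> by (intro R0(2)) simp
  have KR: "cmod k \<le> R0" if "k \<in> K" for k using that \<open>0 < s\<close> by (intro R0(2)) (simp add: K_def)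
  have ne: "z \<noteq> pt i" if "z \<in> L \<union> K" "i \<in> I" for z i
    using pt[OF that(2)] that(1) \<open>0 < s\<close> by (auto simp: L_def K_def)
  have "bounded (\<Union>i\<in>I. (\<lambda>z. ln (cmod (z - pt i))) ` (L \<union> K))"
    using \<open>finite I\<close> \<open>compact L\<close> \<open>compact K\<close> ne
    by (intro bounded_UN ballI compact_imp_bounded compact_continuous_image continuous_intros) auto
  then obtain B where "0 < B" and B': "\<forall>y\<in>(\<Union>i\<in>I. (\<lambda>z. ln (cmod (z - pt i))) ` (L \<union> K)). norm y \<le> B"
    unfolding bounded_pos by blast
  have B: "\<bar>ln (cmod (z - pt i))\<bar> \<le> B" if "i \<in> I" "z \<in> L \<union> K" for i z
    using B' that by (force simp del: Un_iff)
  define N where "N = nat \<lceil>(2 * B * card I + ln 2) / \<beta>\<rceil>"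
  have "(2 * B * card I + ln 2) / \<beta> \<le> N" unfolding N_def by linarith
  then have N: "2 * B * card I + ln 2 \<le> N * \<beta>" using \<beta> by (simp add: field_simps)
  define n where "n i = nat \<lfloor>N * wt i\<rfloor>" for i
  have n: "0 \<le> N * wt i - n i" "N * wt i - n i \<le> 1" if "i \<in> I" for i
  proof -
    have "0 \<le> real N * wt i" using wt[OF that] by simp
    then have "real (n i) = of_int \<lfloor>N * wt i\<rfloor>" by (simp add: n_def)
    then show "0 \<le> N * wt i - n i" "N * wt i - n i \<le> 1" by linarith+
  qed
  define p0 where "p0 = (\<Prod>i\<in>I. [:- pt i, 1:] ^ n i)"
  have p0: "cmod (poly p0 z) = (\<Prod>i\<in>I. cmod (z - pt i) ^ n i)" for z
    by (simp add: p0_def poly_prod poly_power prod_norm[symmetric] norm_power)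
  have p0_pos: "0 < cmod (poly p0 z)" if "z \<in> L \<union> K" for z
    unfolding p0 using ne[OF that] by (intro prod_pos) auto
  have ln_p0: "ln (cmod (poly p0 z)) = (\<Sum>i\<in>I. n i * ln (cmod (z - pt i)))" if "z \<in> L \<union> K" for z
    unfolding p0 using ne[OF that] \<open>finite I\<close> by (subst ln_prod) (auto simp: ln_realpow)
  have gap2: "ln 2 \<le> ln (cmod (poly p0 l)) - ln (cmod (poly p0 k))" if "l \<in> L" "k \<in> K" for l k
  proof -
    define x where "x i = ln (cmod (l - pt i)) - ln (cmod (k - pt i))" for i
    have "(\<Sum>i\<in>I. (N * wt i - n i) * x i) \<le> (\<Sum>i\<in>I. 2 * B)"
    proof (rule sum_mono)
      fix i assume "i \<in> I"
      have "\<bar>x i\<bar> \<le> 2 * B" using B[OF \<open>i \<in> I\<close>, of l] B[OF \<open>i \<in> I\<close>, of k] that by (auto simp: x_def)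
      then have "\<bar>(N * wt i - n i) * x i\<bar> \<le> 1 * (2 * B)"
        unfolding abs_mult using n[OF \<open>i \<in> I\<close>] by (intro mult_mono) auto
      then show "(N * wt i - n i) * x i \<le> 2 * B" by linarith
    qed
    also have "(\<Sum>i\<in>I. (N * wt i - n i) * x i) = N * (\<Sum>i\<in>I. wt i * x i) - (\<Sum>i\<in>I. n i * x i)"
      by (simp add: left_diff_distrib sum_subtractf sum_distrib_left mult.assoc)
    finally have "N * (\<Sum>i\<in>I. wt i * x i) - 2 * B * card I \<le> (\<Sum>i\<in>I. n i * x i)" by (simp add: mult.commute)
    moreover have "N * \<beta> \<le> N * (\<Sum>i\<in>I. wt i * x i)"
      using gap[of l k] that by (intro mult_left_mono) (auto simp: L_def K_def x_def)
    moreover have "(\<Sum>i\<in>I. n i * x i) = ln (cmod (poly p0 l)) - ln (cmod (poly p0 k))"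
      using that by (simp add: ln_p0 x_def right_diff_distrib sum_subtractf)
    ultimately show ?thesis using N by linarith
  qed
  have gap3: "2 * cmod (poly p0 k) \<le> cmod (poly p0 l)" if "l \<in> L" "k \<in> K" for l k
  proof -
    have pos: "0 < cmod (poly p0 k)" "0 < cmod (poly p0 l)" using p0_pos that by blast+
    have "ln (2 * cmod (poly p0 k)) \<le> ln (cmod (poly p0 l))" using gap2[OF that] pos by (simp add: ln_mult)
    then show ?thesis using pos by simp
  qed
  have "\<exists>i\<in>I. 0 < n i"
  proof (rule ccontr)
    assume "\<not> ?thesis"
    then have "poly p0 z = 1" for z by (simp add: p0_def poly_prod)
    then show False using gap3[OF l1 k1] by simp
  qed
  then obtain i0 where i0: "i0 \<in> I" "0 < n i0" by blast
  have deg: "0 < degree p0"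
  proof -
    have "degree p0 = (\<Sum>i\<in>I. degree ([:- pt i, 1:] ^ n i))"
      unfolding p0_def by (intro degree_prod_eq_sum_degree) auto
    also have "\<dots> = (\<Sum>i\<in>I. n i)" by (simp add: degree_power_eq)
    also have "\<dots> \<noteq> 0" using i0 \<open>finite I\<close> by auto
    finally show ?thesis by simp
  qed
  \<comment> \<open>beyond R1 the ratio is compared factor by factor\<close>
  have gap4: "2 * cmod (poly p0 k) \<le> cmod (poly p0 l)" if "s \<le> g l" "k \<in> K" for l k
  proof (cases "cmod l \<le> R1")
    case True
    then show ?thesis using that by (intro gap3) (auto simp: L_def)
  next
    case False
    have fac: "2 * cmod (k - pt i) \<le> cmod (l - pt i)" if "i \<in> I" for i
    proof -
      have "cmod (k - pt i) \<le> 2 * R0" using norm_triangle_ineq4[of k "pt i"] KR[OF \<open>k \<in> K\<close>] ptR[OF that] by linarith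
      moreover have "4 * R0 \<le> cmod (l - pt i)"
        using norm_triangle_ineq2[of l "pt i"] False ptR[OF that] by (simp add: R1_def)
      ultimately show ?thesis by linarith
    qed
    have "2 ^ (\<Sum>i\<in>I. n i) * cmod (poly p0 k) = (\<Prod>i\<in>I. (2 * cmod (k - pt i)) ^ n i)"
      unfolding p0 by (simp add: power_sum power_mult_distrib prod.distrib)
    also have "\<dots> \<le> cmod (poly p0 l)"
      unfolding p0 by (intro prod_mono conjI power_mono fac) auto
    finally have *: "2 ^ (\<Sum>i\<in>I. n i) * cmod (poly p0 k) \<le> cmod (poly p0 l)" .
    have "(\<Sum>i\<in>I. n i) \<noteq> 0" using i0 \<open>finite I\<close> by auto
    then have "(2::real) ^ 1 \<le> 2 ^ (\<Sum>i\<in>I. n i)" by (intro power_increasing) auto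
    then have "2 * cmod (poly p0 k) \<le> 2 ^ (\<Sum>i\<in>I. n i) * cmod (poly p0 k)" by (intro mult_right_mono) auto
    then show ?thesis using * by linarith
  qed
  have "continuous_on K (\<lambda>k. cmod (poly p0 k))" by (intro continuous_intros)
  then obtain k0 where k0: "k0 \<in> K" "\<And>k. k \<in> K \<Longrightarrow> cmod (poly p0 k) \<le> cmod (poly p0 k0)"
    using continuous_attains_sup[OF \<open>compact K\<close> \<open>K \<noteq> {}\<close>] by metis
  define m where "m = cmod (poly p0 k0)"
  have m: "0 < m" using p0_pos k0 by (simp add: m_def)
  define p where "p = smult (of_real (1 / (2 * m))) p0"
  have p: "cmod (poly p z) = cmod (poly p0 z) / (2 * m)" for z
    using m by (simp add: p_def norm_mult norm_divide)
  show ?thesis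
  proof (rule that[of p])
    show "0 < degree p" using deg m by (simp add: p_def)
    show "cmod (poly p k) \<le> 1/2" if "g k = 0" for k
      using k0(2)[of k] that m unfolding p by (simp add: K_def m_def field_simps)
    show "1 \<le> cmod (poly p l)" if "s \<le> g l" for l
      using gap4[OF that k0(1)] m unfolding p by (simp add: m_def[symmetric] field_simps)
  qed
qed

lemma poly_conv_reflect:
  fixes w :: complex
  assumes "w \<noteq> 0"
  shows "poly p w = w ^ degree p * poly (reflect_poly p) (1 / w)"
  using poly_reflect_poly_nz[of "1 / w" p] assms by (simp add: inverse_eq_divide power_one_over)

lemma poly_growth:
  fixes p :: "complex poly"
  assumes "p \<noteq> 0"
  obtains R where "1 \<le> R" "\<And>w. R \<le> cmod w \<Longrightarrow> cmod (lead_coeff p) / 2 * cmod w ^ degree p \<le> cmod (poly p w)"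
proof -
  define Q where "Q = reflect_poly p"
  have Q0: "poly Q 0 = lead_coeff p" "0 < cmod (lead_coeff p)" using assms by (auto simp: Q_def)
  have "open {z. cmod (lead_coeff p) / 2 < cmod (poly Q z)}" by (intro open_Collect_less continuous_intros)
  then have "\<forall>\<^sub>F z in nhds 0. cmod (lead_coeff p) / 2 < cmod (poly Q z)"
    using Q0 eventually_nhds_in_open[of "{z. cmod (lead_coeff p) / 2 < cmod (poly Q z)}" 0] by simp
  then obtain d where d: "0 < d" "\<And>z. cmod z < d \<Longrightarrow> cmod (lead_coeff p) / 2 < cmod (poly Q z)"
    unfolding eventually_nhds_metric by auto
  show ?thesis
  proof (rule that[of "max 1 (2 / d)"])
    fix w assume w: "max 1 (2 / d) \<le> cmod w"
    then have "w \<noteq> 0" by auto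
    have "2 / d \<le> cmod w" "0 < cmod w" using w by auto
    then have "cmod (1 / w) < d" using d(1) by (simp add: norm_divide field_simps)
    then have "cmod (lead_coeff p) / 2 \<le> cmod (poly Q (1 / w))" using d(2) by (simp add: less_imp_le)
    then show "cmod (lead_coeff p) / 2 * cmod w ^ degree p \<le> cmod (poly p w)"
      unfolding poly_conv_reflect[OF \<open>w \<noteq> 0\<close>, of p] norm_mult norm_power Q_def[symmetric]
      by (subst mult.commute) (intro mult_left_mono, auto)
  qed simp
qed

text \<open>
  The polynomial is \<open>a + C p\<^sup>k\<close>. The constant \<open>C\<close> is chosen first, so large that the distance to \<open>a\<close> at
  least doubles once it has reached \<open>C\<close>; then \<open>k\<close> makes the region \<open>\<bar>p\<bar> < 3/4\<close> contract towards \<open>a\<close>.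
\<close>
lemma filled_julia_near_lemniscate:
  fixes p :: "complex poly"
  assumes "0 < degree p" and a: "cmod (poly p a) \<le> 1/2"
  obtains P where "2 \<le> degree P" "\<And>z. cmod (poly p z) \<le> 1/2 \<Longrightarrow> z \<in> filled_julia P"
    "\<And>z. z \<in> filled_julia P \<Longrightarrow> cmod (poly p z) < 1"
proof -
  have "p \<noteq> 0" using assms by auto
  obtain R where R: "1 \<le> R" "\<And>w. R \<le> cmod w \<Longrightarrow> cmod (lead_coeff p) / 2 * cmod w ^ degree p \<le> cmod (poly p w)"
    using poly_growth[OF \<open>p \<noteq> 0\<close>] by metis
  define b where "b = cmod (lead_coeff p) / 2"
  have b: "0 < b" using \<open>p \<noteq> 0\<close> by (simp add: b_def)
  have lin: "b * cmod w \<le> cmod (poly p w)" if "R \<le> cmod w" for w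
  proof -
    have "cmod w ^ 1 \<le> cmod w ^ degree p" using that R(1) assms(1) by (intro power_increasing) auto
    then have "b * cmod w \<le> b * cmod w ^ degree p" using b by (intro mult_left_mono) auto
    then show ?thesis using R(2)[OF that] by (simp add: b_def)
  qed
  have "open {z. cmod (poly p z) < 3/4}" by (intro open_Collect_less continuous_intros)
  moreover have "a \<in> {z. cmod (poly p z) < 3/4}" using a by simp
  ultimately obtain \<delta> where \<delta>: "0 < \<delta>" "\<And>z. dist z a < \<delta> \<Longrightarrow> cmod (poly p z) < 3/4"
    unfolding open_dist by blast
  define C where "C = R + 2 * cmod a + 4 / b"
  have C: "R + cmod a \<le> C" "2 * cmod a \<le> C" "4 / b \<le> C" "1 / b + cmod a \<le> C" "0 < C"
  proof -
    have "0 < 1 / b" "4 / b = 4 * (1 / b)" using b by simp_all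
    then show "R + cmod a \<le> C" "2 * cmod a \<le> C" "4 / b \<le> C" "1 / b + cmod a \<le> C" "0 < C"
      unfolding C_def using R(1) norm_ge_zero[of a] by linarith+
  qed
  have "(\<lambda>k. C * (3/4) ^ k) \<longlonglongrightarrow> C * 0" by (intro tendsto_intros LIMSEQ_realpow_zero) auto
  then have "\<forall>\<^sub>F k in sequentially. C * (3/4) ^ k < \<delta>" using \<delta>(1) by (intro order_tendstoD(2)) auto
  then have "\<forall>\<^sub>F k in sequentially. C * (3/4) ^ k < \<delta> \<and> 2 \<le> k"
    using eventually_ge_at_top[of 2] by eventually_elim auto
  then obtain k where k: "C * (3/4) ^ k < \<delta>" "2 \<le> k" by (auto simp: eventually_sequentially)
  define P where "P = [:a:] + smult (of_real C) (p ^ k)"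
  have P: "poly P z - a = of_real C * poly p z ^ k" for z by (simp add: P_def)
  have normP: "cmod (poly P z - a) = C * cmod (poly p z) ^ k" for z
    unfolding P using C by (simp add: norm_mult norm_power)
  have "degree (smult (of_real C) (p ^ k)) = k * degree p" using C(5) \<open>p \<noteq> 0\<close> by (simp add: degree_power_eq)
  moreover have kd: "2 \<le> k * degree p" using k(2) assms(1) mult_le_mono[of 2 k 1 "degree p"] by simp
  ultimately have degP: "degree P = k * degree p" using k(2) assms(1) unfolding P_def
    by (subst degree_add_eq_right) (auto simp del: degree_smult_eq)
  show ?thesis
  proof (rule that[of P])
    show "2 \<le> degree P" using degP kd by simp
    fix z assume z: "cmod (poly p z) \<le> 1/2"
    have step: "dist (poly P w) a < \<delta>" if "cmod (poly p w) < 3/4" for w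
    proof -
      have "C * cmod (poly p w) ^ k \<le> C * (3/4) ^ k" using that C by (intro mult_left_mono power_mono) auto
      then show ?thesis using k(1) normP[of w] by (simp add: dist_norm)
    qed
    have "dist ((poly P ^^ Suc n) z) a < \<delta>" for n
    proof (induction n)
      case 0 then show ?case using step[of z] z by simp
    next
      case (Suc n) then show ?case using step \<delta>(2) by simp
    qed
    then have "(poly P ^^ n) z \<in> ball a \<delta>" if "n \<in> {1..}" for n
      using that by (cases n) (auto simp: dist_commute)
    then have "(\<lambda>n. (poly P ^^ n) z) ` {1..} \<subseteq> ball a \<delta>" by blast
    then show "z \<in> filled_julia P" unfolding filled_julia_def using bounded_subset[OF bounded_ball] by blast
  next
    fix z assume z: "z \<in> filled_julia P"
    show "cmod (poly p z) < 1"
    proof (rule ccontr)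
      assume "\<not> cmod (poly p z) < 1"
      then have z1: "1 \<le> cmod (poly p z)" by simp
      have double: "2 * cmod (w - a) \<le> cmod (poly P w - a)" if "C \<le> cmod (w - a)" for w
      proof -
        have w: "cmod (w - a) \<le> cmod w + cmod a" by (rule norm_triangle_ineq4)
        then have "R \<le> cmod w" using that C(1) by linarith
        have "cmod (w - a) \<le> 2 * cmod w" using w that C(2) by linarith
        have "1 / b \<le> cmod w" using w that C(4) by linarith
        then have "1 \<le> b * cmod w" using b by (simp add: field_simps)
        also have "\<dots> \<le> cmod (poly p w)" by (rule lin[OF \<open>R \<le> cmod w\<close>])
        finally have pw: "1 \<le> cmod (poly p w)" .
        have "4 * cmod w \<le> C * b * cmod w" using C(3) b by (intro mult_right_mono) (auto simp: field_simps)
        also have "\<dots> \<le> C * cmod (poly p w)" using lin[OF \<open>R \<le> cmod w\<close>] C(5) by simp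
        also have "\<dots> \<le> C * cmod (poly p w) ^ k" using pw k(2) C(5) power_increasing[of 1 k "cmod (poly p w)"] by simp
        finally show ?thesis using \<open>cmod (w - a) \<le> 2 * cmod w\<close> unfolding normP by linarith
      qed
      have grow: "C * 2 ^ n \<le> cmod ((poly P ^^ Suc n) z - a)" for n
      proof (induction n)
        case 0
        have "C * 1 \<le> C * cmod (poly p z) ^ k" using z1 C(5) by (intro mult_left_mono one_le_power) auto
        then show ?case using normP[of z] by simp
      next
        case (Suc n)
        have "C * 1 \<le> C * 2 ^ n" using C(5) by (intro mult_left_mono one_le_power) auto
        then have "C \<le> cmod ((poly P ^^ Suc n) z - a)" using Suc by linarith
        from double[OF this] show ?case using Suc by simp
      qed
      obtain B where B: "\<And>n. 1 \<le> n \<Longrightarrow> cmod ((poly P ^^ n) z) \<le> B"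
        using z unfolding filled_julia_def bounded_iff by auto
      obtain n where n: "(B + cmod a) / C < 2 ^ n" using real_arch_pow[of 2 "(B + cmod a) / C"] by auto
      then have "B + cmod a < C * 2 ^ n" using C(5) by (simp add: field_simps)
      also have "\<dots> \<le> cmod ((poly P ^^ Suc n) z) + cmod a"
        using grow[of n] norm_triangle_ineq4[of "(poly P ^^ Suc n) z" a] by linarith
      finally show False using B[of "Suc n"] by simp
    qed
  qed
qed

section \<open>The Green function of a filled Julia set\<close>

lemma Re_has_derivative:
  assumes "(F has_field_derivative D) (at z)"
  shows "((\<lambda>z. Re (F z)) has_derivative (\<lambda>h. Re D * Re h + (- Im D) * Im h)) (at z)"
    and "((\<lambda>z. - Im (F z)) has_derivative (\<lambda>h. (- Im D) * Re h + (- Re D) * Im h)) (at z)"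
proof -
  have F: "(F has_derivative (\<lambda>h. D * h)) (at z)" using assms by (simp add: has_field_derivative_def)
  show "((\<lambda>z. Re (F z)) has_derivative (\<lambda>h. Re D * Re h + (- Im D) * Im h)) (at z)"
    using has_derivative_Re[OF F] by simp
  show "((\<lambda>z. - Im (F z)) has_derivative (\<lambda>h. (- Im D) * Re h + (- Re D) * Im h)) (at z)"
    using has_derivative_minus[OF has_derivative_Im[OF F]] by (simp add: algebra_simps)
qed

text \<open>
  The derivatives of the local holomorphic functions are determined by \<open>u\<close>, hence they fit together to
  one holomorphic function \<open>D\<close> on \<open>S\<close>; its real and imaginary parts and those of its derivative are the
  required partial derivatives up to sign.
\<close>
lemma harmonic_on_if_locally_Re:
  assumes "open S"
    and loc: "\<And>z. z \<in> S \<Longrightarrow> \<exists>r F. 0 < r \<and> ball z r \<subseteq> S \<and> F holomorphic_on ball z r \<and> (\<forall>w\<in>ball z r. u w = Re (F w))"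
  shows "harmonic_on u S"
proof -
  obtain r F where r: "\<And>z. z \<in> S \<Longrightarrow> 0 < r z" "\<And>z. z \<in> S \<Longrightarrow> ball z (r z) \<subseteq> S"
    and F: "\<And>z. z \<in> S \<Longrightarrow> F z holomorphic_on ball z (r z)" "\<And>z w. z \<in> S \<Longrightarrow> w \<in> ball z (r z) \<Longrightarrow> u w = Re (F z w)"
    using loc by metis
  have dF: "(F z has_field_derivative deriv (F z) w) (at w)" if "z \<in> S" "w \<in> ball z (r z)" for z w
    by (rule holomorphic_derivI[OF F(1)[OF that(1)] open_ball that(2)])
  have du: "(u has_derivative (\<lambda>h. Re (deriv (F z) w) * Re h + (- Im (deriv (F z) w)) * Im h)) (at w)"
    if "z \<in> S" "w \<in> ball z (r z)" for z w
    by (rule has_derivative_transform_within_open[OF Re_has_derivative(1)[OF dF[OF that]] open_ball that(2)])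
      (use F(2)[OF that(1)] in auto)
  define D where "D z = deriv (F z) z" for z
  have D_eq: "D w = deriv (F z) w" if "z \<in> S" "w \<in> ball z (r z)" for z w
  proof -
    have "w \<in> S" using that r by blast
    then have "w \<in> ball w (r w)" using r by simp
    from has_derivative_unique[OF du[OF \<open>w \<in> S\<close> this] du[OF that]]
    have *: "Re (D w) * Re h + (- Im (D w)) * Im h = Re (deriv (F z) w) * Re h + (- Im (deriv (F z) w)) * Im h" for h
      by (metis D_def)
    show ?thesis using *[of 1] *[of \<i>] by (simp add: complex_eq_iff)
  qed
  have holD: "D holomorphic_on S"
  proof (rule holomorphic_onI)
    fix z assume "z \<in> S"
    have zb: "z \<in> ball z (r z)" using r \<open>z \<in> S\<close> by simp
    have "deriv (F z) holomorphic_on ball z (r z)" by (rule holomorphic_deriv[OF F(1)[OF \<open>z \<in> S\<close>] open_ball])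
    then have "D holomorphic_on ball z (r z)"
      by (rule holomorphic_transform) (simp add: D_eq[OF \<open>z \<in> S\<close>])
    then have "D field_differentiable (at z)"
      using zb by (simp add: holomorphic_on_imp_differentiable_at[OF _ open_ball])
    then show "D field_differentiable (at z within S)"
      using field_differentiable_at_within by blast
  qed
  have dD: "(D has_field_derivative deriv D z) (at z)" if "z \<in> S" for z
    by (rule holomorphic_derivI[OF holD \<open>open S\<close> that])
  have cont: "continuous_on S (deriv D)"
    by (intro holomorphic_on_imp_continuous_on holomorphic_deriv holD \<open>open S\<close>)
  show ?thesis
    unfolding harmonic_on_def
  proof (intro conjI exI ballI)
    show "(u has_derivative (\<lambda>h. Re (D z) * Re h + (- Im (D z)) * Im h)) (at z)" if "z \<in> S" for z
      using du[OF that, of z] r(1)[OF that] by (simp add: D_def)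
    show "((\<lambda>z. Re (D z)) has_derivative (\<lambda>h. Re (deriv D z) * Re h + (- Im (deriv D z)) * Im h)) (at z)" if "z \<in> S" for z
      by (rule Re_has_derivative(1)[OF dD[OF that]])
    show "((\<lambda>z. - Im (D z)) has_derivative (\<lambda>h. (- Im (deriv D z)) * Re h + (- Re (deriv D z)) * Im h)) (at z)" if "z \<in> S" for z
      by (rule Re_has_derivative(2)[OF dD[OF that]])
  qed (use cont \<open>open S\<close> in \<open>auto intro!: continuous_intros\<close>)
qed

lemma reflect_poly_near_infinity:
  fixes P :: "complex poly"
  assumes "P \<noteq> 0" "0 < e"
  obtains X where "0 < X" "\<And>w. X \<le> cmod w \<Longrightarrow> cmod (poly (reflect_poly P) (1 / w) / lead_coeff P - 1) < e"
proof -
  let ?T = "\<lambda>z. poly (reflect_poly P) z / lead_coeff P - 1"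
  have "open {z. cmod (?T z) < e}" by (intro open_Collect_less continuous_intros) (use assms in auto)
  moreover have "0 \<in> {z. cmod (?T z) < e}" using assms by simp
  ultimately obtain d where d: "0 < d" "\<And>z. dist z 0 < d \<Longrightarrow> cmod (?T z) < e"
    unfolding open_dist by blast
  show ?thesis
  proof (rule that[of "2 / d"])
    fix w :: complex assume w: "2 / d \<le> cmod w"
    have "0 < 2 / d" using d by simp
    then have "0 < cmod w" using w by linarith
    then have "cmod (1 / w) < d" using w d by (simp add: norm_divide field_simps)
    then show "cmod (?T (1 / w)) < e" by (intro d(2)) simp
  qed (use d in simp)
qed

text \<open>
  A radius beyond which \<open>P\<close> at least doubles the modulus, \<open>P w / (c w\<^sup>d)\<close> has a well-behaved logarithm
  (\<open>c\<close> the leading coefficient, \<open>d\<close> the degree), and \<open>ln \<bar>w\<bar>\<close> outweighs the corrections that turn it into the Green function.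
\<close>
locale escape_radius =
  fixes P :: "complex poly" and R :: real
  assumes degP: "2 \<le> degree P" and R_ge_1: "1 \<le> R"
    and expanding: "\<And>w. R \<le> cmod w \<Longrightarrow> 2 * cmod w \<le> cmod (poly P w)"
    and near: "\<And>w. R \<le> cmod w \<Longrightarrow> cmod (poly (reflect_poly P) (1 / w) / lead_coeff P - 1) < 1/2"
    and R_big: "2 + \<bar>ln (cmod (lead_coeff P))\<bar> < ln R"

lemma escape_radius_exists:
  fixes P :: "complex poly"
  assumes "2 \<le> degree P"
  shows "\<exists>R. escape_radius P R"
proof -
  have "P \<noteq> 0" using assms by auto
  obtain R1 where R1: "1 \<le> R1" "\<And>w. R1 \<le> cmod w \<Longrightarrow> cmod (lead_coeff P) / 2 * cmod w ^ degree P \<le> cmod (poly P w)"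
    using poly_growth[OF \<open>P \<noteq> 0\<close>] by metis
  obtain X where X: "0 < X" "\<And>w. X \<le> cmod w \<Longrightarrow> cmod (poly (reflect_poly P) (1 / w) / lead_coeff P - 1) < 1/2"
    using reflect_poly_near_infinity[OF \<open>P \<noteq> 0\<close>, of "1/2"] by auto
  define a where "a = cmod (lead_coeff P)"
  have a: "0 < a" using \<open>P \<noteq> 0\<close> by (simp add: a_def)
  define R where "R = R1 + X + 4 / a + exp (3 + \<bar>ln a\<bar>)"
  have pos: "0 < 4 / a" "0 < exp (3 + \<bar>ln a\<bar>)" using a by simp_all
  have R: "R1 \<le> R" "X \<le> R" "4 / a \<le> R" "exp (3 + \<bar>ln a\<bar>) \<le> R" "1 \<le> R"
    using R1 X pos unfolding R_def by linarith+
  show ?thesis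
  proof (intro exI[of _ R], unfold_locales)
    show "2 * cmod w \<le> cmod (poly P w)" if "R \<le> cmod w" for w
    proof -
      have w1: "1 \<le> cmod w" "4 / a \<le> cmod w" using that R by linarith+
      then have "2 \<le> a / 2 * cmod w" using a by (simp add: field_simps)
      then have "2 * cmod w \<le> a / 2 * cmod w * cmod w" using w1 by (intro mult_right_mono) auto
      also have "\<dots> = a / 2 * cmod w ^ 2" by (simp add: power2_eq_square)
      also have "\<dots> \<le> a / 2 * cmod w ^ degree P" using w1 a assms by (intro mult_left_mono power_increasing) auto
      also have "\<dots> \<le> cmod (poly P w)" using R1(2)[of w] that R(1) by (simp add: a_def)
      finally show ?thesis .
    qed
    have "ln (exp (3 + \<bar>ln a\<bar>)) \<le> ln R" using R pos by (intro ln_mono) auto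
    then show "2 + \<bar>ln (cmod (lead_coeff P))\<bar> < ln R" by (simp add: a_def[symmetric])
    show "cmod (poly (reflect_poly P) (1 / w) / lead_coeff P - 1) < 1/2" if "R \<le> cmod w" for w
      using X(2)[of w] that R(2) by linarith
  qed (use assms R in auto)
qed

lemma poly_funpow: "\<exists>q. \<forall>z::complex. (poly P ^^ n) z = poly q z"
proof (induction n)
  case 0
  show ?case by (intro exI[of _ "[:0,1:]"]) simp
next
  case (Suc n)
  then obtain q where "\<forall>z. (poly P ^^ n) z = poly q z" by blast
  then show ?case by (intro exI[of _ "pcompose P q"]) (simp add: poly_pcompose)
qed

lemma holomorphic_funpow_poly: "(poly P ^^ n) holomorphic_on S"
proof -
  obtain q where "\<forall>z. (poly P ^^ n) z = poly q z" using poly_funpow by blast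
  then have "(poly P ^^ n) = poly q" by auto
  then show ?thesis by (auto intro!: holomorphic_intros)
qed

context escape_radius
begin

abbreviation it :: "nat \<Rightarrow> complex \<Rightarrow> complex" where "it n \<equiv> poly P ^^ n"

lemma cont_it: "continuous_on S (it n)"
  by (rule holomorphic_on_imp_continuous_on[OF holomorphic_funpow_poly])

lemma it_growth: "R \<le> cmod w \<Longrightarrow> 2 ^ n * cmod w \<le> cmod (it n w)"
proof (induction n)
  case (Suc n)
  have "1 * cmod w \<le> 2 ^ n * cmod w" by (intro mult_right_mono) auto
  then have "R \<le> cmod (it n w)" using Suc by linarith
  then show ?case using expanding[of "it n w"] Suc by simp
qed simp

lemma it_ge: "R \<le> cmod w \<Longrightarrow> cmod w \<le> cmod (it n w)"
  using it_growth[of w n] mult_right_mono[of 1 "2 ^ n" "cmod w"] by simp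

lemma it_gt: "R < cmod w \<Longrightarrow> R < cmod (it n w)"
  using it_ge[of w n] by linarith

lemma it_escape_strict: "R \<le> cmod (it n z) \<Longrightarrow> R < cmod (it (Suc n) z)"
  using expanding[of "it n z"] R_ge_1 by simp

lemma filled_julia_iff: "z \<in> filled_julia P \<longleftrightarrow> (\<forall>n. cmod (it n z) < R)"
proof
  assume z: "z \<in> filled_julia P"
  show "\<forall>n. cmod (it n z) < R"
  proof (rule ccontr)
    assume "\<not> ?thesis"
    then obtain n where n: "R \<le> cmod (it n z)" by (auto simp: not_less)
    obtain B where B: "\<And>m. 1 \<le> m \<Longrightarrow> cmod (it m z) \<le> B"
      using z unfolding filled_julia_def bounded_iff by auto
    obtain k where k: "B < 2 ^ k" using real_arch_pow[of 2 B] by auto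
    have "2 ^ Suc k * 1 \<le> 2 ^ Suc k * cmod (it n z)" using n R_ge_1 by (intro mult_left_mono) auto
    also have "\<dots> \<le> cmod (it (Suc k) (it n z))" by (rule it_growth[OF n])
    also have "\<dots> = cmod (it (Suc k + n) z)" by (simp only: funpow_add o_apply)
    also have "\<dots> \<le> B" by (intro B) simp
    finally have "2 * 2 ^ k \<le> B" by simp
    moreover have "(0::real) < 2 ^ k" by simp
    ultimately show False using k by linarith
  qed
next
  assume "\<forall>n. cmod (it n z) < R"
  then show "z \<in> filled_julia P"
    unfolding filled_julia_def bounded_iff by (auto intro!: exI[of _ R] less_imp_le)
qed

text \<open>
  An orbit point of modulus exactly \<open>R\<close> is followed by one of larger modulus. The closed condition
  shows that the set is compact, the open one that points nearby stay bounded for many steps.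
\<close>
lemma filled_julia_iff_le: "z \<in> filled_julia P \<longleftrightarrow> (\<forall>n. cmod (it n z) \<le> R)"
  unfolding filled_julia_iff using it_escape_strict by (meson leD less_imp_le not_less)

lemma compact_filled_julia: "compact (filled_julia P)"
proof -
  have "filled_julia P = (\<Inter>n. {z. cmod (it n z) \<le> R})" by (auto simp: filled_julia_iff_le)
  moreover have "closed (\<Inter>n. {z. cmod (it n z) \<le> R})"
    by (intro closed_INT ballI closed_Collect_le continuous_intros cont_it)
  ultimately have "closed (filled_julia P)" by simp
  moreover have "filled_julia P \<subseteq> cball 0 R"
    unfolding subset_iff by (metis filled_julia_iff_le funpow_0 mem_cball_0)
  then have "bounded (filled_julia P)" using bounded_cball bounded_subset by blast
  ultimately show ?thesis by (simp add: compact_eq_bounded_closed)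
qed

text \<open>
  The iterates of \<open>P\<close> are themselves polynomials bounded by \<open>R\<close> on the filled Julia set.
\<close>
lemma polynomial_hull_filled_julia:
  assumes "filled_julia P \<noteq> {}"
  shows "polynomial_hull (filled_julia P) = filled_julia P"
proof
  show "filled_julia P \<subseteq> polynomial_hull (filled_julia P)"
    by (rule polynomial_hull_superset[OF compact_filled_julia])
  show "polynomial_hull (filled_julia P) \<subseteq> filled_julia P"
  proof
    fix z assume z: "z \<in> polynomial_hull (filled_julia P)"
    have "cmod (it n z) \<le> R" for n
    proof -
      obtain q where q: "\<forall>z. it n z = poly q z" using poly_funpow by blast
      have "cmod (poly q w) \<le> R" if "w \<in> filled_julia P" for w
        using that q unfolding filled_julia_iff_le by metis
      then have "cmod (poly q z) \<le> R" by (rule poly_le_on_polynomial_hull[OF z assms])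
      then show ?thesis using q by simp
    qed
    then show "z \<in> filled_julia P" by (simp add: filled_julia_iff_le)
  qed
qed

text \<open>
  The logarithm of \<open>P w / (c w\<^sup>d)\<close>, where \<open>c\<close> is the leading coefficient and \<open>d\<close> the degree; written with the reflected
  polynomial, it is visibly small near infinity.
\<close>
definition boettcher_term :: "complex \<Rightarrow> complex" where
  "boettcher_term w = Ln (poly (reflect_poly P) (1 / w) / lead_coeff P)"

abbreviation d :: real where "d \<equiv> real (degree P)"

definition log_correction :: "complex \<Rightarrow> complex" where
  "log_correction w = (\<Sum>k. boettcher_term (it k w) / of_real (d ^ Suc k))"

text \<open>
  The logarithm of the modulus of the Boettcher coordinate of \<open>P\<close> at infinity, normalised to satisfy
  \<open>outer_green (P w) = d * outer_green w\<close>.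
\<close>
definition outer_green :: "complex \<Rightarrow> real" where
  "outer_green w = ln (cmod w) + ln (cmod (lead_coeff P)) / (d - 1) + Re (log_correction w)"

lemma lead_nz: "lead_coeff P \<noteq> 0" using degP by auto

lemma quotient_bounds:
  assumes "R \<le> cmod w"
  shows "poly (reflect_poly P) (1 / w) / lead_coeff P \<notin> \<real>\<^sub>\<le>\<^sub>0"
    and "cmod (boettcher_term w) \<le> 2 * cmod (poly (reflect_poly P) (1 / w) / lead_coeff P - 1)"
    and "cmod (boettcher_term w) \<le> 1"
proof -
  define T where "T = poly (reflect_poly P) (1 / w) / lead_coeff P - 1"
  have T: "cmod T < 1/2" using near[OF assms] by (simp add: T_def)
  have eq: "poly (reflect_poly P) (1 / w) / lead_coeff P = 1 + T" by (simp add: T_def)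
  have "\<bar>Re T\<bar> < 1/2" using abs_Re_le_cmod[of T] T by linarith
  then show "poly (reflect_poly P) (1 / w) / lead_coeff P \<notin> \<real>\<^sub>\<le>\<^sub>0"
    unfolding eq by (auto simp: complex_nonpos_Reals_iff)
  show *: "cmod (boettcher_term w) \<le> 2 * cmod (poly (reflect_poly P) (1 / w) / lead_coeff P - 1)"
    unfolding boettcher_term_def eq using norm_Ln_le[OF T] by simp
  then show "cmod (boettcher_term w) \<le> 1" using near[OF assms] by linarith
qed

lemma ln_cmod_poly:
  assumes "R \<le> cmod w"
  shows "ln (cmod (poly P w)) = d * ln (cmod w) + ln (cmod (lead_coeff P)) + Re (boettcher_term w)"
proof -
  let ?q = "poly (reflect_poly P) (1 / w) / lead_coeff P"
  have w: "w \<noteq> 0" using assms R_ge_1 by auto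
  have q: "?q \<noteq> 0" using quotient_bounds(1)[OF assms] by auto
  have "poly P w = w ^ degree P * (lead_coeff P * ?q)"
    using poly_conv_reflect[OF w, of P] lead_nz by simp
  then have "cmod (poly P w) = cmod w ^ degree P * (cmod (lead_coeff P) * cmod ?q)"
    by (simp only: norm_mult norm_power)
  then have "ln (cmod (poly P w)) = d * ln (cmod w) + (ln (cmod (lead_coeff P)) + ln (cmod ?q))"
    using w q lead_nz by (simp add: ln_mult ln_realpow del: norm_divide)
  then show ?thesis using q by (simp add: boettcher_term_def)
qed

lemma d_ge_2: "2 \<le> d" using degP by simp

lemma inverse_d_powers_sums: "(\<lambda>k. 1 / d ^ Suc k) sums (1 / (d - 1))"
proof -
  have "(\<lambda>k. (1 / d) ^ Suc k) sums (1 / d / (1 - 1 / d))"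
    using sums_mult[OF geometric_sums[of "1 / d"], of "1 / d"] d_ge_2 by simp
  moreover have "1 / x / (1 - 1 / x) = 1 / (x - 1)" if "2 \<le> x" for x :: real
    using that by (simp add: field_simps)
  ultimately show ?thesis using d_ge_2 by (simp only: power_one_over)
qed

lemma log_correction_bound:
  assumes "\<And>k. cmod (boettcher_term (it k w)) \<le> e"
  shows "summable (\<lambda>k. boettcher_term (it k w) / of_real (d ^ Suc k))" "cmod (log_correction w) \<le> e"
proof -
  have le: "cmod (boettcher_term (it k w) / of_real (d ^ Suc k)) \<le> e * (1 / d ^ Suc k)" for k
    using assms[of k] d_ge_2 by (simp add: norm_divide norm_power divide_right_mono del: power_Suc)
  have S: "(\<lambda>k. e * (1 / d ^ Suc k)) sums (e * (1 / (d - 1)))" by (rule sums_mult[OF inverse_d_powers_sums])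
  show "summable (\<lambda>k. boettcher_term (it k w) / of_real (d ^ Suc k))"
    by (rule summable_comparison_test'[OF sums_summable[OF S], of 0]) (use le in auto)
  have "cmod (log_correction w) \<le> (\<Sum>k. e * (1 / d ^ Suc k))"
    unfolding log_correction_def by (rule norm_suminf_le[OF le sums_summable[OF S]])
  also have "\<dots> = e * (1 / (d - 1))" by (rule sums_unique[OF S, symmetric])
  also have "\<dots> \<le> e * 1"
    using d_ge_2 order_trans[OF norm_ge_zero assms[of 0]] by (intro mult_left_mono) (auto simp: field_simps)
  finally show "cmod (log_correction w) \<le> e" by simp
qed

lemma log_correction_le_1: "R \<le> cmod w \<Longrightarrow> cmod (log_correction w) \<le> 1"
  by (rule log_correction_bound(2)) (meson it_ge order_trans quotient_bounds(3))

text \<open>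
  The series is built to satisfy this recursion: together with \<open>ln_cmod_poly\<close> it turns into
  \<open>G(P w) = d G(w)\<close> for \<open>G = outer_green\<close>.
\<close>
lemma log_correction_poly:
  assumes "R \<le> cmod w"
  shows "log_correction (poly P w) = of_real d * log_correction w - boettcher_term w"
proof -
  have "cmod (boettcher_term (it k w)) \<le> 1" for k
    using it_ge[OF assms, of k] assms by (intro quotient_bounds(3)) linarith
  then have sm: "summable (\<lambda>k. boettcher_term (it k w) / of_real (d ^ Suc k))"
    by (rule log_correction_bound(1))
  have "log_correction w = boettcher_term w / of_real d + (\<Sum>k. boettcher_term (it (Suc k) w) / of_real (d ^ Suc (Suc k)))"
    using suminf_split_head[OF sm] unfolding log_correction_def by simp
  also have "(\<Sum>k. boettcher_term (it (Suc k) w) / of_real (d ^ Suc (Suc k))) =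
      (\<Sum>k. boettcher_term (it k (poly P w)) / of_real (d ^ Suc k) / of_real d)"
    by (simp add: funpow_swap1 mult.commute)
  also have "\<dots> = log_correction (poly P w) / of_real d"
  proof -
    have "cmod (boettcher_term (it k (poly P w))) \<le> 1" for k
    proof -
      have "it k (poly P w) = it (Suc k) w" by (simp add: funpow_swap1)
      then show ?thesis using \<open>\<And>k. cmod (boettcher_term (it k w)) \<le> 1\<close> by metis
    qed
    then show ?thesis unfolding log_correction_def
      by (rule suminf_divide[OF log_correction_bound(1)])
  qed
  finally show ?thesis using d_ge_2 by (simp add: field_simps)
qed

lemma outer_green_poly:
  assumes "R \<le> cmod w"
  shows "outer_green (poly P w) = d * outer_green w"
proof -
  have "ln (cmod (lead_coeff P)) + ln (cmod (lead_coeff P)) / (d - 1) = d * (ln (cmod (lead_coeff P)) / (d - 1))"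
    using d_ge_2 by (simp add: field_simps)
  then show ?thesis
    unfolding outer_green_def ln_cmod_poly[OF assms] log_correction_poly[OF assms]
    by (simp add: distrib_left)
qed

lemma outer_green_it: "R \<le> cmod w \<Longrightarrow> outer_green (it n w) = d ^ n * outer_green w"
proof (induction n)
  case (Suc n)
  then show ?case using outer_green_poly[of "it n w"] it_ge[of w n] by simp
qed simp

lemma outer_green_pos:
  assumes "R \<le> cmod w" shows "0 < outer_green w"
proof -
  have "\<bar>Re (log_correction w)\<bar> \<le> 1" using log_correction_le_1[OF assms] abs_Re_le_cmod[of "log_correction w"] by linarith
  moreover have "\<bar>ln (cmod (lead_coeff P)) / (d - 1)\<bar> \<le> \<bar>ln (cmod (lead_coeff P))\<bar>"
    using d_ge_2 by (simp add: abs_divide divide_le_eq mult_le_cancel_left1)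
  moreover have "ln R \<le> ln (cmod w)" using assms R_ge_1 by (intro ln_mono) auto
  ultimately show ?thesis using R_big unfolding outer_green_def by linarith
qed

lemma holomorphic_log_correction: "log_correction holomorphic_on {w. R < cmod w}"
proof -
  let ?U = "{w. R < cmod w}"
  let ?t = "\<lambda>k w. boettcher_term (it k w) / of_real (d ^ Suc k)"
  have openU: "open ?U" by (intro open_Collect_less continuous_intros)
  have lim: "uniform_limit ?U (\<lambda>n w. \<Sum>k<n. ?t k w) log_correction sequentially"
    unfolding log_correction_def[abs_def]
  proof (rule Weierstrass_m_test)
    fix k w assume "w \<in> ?U"
    then have "cmod (boettcher_term (it k w)) \<le> 1"
      using it_gt[of w k] by (intro quotient_bounds(3)) auto
    then show "norm (?t k w) \<le> 1 / d ^ Suc k"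
      using d_ge_2 by (simp add: norm_divide norm_power divide_right_mono del: power_Suc)
  qed (rule sums_summable[OF inverse_d_powers_sums])
  show ?thesis
  proof (rule holomorphic_uniform_sequence[OF openU])
    fix n
    have "boettcher_term holomorphic_on ?U"
      unfolding boettcher_term_def[abs_def]
      using R_ge_1 lead_nz quotient_bounds(1)
      by (intro holomorphic_intros) auto
    then have "(\<lambda>w. boettcher_term (it k w)) holomorphic_on ?U" for k
      using holomorphic_on_compose_gen[OF holomorphic_funpow_poly[of k P ?U], of boettcher_term ?U] it_gt
      by (auto simp: o_def)
    then show "(\<lambda>w. \<Sum>k<n. ?t k w) holomorphic_on ?U"
      using d_ge_2 by (intro holomorphic_intros) auto
  next
    fix x assume "x \<in> ?U"
    then obtain r where "0 < r" "cball x r \<subseteq> ?U" using openU open_contains_cball by blast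
    then show "\<exists>r>0. cball x r \<subseteq> ?U \<and> uniform_limit (cball x r) (\<lambda>n w. \<Sum>k<n. ?t k w) log_correction sequentially"
      using uniform_limit_on_subset[OF lim] by blast
  qed
qed

text \<open>
  The extension forced by the functional equation from the neighbourhood of infinity to all escaping points.
\<close>
definition julia_green :: "complex \<Rightarrow> real" where
  "julia_green z = (if z \<in> filled_julia P then 0 else
     (let n = (LEAST n. R < cmod (it n z)) in outer_green (it n z) / d ^ n))"

lemma escapes: "z \<notin> filled_julia P \<Longrightarrow> \<exists>n. R < cmod (it n z)"
  unfolding filled_julia_iff_le by (auto simp: not_le)

text \<open>
  By the functional equation the first escape time can be replaced by any later one. In particular, near a given point one
  and the same \<open>n\<close> may be used.
\<close>
lemma julia_green_eq:
  assumes "R < cmod (it n z)"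
  shows "julia_green z = outer_green (it n z) / d ^ n"
proof -
  define m where "m = (LEAST n. R < cmod (it n z))"
  have m: "R < cmod (it m z)" unfolding m_def using assms by (rule LeastI)
  have "m \<le> n" unfolding m_def using assms by (rule Least_le)
  then have "it n z = it (n - m) (it m z)" by (metis funpow_add le_add_diff_inverse2 o_apply)
  then have "outer_green (it n z) = d ^ (n - m) * outer_green (it m z)"
    using outer_green_it[of "it m z" "n - m"] m by simp
  moreover have "d ^ n = d ^ (n - m) * d ^ m" using \<open>m \<le> n\<close> by (simp add: power_add[symmetric])
  ultimately have "outer_green (it n z) / d ^ n = outer_green (it m z) / d ^ m" using d_ge_2 by simp
  moreover have "z \<notin> filled_julia P" using assms unfolding filled_julia_iff_le by (auto simp: not_le)
  ultimately show ?thesis by (simp add: julia_green_def m_def Let_def)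
qed

lemma julia_green_it: "julia_green z = julia_green (it n z) / d ^ n"
proof (cases "z \<in> filled_julia P")
  case True
  have "it k (it n z) = it (k + n) z" for k by (simp add: funpow_add)
  then have "it n z \<in> filled_julia P" using True unfolding filled_julia_iff by metis
  then show ?thesis using True by (simp add: julia_green_def)
next
  case False
  then obtain m where m: "R < cmod (it m z)" using escapes by blast
  have eq: "it (n + m) z = it n (it m z)" "it (n + m) z = it m (it n z)"
    by (simp_all only: funpow_add o_apply, metis comp_apply funpow_add add.commute)
  then have nm: "R < cmod (it (n + m) z)" using it_gt[OF m] by metis
  have "julia_green z = outer_green (it (n + m) z) / d ^ (n + m)" by (rule julia_green_eq[OF nm])
  moreover have "julia_green (it n z) = outer_green (it (n + m) z) / d ^ m"
    unfolding eq(2) by (rule julia_green_eq) (use nm eq in metis)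
  ultimately show ?thesis by (simp add: power_add mult.commute)
qed

lemma julia_green_nonneg: "0 \<le> julia_green z"
  and julia_green_pos: "z \<notin> filled_julia P \<Longrightarrow> 0 < julia_green z"
proof -
  show pos: "0 < julia_green z" if nz: "z \<notin> filled_julia P"
  proof -
    obtain n where n: "R < cmod (it n z)" using escapes[OF nz] by blast
    then have "0 < outer_green (it n z)" by (intro outer_green_pos) simp
    then show ?thesis unfolding julia_green_eq[OF n] using d_ge_2 by simp
  qed
  show "0 \<le> julia_green z" using pos by (cases "z \<in> filled_julia P") (auto simp: julia_green_def intro: less_imp_le)
qed

text \<open>
  At the first escape time from the disc of radius \<open>R\<close> the orbit has just been mapped from that disc,
  so it is still in a fixed compact set.
\<close>
lemma julia_green_bounded: "\<exists>M\<ge>0. \<forall>z. cmod z \<le> R \<longrightarrow> julia_green z \<le> M"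
proof -
  have "bounded (poly P ` cball 0 R)"
    by (intro compact_imp_bounded compact_continuous_image continuous_intros) auto
  then obtain B where B: "0 < B" "\<And>z. cmod z \<le> R \<Longrightarrow> cmod (poly P z) \<le> B"
    unfolding bounded_pos by auto
  define M where "M = \<bar>ln B\<bar> + \<bar>ln (cmod (lead_coeff P)) / (d - 1)\<bar> + 1"
  show ?thesis
  proof (intro exI[of _ M] conjI allI impI)
    show "0 \<le> M" by (simp add: M_def)
    fix z assume z: "cmod z \<le> R"
    show "julia_green z \<le> M"
    proof (cases "z \<in> filled_julia P")
      case True
      then show ?thesis using \<open>0 \<le> M\<close> by (simp add: julia_green_def)
    next
      case False
      define n where "n = (LEAST n. R < cmod (it n z))"
      have n: "R < cmod (it n z)" unfolding n_def using escapes[OF False] by (rule LeastI_ex)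
      then obtain k where k: "n = Suc k" using z by (cases n) auto
      have "\<not> R < cmod (it k z)" using not_less_Least[of k "\<lambda>n. R < cmod (it n z)"] k by (simp add: n_def)
      then have up: "cmod (it n z) \<le> B" using B(2)[of "it k z"] by (simp add: k)
      have "0 < cmod (it n z)" using n R_ge_1 by linarith
      then have "ln (cmod (it n z)) \<le> ln B" using up by (intro ln_mono) auto
      moreover have "Re (log_correction (it n z)) \<le> 1"
        using log_correction_le_1[of "it n z"] complex_Re_le_cmod[of "log_correction (it n z)"] n by linarith
      ultimately have "outer_green (it n z) \<le> M" unfolding outer_green_def M_def by linarith
      have pos: "0 \<le> outer_green (it n z)" using outer_green_pos[of "it n z"] n by simp
      have "(1::real) \<le> d ^ n" using d_ge_2 by (intro one_le_power) simp
      then have "outer_green (it n z) / d ^ n \<le> outer_green (it n z)" using pos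
        by (simp add: divide_le_eq mult_left_mono[of 1 "d ^ n" "outer_green (it n z)", simplified])
      then show ?thesis unfolding julia_green_eq[OF n] using \<open>outer_green (it n z) \<le> M\<close> by linarith
    qed
  qed
qed

text \<open>
  Points near \<open>\<zeta>\<close> stay in the disc of radius \<open>R\<close> for \<open>n\<close> steps, and the functional equation divides the
  uniform bound on that disc by \<open>d\<^sup>n\<close>.
\<close>
lemma julia_green_tendsto_0:
  assumes "\<zeta> \<in> filled_julia P"
  shows "(julia_green \<longlongrightarrow> 0) (at \<zeta>)"
proof (rule tendstoI)
  fix e :: real assume "0 < e"
  obtain M where M: "0 \<le> M" "\<And>z. cmod z \<le> R \<Longrightarrow> julia_green z \<le> M" using julia_green_bounded by blast
  obtain n where n: "M / e < 2 ^ n" using real_arch_pow[of 2 "M / e"] by auto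
  have "(2::real) ^ n \<le> d ^ n" using d_ge_2 by (intro power_mono) auto
  then have "M < e * d ^ n" using n \<open>0 < e\<close> by (simp add: field_simps) (smt (verit, ccfv_SIG) mult_left_mono)
  then have Me: "M / d ^ n < e" using d_ge_2 by (simp add: divide_less_eq)
  have "open {z. cmod (it n z) < R}" by (intro open_Collect_less continuous_intros cont_it)
  moreover have "\<zeta> \<in> {z. cmod (it n z) < R}" using assms by (simp add: filled_julia_iff)
  ultimately have "\<forall>\<^sub>F z in nhds \<zeta>. z \<in> {z. cmod (it n z) < R}" by (rule eventually_nhds_in_open)
  then have "\<forall>\<^sub>F z in at \<zeta>. z \<in> {z. cmod (it n z) < R}" by (auto simp: eventually_at_filter elim: eventually_mono)
  then show "\<forall>\<^sub>F z in at \<zeta>. dist (julia_green z) 0 < e"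
  proof eventually_elim
    case (elim z)
    have "julia_green z = julia_green (it n z) / d ^ n" by (rule julia_green_it)
    also have "\<dots> \<le> M / d ^ n" using M(2)[of "it n z"] elim by (intro divide_right_mono) auto
    also have "\<dots> < e" by (rule Me)
    finally show ?case using julia_green_nonneg[of z] by (simp add: dist_real_def)
  qed
qed

lemma log_correction_tendsto_0: "(log_correction \<longlongrightarrow> 0) at_infinity"
proof (rule tendstoI)
  fix e :: real assume "0 < e"
  have "P \<noteq> 0" using lead_nz by auto
  obtain X where X: "0 < X" "\<And>w. X \<le> cmod w \<Longrightarrow> cmod (poly (reflect_poly P) (1 / w) / lead_coeff P - 1) < e / 4"
    using reflect_poly_near_infinity[OF \<open>P \<noteq> 0\<close>, of "e / 4"] \<open>0 < e\<close> by auto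
  have "cmod (log_correction w) < e" if "max R X \<le> cmod w" for w
  proof -
    have "cmod (boettcher_term (it k w)) \<le> e / 2" for k
    proof -
      have "R \<le> cmod (it k w)" "X \<le> cmod (it k w)" using it_ge[of w k] that by auto
      then show ?thesis using quotient_bounds(2)[of "it k w"] X(2)[of "it k w"] by linarith
    qed
    then have "cmod (log_correction w) \<le> e / 2" by (rule log_correction_bound(2))
    then show ?thesis using \<open>0 < e\<close> by linarith
  qed
  then show "\<forall>\<^sub>F w in at_infinity. dist (log_correction w) 0 < e"
    unfolding eventually_at_infinity dist_norm by (intro exI[of _ "max R X"]) (simp del: max.bounded_iff)
qed

lemma julia_green_at_infinity:
  "((\<lambda>z. julia_green z - ln (cmod z)) \<longlongrightarrow> ln (cmod (lead_coeff P)) / (d - 1)) at_infinity"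
proof -
  have "((\<lambda>z. ln (cmod (lead_coeff P)) / (d - 1) + Re (log_correction z)) \<longlongrightarrow> ln (cmod (lead_coeff P)) / (d - 1) + Re 0) at_infinity"
    by (intro tendsto_intros log_correction_tendsto_0)
  moreover have "\<forall>\<^sub>F z in at_infinity. ln (cmod (lead_coeff P)) / (d - 1) + Re (log_correction z) = julia_green z - ln (cmod z)"
    unfolding eventually_at_infinity
  proof (intro exI[of _ "R + 1"] allI impI)
    fix z assume "R + 1 \<le> cmod z"
    then have "R < cmod (it 0 z)" by simp
    from julia_green_eq[OF this] show "ln (cmod (lead_coeff P)) / (d - 1) + Re (log_correction z) = julia_green z - ln (cmod z)"
      by (simp add: outer_green_def)
  qed
  ultimately show ?thesis by (simp add: tendsto_cong)
qed

lemma harmonic_julia_green: "harmonic_on julia_green (- filled_julia P)"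
proof (rule harmonic_on_if_locally_Re)
  show opn: "open (- filled_julia P)" using compact_filled_julia by (simp add: compact_imp_closed open_Compl)
  fix z assume "z \<in> - filled_julia P"
  then obtain n where n: "R < cmod (it n z)" using escapes by blast
  define U where "U = {z. R < cmod (it n z)}"
  have "open U" unfolding U_def by (intro open_Collect_less continuous_intros cont_it)
  moreover have "z \<in> U" using n by (simp add: U_def)
  ultimately obtain r where r: "0 < r" "ball z r \<subseteq> U" using open_contains_ball by blast
  have sub: "U \<subseteq> - filled_julia P" unfolding U_def by (auto simp: filled_julia_iff_le simp flip: not_le)
  have nz: "it n w \<noteq> 0" if "w \<in> ball z r" for w using that r R_ge_1 by (auto simp: U_def)
  obtain L where L: "L holomorphic_on ball z r" "\<And>w. w \<in> ball z r \<Longrightarrow> it n w = exp (L w)"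
    using contractible_imp_holomorphic_log[OF holomorphic_funpow_poly convex_imp_contractible[OF convex_ball] nz] by blast
  define F where "F w = (L w + of_real (ln (cmod (lead_coeff P)) / (d - 1)) + log_correction (it n w)) / of_real (d ^ n)" for w
  have "(\<lambda>w. log_correction (it n w)) holomorphic_on ball z r"
    using holomorphic_on_compose_gen[OF holomorphic_funpow_poly holomorphic_log_correction, of n P "ball z r"] r
    by (auto simp: o_def U_def)
  then have "F holomorphic_on ball z r"
    unfolding F_def using L(1) d_ge_2 by (intro holomorphic_intros) auto
  moreover have "julia_green w = Re (F w)" if "w \<in> ball z r" for w
  proof -
    have "R < cmod (it n w)" using that r by (auto simp: U_def)
    moreover have "ln (cmod (it n w)) = Re (L w)" using L(2)[OF that] by simp
    moreover have "Re (F w) = Re (L w + of_real (ln (cmod (lead_coeff P)) / (d - 1)) + log_correction (it n w)) / d ^ n"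
      unfolding F_def by (simp only: Re_divide_of_real)
    ultimately show ?thesis by (simp add: julia_green_eq outer_green_def)
  qed
  ultimately show "\<exists>r F. 0 < r \<and> ball z r \<subseteq> - filled_julia P \<and> F holomorphic_on ball z r \<and> (\<forall>w\<in>ball z r. julia_green w = Re (F w))"
    using r sub by blast
qed

lemma julia_green_is_green:
  assumes "filled_julia P \<noteq> {}"
  shows "is_green_function (filled_julia P) julia_green"
proof -
  have hull: "polynomial_hull (filled_julia P) = filled_julia P" by (rule polynomial_hull_filled_julia[OF assms])
  have D: "D_inf (filled_julia P) = - filled_julia P" by (simp add: D_inf_def hull)
  have "open (- filled_julia P)" using compact_filled_julia by (simp add: compact_imp_closed open_Compl)
  then have "frontier (- filled_julia P) \<subseteq> filled_julia P" by (auto simp: frontier_def interior_open)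
  then have "\<forall>\<zeta>\<in>frontier (- filled_julia P). (julia_green \<longlongrightarrow> 0) (at \<zeta> within - filled_julia P)"
    using julia_green_tendsto_0 by (blast intro: tendsto_within_subset)
  then show ?thesis
    unfolding is_green_function_def D hull
    using harmonic_julia_green julia_green_pos julia_green_at_infinity by (auto simp: julia_green_def)
qed

end

section \<open>The approximation theorem\<close>

theorem theorem4p2:
  fixes E :: "complex set" and \<epsilon> :: real
  assumes "regular_compact E"
    and "0 < \<epsilon>" and "\<epsilon> \<le> 1"
  shows "\<forall>s0>0. \<exists>s P. 0 < s \<and> s < s0 \<and> 2 \<le> degree P \<and>
           E \<subseteq> filled_julia P \<and>
           filled_julia P \<subseteq> green_sublevel E s \<and>
           green_sublevel E s \<subseteq> open_nbhd (polynomial_hull E) \<epsilon> \<and>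
           Gamma_dist E (filled_julia P) \<le> s \<and>
           hausdorff_dist (polynomial_hull E) (filled_julia P) \<le> \<epsilon>"
proof (intro allI impI)
  fix s0 :: real assume "0 < s0"
  obtain g where "compact E" and G: "is_green_function E g"
    using assms(1) unfolding regular_compact_def by blast
  have gE: "green_function E = g" by (rule green_function_eq[OF G])
  have hull_ne: "polynomial_hull E \<noteq> {}" by (rule green_polynomial_hull_nonempty[OF G])
  then have "E \<noteq> {}" using polynomial_hull_empty by auto
  have E_hull: "E \<subseteq> polynomial_hull E" by (rule polynomial_hull_superset[OF \<open>compact E\<close>])
  obtain s1 where s1: "0 < s1" "\<And>z. g z \<le> s1 \<Longrightarrow> infdist z (polynomial_hull E) < \<epsilon>"
    using sublevel_in_nbhd[OF G assms(2)] by blast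
  define s where "s = min s1 (s0 / 2)"
  have s: "0 < s" "s < s0" "s \<le> s1" using s1 \<open>0 < s0\<close> by (auto simp: s_def)
  obtain p where p: "0 < degree p" "\<And>k. g k = 0 \<Longrightarrow> cmod (poly p k) \<le> 1/2" "\<And>l. s \<le> g l \<Longrightarrow> 1 \<le> cmod (poly p l)"
    using lemniscate[OF G s(1)] by blast
  obtain a where "a \<in> polynomial_hull E" using hull_ne by blast
  then have "cmod (poly p a) \<le> 1/2" by (intro p(2)) (simp add: green_zero_iff[OF G])
  then obtain P where P: "2 \<le> degree P" "\<And>z. cmod (poly p z) \<le> 1/2 \<Longrightarrow> z \<in> filled_julia P"
    "\<And>z. z \<in> filled_julia P \<Longrightarrow> cmod (poly p z) < 1"
    using filled_julia_near_lemniscate[OF p(1)] by blast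
  define K where "K = filled_julia P"
  have hull_K: "polynomial_hull E \<subseteq> K"
    unfolding K_def using P(2) p(2) green_zero_iff[OF G] by blast
  then have E_K: "E \<subseteq> K" "K \<noteq> {}" using E_hull hull_ne by auto
  have g_K: "g z \<le> s" if "z \<in> K" for z
    using P(3)[of z] p(3)[of z] that unfolding K_def by force
  have near_hull: "infdist z (polynomial_hull E) < \<epsilon>" if "g z \<le> s" for z
    using s1(2)[of z] that s(3) by simp
  obtain R where "escape_radius P R" using escape_radius_exists[OF P(1)] by blast
  then interpret escape_radius P R .
  have G_K: "is_green_function K julia_green"
    using julia_green_is_green E_K(2) unfolding K_def by blast
  have zero: "green_function K z = 0" if "z \<in> K" for z
    unfolding green_function_eq[OF G_K] using that by (simp add: julia_green_def K_def)
  have "(SUP z\<in>K. green_function E z) \<le> s"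
    unfolding gE using E_K(2) g_K by (intro cSUP_least) auto
  moreover have "(SUP z\<in>E. green_function K z) \<le> s"
    using \<open>E \<noteq> {}\<close> E_K(1) zero s(1) by (intro cSUP_least) auto
  ultimately have Gamma: "Gamma_dist E K \<le> s" unfolding Gamma_dist_def by simp
  have "(SUP a\<in>polynomial_hull E. infdist a K) \<le> \<epsilon>"
    using hull_ne hull_K assms(2) by (intro cSUP_least) (auto simp: infdist_zero)
  moreover have "(SUP b\<in>K. infdist b (polynomial_hull E)) \<le> \<epsilon>"
    using E_K(2) near_hull g_K by (intro cSUP_least less_imp_le) blast+
  ultimately have chi: "hausdorff_dist (polynomial_hull E) K \<le> \<epsilon>" unfolding hausdorff_dist_def by simp
  have "K \<subseteq> green_sublevel E s" using g_K by (auto simp: green_sublevel_def gE)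
  moreover have "green_sublevel E s \<subseteq> open_nbhd (polynomial_hull E) \<epsilon>"
    using near_hull hull_ne by (auto simp: green_sublevel_def open_nbhd_def gE)
  ultimately show "\<exists>s P. 0 < s \<and> s < s0 \<and> 2 \<le> degree P \<and>
           E \<subseteq> filled_julia P \<and>
           filled_julia P \<subseteq> green_sublevel E s \<and>
           green_sublevel E s \<subseteq> open_nbhd (polynomial_hull E) \<epsilon> \<and>
           Gamma_dist E (filled_julia P) \<le> s \<and>
           hausdorff_dist (polynomial_hull E) (filled_julia P) \<le> \<epsilon>"
    using s P(1) E_K(1) Gamma chi unfolding K_def by blast
qed

end
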